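(* Let $(X,d)$ be a finite metric space with diameter $D$, endowed with a distribution $p$, and let $\varepsilon>0$. Suppose $(X,d,p)$ satisfies the doubling condition with constant $C>1$. Let $\{N_i:\log\frac{\varepsilon}{8}\le i\le\log D\}$ be a sequence in which each $N_i$ is a well separated $2^i$-net of $(X,d)$, and let $p_i$ be the distribution on $N_i$ obtained by assigning each point of $X$ to a nearest point of $N_i$ (see context). (Upper bound) There is an algorithm which, given sample access to an unknown distribution $q$ over $X$, - accepts with probability at least $2/3$ if $p=q$; - rejects with probability at least $2/3$ if $W_d(p,q)\ge\varepsilon$, and whose sample complexity is $$\tilde O\left(\max\left\{\max\left\{2^{2i}\varepsilon^{-2}\,\|p_i\|_{2/3},\ 2^i\varepsilon^{-1}\right\} : \log\tfrac{\varepsilon}{8}\le i\le\log D\right\}\right).$$ (Lower bound) Any algorithm for this task requires $$\Omega\left(\max\left\{\max\left\{2^{2i}\varepsilon^{-2}\,\left\|(p_i)^{-\max}_{-2^{-i}\varepsilon}\right\|_{2/3},\ 2^i\varepsilon^{-1}\right\} : \log\tfrac{\varepsilon}{8}\le i\le\log D\right\}\right)$$ many samples.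
   Context: A metric $d:X\times X\to\mathbb{R}_{\ge 0}$ satisfies $d(a,b)=d(b,a)$, $d(a,a)=0$ and the triangle inequality. The diameter is $D=\max_{a,b\in X}d(a,b)$. Logarithms are base 2 and $i$ ranges over integers. For $M\subset X$, $p(M)=\sum_{x\in M}p(x)$. Wasserstein distance: $W_d(p,q)=\inf_{M\in\mathrm{coup}(p,q)}\int d(x,y)\,dM(x,y)$, where $\mathrm{coup}(p,q)$ is the set of distributions on $X\times X$ with marginals $p$ and $q$. Doubling condition: with $B(x,r)=\{y\in X:d(x,y)\le r\}$, $(X,d,p)$ satisfies the doubling condition if there is a constant $C>1$ such that $p(B(x,2r))\le C\,p(B(x,r))$ for every $x\in X$ and $r>0$. Nets: $N\subset X$ is an $\eta$-net of $(X,d)$ if for every $x\in X$ there is $y\in N$ with $d(x,y)\le\eta$; it is an $\eta$-packing if $d(x,y)>\eta$ for all distinct $x,y\in N$; it is a well separated $\eta$-net if it is both. Distributions $p_i$: for $y\in X$ let $\pi_i(y)=\arg\min_{z\in N_i}d(z,y)$ (a fixed choice of minimizer), for $x\in N_i$ let $C_i(x)=\{y\in X:\pi_i(y)=x\}$, and set $p_i(x)=\sum_{y\in C_i(x)}p(y)$. Then $p_i$ is a probability distribution on $N_i$, regarded as a vector. For a nonnegative vector $v$, $\|v\|_{2/3}=\left(\sum_j v_j^{2/3}\right)^{3/2}$. For a probability vector $v$ and $\delta>0$, $v^{-\max}_{-\delta}$ denotes the vector obtained from $v$ by removing one element with the largest probability mass and then repeatedly removing the (remaining) element with the smallest probability mass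 until $\delta$ mass has been removed in this second step (or nothing remains; the empty vector has norm $0$). Sample access to $q$ means the (possibly randomized) algorithm receives i.i.d. samples from $q$; the algorithm knows $(X,d)$, $p$ and $\varepsilon$; its sample complexity is the number of samples it uses. The doubling constant $C$ is treated as a universal constant: constants in $O$, $\Omega$ may depend on $C$ but not otherwise on $X,d,p,q,\varepsilon$; $\tilde O$ additionally hides factors polylogarithmic in $D/\varepsilon$.
   Formalization: The lower bound is stated only when some q on X has W_d(p,q) ≥ ε; otherwise always accepting is a correct algorithm with 0 samples although the stated maximum can be positive (two points at distance 1, p uniform, ε = 0.9). *)

theory Defs
  imports "HOL-Probability.Probability" "HOL-Library.Multiset"
begin

text \<open>
  Finite metric spaces are given by a carrier set and a distance function, so that bounds can be
  stated uniformly over all finite spaces.  Distinct points at distance zero are allowed.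
  Distributions on \<open>X\<close> are elements of \<^typ>\<open>'a pmf\<close> whose support lies in \<open>X\<close>.
\<close>

definition metric_on :: "'a set \<Rightarrow> ('a \<Rightarrow> 'a \<Rightarrow> real) \<Rightarrow> bool" where
  "metric_on X d \<longleftrightarrow>
     (\<forall>a\<in>X. \<forall>b\<in>X. 0 \<le> d a b) \<and>
     (\<forall>a\<in>X. d a a = 0) \<and>
     (\<forall>a\<in>X. \<forall>b\<in>X. d a b = d b a) \<and>
     (\<forall>a\<in>X. \<forall>b\<in>X. \<forall>c\<in>X. d a c \<le> d a b + d b c)"

definition diam_on :: "'a set \<Rightarrow> ('a \<Rightarrow> 'a \<Rightarrow> real) \<Rightarrow> real" where
  "diam_on X d = Max ((\<lambda>(a, b). d a b) ` (X \<times> X))"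

definition coup :: "'a pmf \<Rightarrow> 'a pmf \<Rightarrow> ('a \<times> 'a) pmf set" where
  "coup p q = {M. map_pmf fst M = p \<and> map_pmf snd M = q}"

definition wasserstein :: "('a \<Rightarrow> 'a \<Rightarrow> real) \<Rightarrow> 'a pmf \<Rightarrow> 'a pmf \<Rightarrow> real" where
  "wasserstein d p q = (INF M\<in>coup p q. measure_pmf.expectation M (\<lambda>(x, y). d x y))"

definition ball_on :: "'a set \<Rightarrow> ('a \<Rightarrow> 'a \<Rightarrow> real) \<Rightarrow> 'a \<Rightarrow> real \<Rightarrow> 'a set" where
  "ball_on X d x r = {y \<in> X. d x y \<le> r}"

definition doubling :: "'a set \<Rightarrow> ('a \<Rightarrow> 'a \<Rightarrow> real) \<Rightarrow> 'a pmf \<Rightarrow> real \<Rightarrow> bool" where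
  "doubling X d p C \<longleftrightarrow>
     (\<forall>x\<in>X. \<forall>r>0. measure_pmf.prob p (ball_on X d x (2 * r))
        \<le> C * measure_pmf.prob p (ball_on X d x r))"

definition net :: "'a set \<Rightarrow> ('a \<Rightarrow> 'a \<Rightarrow> real) \<Rightarrow> real \<Rightarrow> 'a set \<Rightarrow> bool" where
  "net X d \<eta> N \<longleftrightarrow> N \<subseteq> X \<and> (\<forall>x\<in>X. \<exists>y\<in>N. d x y \<le> \<eta>)"

definition packing :: "'a set \<Rightarrow> ('a \<Rightarrow> 'a \<Rightarrow> real) \<Rightarrow> real \<Rightarrow> 'a set \<Rightarrow> bool" where
  "packing X d \<eta> N \<longleftrightarrow> N \<subseteq> X \<and> (\<forall>x\<in>N. \<forall>y\<in>N. x \<noteq> y \<longrightarrow> \<eta> < d x y)"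

definition well_separated_net ::
    "'a set \<Rightarrow> ('a \<Rightarrow> 'a \<Rightarrow> real) \<Rightarrow> real \<Rightarrow> 'a set \<Rightarrow> bool" where
  "well_separated_net X d \<eta> N \<longleftrightarrow> net X d \<eta> N \<and> packing X d \<eta> N"

text \<open>A choice of nearest points; ties may be broken arbitrarily.\<close>

definition nearest_map ::
    "'a set \<Rightarrow> ('a \<Rightarrow> 'a \<Rightarrow> real) \<Rightarrow> 'a set \<Rightarrow> ('a \<Rightarrow> 'a) \<Rightarrow> bool" where
  "nearest_map X d N \<pi> \<longleftrightarrow> (\<forall>y\<in>X. is_arg_min (\<lambda>z. d z y) (\<lambda>z. z \<in> N) (\<pi> y))"

definition cell :: "'a set \<Rightarrow> ('a \<Rightarrow> 'a) \<Rightarrow> 'a \<Rightarrow> 'a set" where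
  "cell X \<pi> x = {y \<in> X. \<pi> y = x}"

definition cell_mass :: "'a set \<Rightarrow> 'a pmf \<Rightarrow> ('a \<Rightarrow> 'a) \<Rightarrow> 'a \<Rightarrow> real" where
  "cell_mass X p \<pi> x = (\<Sum>y\<in>cell X \<pi> x. pmf p y)"

text \<open>
  The norm and the truncation below do not depend on the order of the entries of a vector, so the
  vector of cell masses is represented by the multiset of its entries.
\<close>

definition net_vec :: "'a set \<Rightarrow> 'a pmf \<Rightarrow> 'a set \<Rightarrow> ('a \<Rightarrow> 'a) \<Rightarrow> real multiset" where
  "net_vec X p N \<pi> = image_mset (cell_mass X p \<pi>) (mset_set N)"

definition norm23 :: "real multiset \<Rightarrow> real" where
  "norm23 v = (\<Sum>t\<in>#v. t powr (2/3)) powr (3/2)"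

text \<open>\<open>drop_mass \<delta> xs\<close> removes entries from the front until their sum is at least \<open>\<delta>\<close>.\<close>

fun drop_mass :: "real \<Rightarrow> real list \<Rightarrow> real list" where
  "drop_mass \<delta> [] = []"
| "drop_mass \<delta> (x # xs) = (if \<delta> \<le> 0 then x # xs else drop_mass (\<delta> - x) xs)"

text \<open>The sorted list is ascending: its last entry is a largest one.\<close>

definition trunc :: "real \<Rightarrow> real multiset \<Rightarrow> real multiset" where
  "trunc \<delta> v = mset (drop_mass \<delta> (butlast (sorted_list_of_multiset v)))"

text \<open>
  For a space of diameter zero there are no scales (\<open>log 0 = -\<infinity>\<close>); the conjunct \<open>0 < D\<close> is
  needed because \<^term>\<open>log 2 (0::real)\<close> is \<open>0\<close> in HOL.
\<close>

definition scales :: "real \<Rightarrow> real \<Rightarrow> int set" where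
  "scales D \<epsilon> = {i. 0 < D \<and> log 2 (\<epsilon> / 8) \<le> of_int i \<and> of_int i \<le> log 2 D}"

text \<open>
  All quantities maximised are positive; inserting \<open>0\<close> only matters if there are no scales, which
  forces \<open>D < \<epsilon>\<close>.
\<close>

definition upper_rate ::
    "'a set \<Rightarrow> ('a \<Rightarrow> 'a \<Rightarrow> real) \<Rightarrow> 'a pmf \<Rightarrow> real \<Rightarrow> (int \<Rightarrow> 'a set) \<Rightarrow> (int \<Rightarrow> 'a \<Rightarrow> 'a) \<Rightarrow> real" where
  "upper_rate X d p \<epsilon> N \<pi> =
     Max (insert 0 ((\<lambda>i. max (2 powi (2 * i) * \<epsilon> powi (-2) * norm23 (net_vec X p (N i) (\<pi> i)))
                             (2 powi i * \<epsilon> powi (-1)))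
                    ` scales (diam_on X d) \<epsilon>))"

definition lower_rate ::
    "'a set \<Rightarrow> ('a \<Rightarrow> 'a \<Rightarrow> real) \<Rightarrow> 'a pmf \<Rightarrow> real \<Rightarrow> (int \<Rightarrow> 'a set) \<Rightarrow> (int \<Rightarrow> 'a \<Rightarrow> 'a) \<Rightarrow> real" where
  "lower_rate X d p \<epsilon> N \<pi> =
     Max (insert 0 ((\<lambda>i. max (2 powi (2 * i) * \<epsilon> powi (-2) *
                                norm23 (trunc (2 powi (- i) * \<epsilon>) (net_vec X p (N i) (\<pi> i))))
                             (2 powi i * \<epsilon> powi (-1)))
                    ` scales (diam_on X d) \<epsilon>))"

text \<open>
  A randomized algorithm using \<open>n\<close> samples maps the list of samples to a random verdict, where
  \<^const>\<open>True\<close> means acceptance.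
\<close>

definition accept_prob :: "nat \<Rightarrow> ('a list \<Rightarrow> bool pmf) \<Rightarrow> 'a pmf \<Rightarrow> real" where
  "accept_prob n T q = pmf (bind_pmf (replicate_pmf n q) T) True"

definition reject_prob :: "nat \<Rightarrow> ('a list \<Rightarrow> bool pmf) \<Rightarrow> 'a pmf \<Rightarrow> real" where
  "reject_prob n T q = pmf (bind_pmf (replicate_pmf n q) T) False"

definition far_dists ::
    "'a set \<Rightarrow> ('a \<Rightarrow> 'a \<Rightarrow> real) \<Rightarrow> 'a pmf \<Rightarrow> real \<Rightarrow> 'a pmf set" where
  "far_dists X d p \<epsilon> = {q. set_pmf q \<subseteq> X \<and> \<epsilon> \<le> wasserstein d p q}"

definition is_tester ::
    "'a set \<Rightarrow> ('a \<Rightarrow> 'a \<Rightarrow> real) \<Rightarrow> 'a pmf \<Rightarrow> real \<Rightarrow> nat \<Rightarrow> ('a list \<Rightarrow> bool pmf) \<Rightarrow> bool" where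
  "is_tester X d p \<epsilon> n T \<longleftrightarrow>
     2/3 \<le> accept_prob n T p \<and> (\<forall>q\<in>far_dists X d p \<epsilon>. 2/3 \<le> reject_prob n T q)"

text \<open>
  If no distribution is \<open>\<epsilon>\<close>-far from \<open>p\<close>, always accepting is a tester without samples. The
  following shows that this only happens when \<open>D / \<epsilon>\<close> is bounded in terms of \<open>C\<close>.
\<close>

lemma far_dists_nonempty:
  assumes "finite X" "metric_on X d" "set_pmf p \<subseteq> X" "doubling X d p C" "C > 1"
    and D: "0 < diam_on X d" "4 * C\<^sup>2 * \<epsilon> \<le> 3 * diam_on X d"
  shows "far_dists X d p \<epsilon> \<noteq> {}"
proof -
  have X: "X \<noteq> {}" using assms(3) set_pmf_not_empty[of p] by blast
  define D where "D = diam_on X d"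
  have "D \<in> (\<lambda>(a, b). d a b) ` (X \<times> X)"
    unfolding D_def diam_on_def using X assms(1) by (intro Max_in) auto
  then obtain a b where ab: "a \<in> X" "b \<in> X" "d a b = D" by auto
  have le: "d x y \<le> D" if "x \<in> X" "y \<in> X" for x y
    unfolding D_def diam_on_def using that assms(1) by (intro Max_ge) auto
  have D0: "0 < D" using assms D_def by simp
  let ?P = "\<lambda>r. measure_pmf.prob p (ball_on X d a r)"
  have P1: "?P D = 1"
  proof -
    have "ball_on X d a D = X" using le ab by (auto simp: ball_on_def)
    thus ?thesis using assms(3) by (simp add: measure_pmf.prob_eq_1 AE_measure_pmf_iff subset_eq)
  qed
  have db: "?P (2 * r) \<le> C * ?P r" if "r > 0" for r
    using assms(4) ab(1) that unfolding doubling_def by blast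
  have "1 \<le> C * ?P (D/2)"
    using db[of "D/2"] D0 P1 by simp
  also have "\<dots> \<le> C * (C * ?P (D/4))"
    using db[of "D/4"] D0 assms(5) by (intro mult_left_mono) simp_all
  finally have "1 \<le> C * (C * ?P (D/4))" .
  hence mass: "1 \<le> C\<^sup>2 * ?P (D/4)" by (simp add: power2_eq_square mult.assoc)
  have cost: "\<epsilon> \<le> measure_pmf.expectation M (\<lambda>(x, y). d x y)"
    if "M \<in> coup p (return_pmf b)" for M
  proof -
    have M: "map_pmf fst M = p" "map_pmf snd M = return_pmf b" using that by (auto simp: coup_def)
    have sup: "x \<in> X \<and> y = b" if "(x, y) \<in> set_pmf M" for x y
    proof -
      have "x \<in> set_pmf (map_pmf fst M)" "y \<in> set_pmf (map_pmf snd M)"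
        using that by force+
      thus ?thesis using M assms(3) by auto
    qed
    have fin: "finite (set_pmf M)"
      using sup assms(1) by (intro finite_subset[of "set_pmf M" "X \<times> {b}"]) auto
    have "3 * D / 4 * ?P (D/4)
        = measure_pmf.expectation p (\<lambda>x. 3 * D / 4 * indicator (ball_on X d a (D/4)) x)"
      by simp
    also have "\<dots> = measure_pmf.expectation M
                     (\<lambda>z. 3 * D / 4 * indicator (ball_on X d a (D/4)) (fst z))"
      by (subst M(1)[symmetric]) (simp only: integral_map_pmf)
    also have "\<dots> \<le> measure_pmf.expectation M (\<lambda>(x, y). d x y)"
    proof (intro integral_mono_AE)
      show "AE z in measure_pmf M.
              3 * D / 4 * indicator (ball_on X d a (D/4)) (fst z) \<le> (case z of (x, y) \<Rightarrow> d x y)"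
      proof (subst AE_measure_pmf_iff, intro ballI)
        fix z assume z: "z \<in> set_pmf M"
        obtain x where x: "z = (x, b)" "x \<in> X" using sup z by (cases z) auto
        have "D \<le> d a x + d x b" "0 \<le> d x b"
          using assms(2) ab x unfolding metric_on_def by metis+
        thus "3 * D / 4 * indicator (ball_on X d a (D/4)) (fst z) \<le> (case z of (x, y) \<Rightarrow> d x y)"
          using x by (auto simp: indicator_def ball_on_def)
      qed
    qed (use fin in \<open>auto intro: integrable_measure_pmf_finite\<close>)
    finally have "3 * D / 4 * ?P (D/4) \<le> measure_pmf.expectation M (\<lambda>(x, y). d x y)" .
    moreover have "\<epsilon> \<le> 3 * D / 4 * ?P (D/4)"
    proof -
      have "C\<^sup>2 * \<epsilon> \<le> 3 * D / 4" using D(2) by (simp add: D_def)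
      also have "\<dots> \<le> 3 * D / 4 * (C\<^sup>2 * ?P (D/4))"
        using mass D0 by (simp add: mult_le_cancel_left1)
      finally have "C\<^sup>2 * \<epsilon> \<le> C\<^sup>2 * (3 * D / 4 * ?P (D/4))" by (simp add: mult_ac)
      thus ?thesis using assms(5) by (simp add: mult_le_cancel_left)
    qed
    ultimately show ?thesis by linarith
  qed
  have "pair_pmf p (return_pmf b) \<in> coup p (return_pmf b)"
    by (simp add: coup_def map_fst_pair_pmf map_snd_pair_pmf)
  hence "\<epsilon> \<le> wasserstein d p (return_pmf b)"
    unfolding wasserstein_def by (intro cINF_greatest cost) auto
  hence "return_pmf b \<in> far_dists X d p \<epsilon>" using ab by (simp add: far_dists_def)
  thus ?thesis by blast
qed

end

theory Submission
  imports Defs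
begin

text \<open>
  Upper bound. Composing the nearest-point maps from the finest scale upwards gives nested cells,
  whose masses exceed those of the given cells by a factor of at most \<open>C\<^sup>2\<close> by doubling. Matching
  mass greedily within the cells, finest scale first, bounds the Wasserstein distance by the sum
  over the scales of the scale times the total variation distance of the cell masses. A distant
  \<open>q\<close> is hence detected at one of the logarithmically many scales by an identity tester in total
  variation, whose sample complexity is governed by the \<open>2/3\<close>-norm.

  Lower bound. Move an amount \<open>\<xi>\<close> of mass, with independent random signs, between two balls of
  mass \<open>b\<close> around well separated points, for many disjoint pairs of such balls. A signed sum of
  cones over the balls is Lipschitz and certifies that the result is far from \<open>p\<close>, while a second
  moment computation shows that distinguishing it needs \<open>n\<^sup>2 \<Sum> (\<xi>\<^sup>2 / b)\<^sup>2 \<ge> 1\<close> up to a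
  constant. The optimal choice is \<open>\<xi> = \<alpha> b\<^bsup>2/3\<^esup>\<close>; where this exceeds \<open>b\<close>, the light cells that the
  truncation removes have enough mass to be used instead. A constant factor in the distance is
  gained by placing the balls on a coarser scale, which by doubling changes the masses only by
  constant factors. When the norm is bounded, two balls at the scale of the diameter suffice.
\<close>

section \<open>Finitely supported samples\<close>

text \<open>Nearest-point cells of different scales need not be nested, and passing unmatched mass
  on to the next scale works only for nested partitions. Composing the maps repairs this, and a
  geometric series keeps every point within twice the current scale of its representative. The
  thresholds \<open>\<eta> k\<close> give each of the \<open>levels\<close> scales a share
  \<open>\<epsilon> / (2 * levels)\<close> of the transport budget; the other half of
  \<open>\<epsilon>\<close> pays for movement inside the finest cells. Of the three logarithmic
  factors, two come from the square of \<open>\<eta>\<close> and one from the union bound over the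
  scales.

  In the lower bound, pairing the balls loses one largest element. This is harmless as soon as the
  sum of the \<open>b powr (2/3)\<close> is at least 2; for smaller sums the norm is bounded and an
  estimate of order \<open>(D / \<epsilon>) ^ 2\<close> for the sample size takes over, which also
  dominates the terms \<open>2 powi i / \<epsilon>\<close>. The coarsening exponent \<open>m\<close>
  with \<open>8 * C ^ 3 \<le> 2 ^ m\<close> makes the truncated mass exceed the mass to be moved by
  the factor \<open>2 * C ^ 3\<close>, which covers the loss in passing from cells to balls.\<close>

abbreviation expect :: "'a pmf \<Rightarrow> ('a \<Rightarrow> real) \<Rightarrow> real" where
  "expect q f \<equiv> measure_pmf.expectation q f"

lemma expect_eq_sum:
  assumes "finite X" "set_pmf q \<subseteq> X"
  shows "expect q f = (\<Sum>x\<in>X. pmf q x * f x)"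
  using assms by (subst integral_measure_pmf_real[of X]) (auto simp: mult.commute)

lemma expect_mono:
  assumes "finite (set_pmf q)" "\<And>x. x \<in> set_pmf q \<Longrightarrow> f x \<le> g x"
  shows "expect q f \<le> expect q g"
  using assms by (auto simp: expect_eq_sum[OF assms(1) order_refl] intro!: sum_mono mult_left_mono)

lemma expect_add:
  assumes "finite (set_pmf q)"
  shows "expect q (\<lambda>x. f x + g x) = expect q f + expect q g"
  using assms by (simp add: integrable_measure_pmf_finite)

lemma expect_sum:
  assumes "finite (set_pmf q)"
  shows "expect q (\<lambda>x. \<Sum>i\<in>I. f i x) = (\<Sum>i\<in>I. expect q (f i))"
  using assms by (simp add: integrable_measure_pmf_finite)

lemma finite_set_replicate_pmf:
  assumes "finite (set_pmf q)"
  shows "finite (set_pmf (replicate_pmf n q))"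
proof -
  have "set_pmf (replicate_pmf n q) = {xs. set xs \<subseteq> set_pmf q \<and> length xs = n}"
    by (auto simp: set_replicate_pmf lists_eq_set)
  thus ?thesis using assms by (simp add: finite_lists_length_eq)
qed

lemma expect_bind:
  assumes "finite (set_pmf q)" "\<And>x. x \<in> set_pmf q \<Longrightarrow> finite (set_pmf (f x))"
  shows "expect (q \<bind> f) h = expect q (\<lambda>x. expect (f x) h)"
  using assms by (subst pmf_expectation_bind[of "set_pmf q"]) (auto simp: expect_eq_sum[of "set_pmf q"])

lemma expect_replicate_Suc:
  assumes "finite (set_pmf q)"
  shows "expect (replicate_pmf (Suc n) q) F = expect q (\<lambda>x. expect (replicate_pmf n q) (\<lambda>xs. F (x # xs)))"
  using assms finite_set_replicate_pmf[OF assms]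
  by (simp add: expect_bind del: integral_map_pmf)

lemma expect_replicate_add:
  assumes "finite (set_pmf q)"
  shows "expect (replicate_pmf (m + n) q) F
       = expect (replicate_pmf m q) (\<lambda>xs. expect (replicate_pmf n q) (\<lambda>ys. F (xs @ ys)))"
  using assms finite_set_replicate_pmf[OF assms]
  by (simp add: replicate_pmf_distrib expect_bind)

lemma expect_replicate_sum_list:
  assumes "finite (set_pmf q)"
  shows "expect (replicate_pmf n q) (\<lambda>xs. \<Sum>x\<leftarrow>xs. h x) = real n * expect q h"
proof (induction n)
  case (Suc n)
  have "expect (replicate_pmf (Suc n) q) (\<lambda>xs. \<Sum>x\<leftarrow>xs. h x)
      = expect q (\<lambda>x. h x + expect (replicate_pmf n q) (\<lambda>xs. \<Sum>x\<leftarrow>xs. h x))"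
    by (simp add: expect_replicate_Suc[OF assms] expect_add finite_set_replicate_pmf assms
             del: replicate_pmf.simps)
  thus ?case by (simp add: Suc expect_add assms algebra_simps)
qed simp

lemma expect_replicate_sum_list_square:
  assumes "finite (set_pmf q)"
  shows "expect (replicate_pmf n q) (\<lambda>xs. (\<Sum>x\<leftarrow>xs. h x)\<^sup>2)
       = real n * (expect q (\<lambda>x. (h x)\<^sup>2) - (expect q h)\<^sup>2) + (real n)\<^sup>2 * (expect q h)\<^sup>2"
proof (induction n)
  case (Suc n)
  define R where "R = replicate_pmf n q"
  have R: "finite (set_pmf R)" by (simp add: R_def finite_set_replicate_pmf assms)
  let ?s = "\<lambda>xs. \<Sum>x\<leftarrow>xs. h x"
  have "expect (replicate_pmf (Suc n) q) (\<lambda>xs. (?s xs)\<^sup>2)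
      = expect q (\<lambda>x. expect R (\<lambda>xs. ((h x)\<^sup>2 + 2 * h x * ?s xs) + (?s xs)\<^sup>2))"
    by (simp add: expect_replicate_Suc[OF assms] R_def power2_sum algebra_simps del: replicate_pmf.simps)
  also have "\<dots> = expect q (\<lambda>x. ((h x)\<^sup>2 + h x * (2 * expect R ?s)) + expect R (\<lambda>xs. (?s xs)\<^sup>2))"
    by (simp add: expect_add R mult_ac)
  also have "\<dots> = expect q (\<lambda>x. (h x)\<^sup>2) + expect q h * (2 * expect R ?s) + expect R (\<lambda>xs. (?s xs)\<^sup>2)"
    by (simp add: expect_add assms)
  also have "expect R ?s = real n * expect q h"
    by (simp add: R_def expect_replicate_sum_list assms)
  also have "expect R (\<lambda>xs. (?s xs)\<^sup>2)
      = real n * (expect q (\<lambda>x. (h x)\<^sup>2) - (expect q h)\<^sup>2) + (real n)\<^sup>2 * (expect q h)\<^sup>2"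
    by (simp add: R_def Suc)
  finally show ?case by (simp add: algebra_simps power2_eq_square del: replicate_pmf.simps)
qed simp

lemma expect_replicate_prod_list:
  assumes "finite (set_pmf q)"
  shows "expect (replicate_pmf n q) (\<lambda>xs. \<Prod>x\<leftarrow>xs. h x) = expect q h ^ n"
proof (induction n)
  case (Suc n)
  thus ?case
    by (simp add: expect_replicate_Suc[OF assms] finite_set_replicate_pmf assms
             del: replicate_pmf.simps)
qed simp

text \<open>The likelihood ratio of product measures is the product of the ratios. The ratio is
  required at every point, so \<open>q\<close> vanishes wherever \<open>p\<close> does.\<close>

lemma expect_replicate_change_measure:
  assumes "finite (set_pmf p)" "finite (set_pmf q)" "\<And>x. pmf q x = pmf p x * r x"
  shows "expect (replicate_pmf n q) F = expect (replicate_pmf n p) (\<lambda>xs. F xs * (\<Prod>x\<leftarrow>xs. r x))"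
proof (induction n arbitrary: F)
  case (Suc n)
  define X where "X = set_pmf p \<union> set_pmf q"
  have X: "finite X" "set_pmf p \<subseteq> X" "set_pmf q \<subseteq> X" using assms by (auto simp: X_def)
  have "expect q G = expect p (\<lambda>x. G x * r x)" for G
    by (simp add: expect_eq_sum[OF X(1,2)] expect_eq_sum[OF X(1,3)] assms(3) mult_ac)
  thus ?case using Suc[of "\<lambda>xs. F (_ # xs)"]
    by (simp add: expect_replicate_Suc assms(1,2) mult_ac flip: integral_mult_right_zero
             del: replicate_pmf.simps)
qed simp

lemma prob_deviation_le:
  fixes f :: "'a \<Rightarrow> real"
  assumes "finite (set_pmf q)" "a > 0" and c: "expect q f = c" "expect q (\<lambda>x. (f x)\<^sup>2) - c\<^sup>2 \<le> v"
  shows "measure_pmf.prob q {x. a \<le> \<bar>f x - c\<bar>} \<le> v / a\<^sup>2"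
proof -
  have int: "integrable q g" for g :: "'a \<Rightarrow> real"
    by (simp add: integrable_measure_pmf_finite assms)
  have "measure_pmf.variance q f \<le> v"
    using c by (subst measure_pmf.variance_eq) (auto simp: int)
  moreover have "measure_pmf.prob q {x. a \<le> \<bar>f x - c\<bar>} \<le> measure_pmf.variance q f / a\<^sup>2"
    using measure_pmf.Chebyshev_inequality[of f q a] assms(2) by (simp add: int c(1))
  ultimately show ?thesis
    using assms(2) by (smt (verit) divide_right_mono zero_le_power2)
qed

lemma pmf_of_weights:
  assumes "finite X" "\<And>x. x \<in> X \<Longrightarrow> 0 \<le> f x" "(\<Sum>x\<in>X. f x) = 1"
  obtains q where "set_pmf q \<subseteq> X" "\<And>x. x \<in> X \<Longrightarrow> pmf q x = f x"
proof -
  define g where "g = (\<lambda>x. if x \<in> X then f x else 0)"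
  have g: "0 \<le> g x" for x using assms(2) by (simp add: g_def)
  have "(\<integral>\<^sup>+x. ennreal (g x) \<partial>count_space UNIV) = (\<Sum>x\<in>X. ennreal (g x))"
    using assms(1) by (intro nn_integral_count_space') (auto simp: g g_def)
  also have "\<dots> = 1" using assms(3) by (simp add: g) (simp add: g_def)
  finally have "pmf (embed_pmf g) x = g x" for x using g by (intro pmf_embed_pmf)
  thus ?thesis by (intro that[of "embed_pmf g"]) (auto simp: set_pmf_iff g_def split: if_splits)
qed

section \<open>The second moment method\<close>

lemma reject_prob_expect:
  assumes "finite (set_pmf q)"
  shows "reject_prob n T q = expect (replicate_pmf n q) (\<lambda>xs. pmf (T xs) False)"
  by (simp add: reject_prob_def pmf_bind)

lemma accept_reject_prob: "accept_prob n T q = 1 - reject_prob n T q"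
proof -
  have "pmf M True + pmf M False = 1" for M :: "bool pmf"
  proof -
    have "sum (pmf M) UNIV = 1" by (rule sum_pmf_eq_1) auto
    thus ?thesis by (simp add: UNIV_bool)
  qed
  thus ?thesis by (simp add: accept_prob_def reject_prob_def add.commute eq_diff_eq)
qed

text \<open>\<open>L\<close> is the likelihood ratio of the uniform mixture of the
  \<open>q s\<close> against \<open>p\<close>. A tester is a function \<open>\<phi>\<close> with
  values in \<open>[0, 1]\<close> whose mean differs by at least 1/3 between mixture and
  \<open>p\<close>, which forces the variance of \<open>L\<close> up to 1/3. The second moment is a
  double sum because \<open>L\<close> is an average over \<open>s\<close>, and each cross term
  factors over the samples.\<close>

lemma mixture_second_moment:
  fixes q :: "'s \<Rightarrow> 'a pmf" and h :: "'s \<Rightarrow> 'a \<Rightarrow> real"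
  assumes S: "finite S" "S \<noteq> {}" and p: "finite (set_pmf p)"
    and fq: "\<And>s. s \<in> S \<Longrightarrow> finite (set_pmf (q s))"
    and q: "\<And>s x. s \<in> S \<Longrightarrow> pmf (q s) x = pmf p x * (1 + h s x)"
    and acc: "2/3 \<le> accept_prob n T p"
    and rej: "\<And>s. s \<in> S \<Longrightarrow> 2/3 \<le> reject_prob n T (q s)"
  shows "4/3 * (real (card S))\<^sup>2
       \<le> (\<Sum>s\<in>S. \<Sum>s'\<in>S. expect p (\<lambda>x. (1 + h s x) * (1 + h s' x)) ^ n)"
proof -
  define R where "R = replicate_pmf n p"
  have R: "finite (set_pmf R)" by (simp add: R_def finite_set_replicate_pmf p)
  define \<phi> where "\<phi> = (\<lambda>xs. pmf (T xs) False)"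
  define G where "G = (\<lambda>s xs. \<Prod>x\<leftarrow>xs. 1 + h s x)"
  define k where "k = real (card S)"
  define L where "L = (\<lambda>xs. (\<Sum>s\<in>S. G s xs) / k)"
  have k: "k > 0" using S by (simp add: k_def card_gt_0_iff)
  have change: "expect (replicate_pmf n (q s)) F = expect R (\<lambda>xs. F xs * G s xs)" if "s \<in> S" for s F
    unfolding R_def G_def using that by (intro expect_replicate_change_measure p fq q)
  have EG: "expect R (G s) = 1" if "s \<in> S" for s
    using change[OF that, of "\<lambda>_. 1"] by simp
  have EL: "expect R L = 1"
    using k by (simp add: L_def expect_sum R EG) (simp add: k_def)
  have E\<phi>: "expect R \<phi> \<le> 1/3"
    using acc accept_reject_prob[of n T p] reject_prob_expect[OF p, of n T]
    by (simp add: R_def \<phi>_def)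
  have "(\<Sum>s\<in>S. 2/3) \<le> (\<Sum>s\<in>S. expect R (\<lambda>xs. \<phi> xs * G s xs))"
    using rej by (intro sum_mono) (simp add: reject_prob_expect fq change \<phi>_def)
  also have "\<dots> = expect R (\<lambda>xs. (\<Sum>s\<in>S. \<phi> xs * G s xs))"
    by (simp add: expect_sum R)
  also have "\<dots> = k * expect R (\<lambda>xs. \<phi> xs * L xs)"
    using k by (simp add: L_def sum_distrib_left)
  finally have E\<phi>L: "2/3 \<le> expect R (\<lambda>xs. \<phi> xs * L xs)"
    using k by (simp add: k_def field_simps)
  have "2 * expect R (\<lambda>xs. \<phi> xs * L xs)
      \<le> expect R (\<lambda>xs. (3 * \<phi> xs + (L xs)\<^sup>2) + (1 - 2 * L xs))"
  proof -
    \<comment> \<open>This is \<open>2 * a * b \<le> a ^ 2 + b ^ 2\<close> for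
      \<open>a = \<phi> xs\<close> and \<open>b = L xs - 1\<close>, with
      \<open>\<phi> ^ 2 \<le> \<phi>\<close>; it stands in for Cauchy-Schwarz.\<close>
    have "2 * (\<phi> xs * L xs) \<le> (3 * \<phi> xs + (L xs)\<^sup>2) + (1 - 2 * L xs)" for xs
    proof -
      have "0 \<le> \<phi> xs" "\<phi> xs \<le> 1" by (simp_all add: \<phi>_def pmf_le_1)
      hence "\<phi> xs * \<phi> xs \<le> 1 * \<phi> xs" by (intro mult_right_mono) auto
      moreover have "0 \<le> (\<phi> xs - (L xs - 1))\<^sup>2" by simp
      ultimately show ?thesis by (simp add: power2_eq_square algebra_simps)
    qed
    thus ?thesis by (subst integral_mult_right_zero[symmetric]) (intro expect_mono R, auto)
  qed
  also have "\<dots> = 3 * expect R \<phi> + expect R (\<lambda>xs. (L xs)\<^sup>2) + (1 - 2 * expect R L)"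
    by (simp add: R integrable_measure_pmf_finite)
  finally have "4/3 \<le> expect R (\<lambda>xs. (L xs)\<^sup>2)"
    using E\<phi> E\<phi>L EL by linarith
  also have "expect R (\<lambda>xs. (L xs)\<^sup>2) = expect R (\<lambda>xs. \<Sum>s\<in>S. \<Sum>s'\<in>S. G s xs * G s' xs) / k\<^sup>2"
    by (simp add: L_def power_divide power2_eq_square sum_product)
  also have "expect R (\<lambda>xs. \<Sum>s\<in>S. \<Sum>s'\<in>S. G s xs * G s' xs)
           = (\<Sum>s\<in>S. \<Sum>s'\<in>S. expect R (\<lambda>xs. G s xs * G s' xs))"
    by (simp add: expect_sum R)
  also have "\<dots> = (\<Sum>s\<in>S. \<Sum>s'\<in>S. expect p (\<lambda>x. (1 + h s x) * (1 + h s' x)) ^ n)"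
  proof (intro sum.cong refl)
    fix s s'
    have "G s xs * G s' xs = (\<Prod>x\<leftarrow>xs. (1 + h s x) * (1 + h s' x))" for xs
      unfolding G_def by (induction xs) (auto simp: mult_ac)
    thus "expect R (\<lambda>xs. G s xs * G s' xs) = expect p (\<lambda>x. (1 + h s x) * (1 + h s' x)) ^ n"
      by (simp add: R_def expect_replicate_prod_list p)
  qed
  finally show ?thesis using k by (simp add: k_def field_simps)
qed

text \<open>The bound \<open>cosh x \<le> exp (x ^ 2 / 2)\<close>: Hoeffding's lemma for a fair coin
  with values 0 and \<open>2 * x\<close>, recentred by the factor \<open>exp (- x)\<close>.\<close>

lemma exp_plus_exp_minus_le:
  fixes x :: real
  assumes "x \<ge> 0"
  shows "exp x + exp (- x) \<le> 2 * exp (x\<^sup>2 / 2)"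
proof -
  have pos: "0 < 1 + 1/2 * (exp (2 * x) - 1)" using exp_gt_zero[of "2 * x"] by argo
  have "ln (1 + 1/2 * (exp (2 * x) - 1)) \<le> x + x\<^sup>2 / 2"
    using Hoeffdings_lemma_aux[of "2 * x" "1/2"] assms by (simp add: power2_eq_square)
  hence "1 + 1/2 * (exp (2 * x) - 1) \<le> exp (x + x\<^sup>2 / 2)"
    using pos by (metis exp_le_cancel_iff exp_ln)
  hence "1 + exp (2 * x) \<le> 2 * (exp x * exp (x\<^sup>2 / 2))"
    unfolding exp_add by argo
  hence "exp (- x) * (1 + exp (2 * x)) \<le> exp (- x) * (2 * (exp x * exp (x\<^sup>2 / 2)))"
    by (intro mult_left_mono) auto
  moreover have "exp (- x) * (1 + exp (2 * x)) = exp x + exp (- x)"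
    by (simp add: algebra_simps flip: exp_add)
  moreover have "exp (- x) * (2 * (exp x * exp (x\<^sup>2 / 2))) = 2 * exp (x\<^sup>2 / 2)"
    by (simp flip: exp_add)
  ultimately show ?thesis by linarith
qed

text \<open>For fixed \<open>s\<close> the products \<open>s i * s' i\<close> are again independent
  signs, so averaging over \<open>s'\<close> alone suffices. After \<open>1 + u \<le> exp u\<close>
  the sum factors over \<open>I\<close>, each factor being twice a \<open>cosh\<close>. The premise
  \<open>pos\<close> is there because taking an n-th power is monotone only on nonnegative
  bases.\<close>

lemma rademacher_chaos_exp:
  fixes c :: "'i \<Rightarrow> real"
  assumes I: "finite I" and c: "\<And>i. i \<in> I \<Longrightarrow> c i \<ge> 0"
  defines "S \<equiv> PiE I (\<lambda>_. {-1, 1::real})"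
  assumes pos: "\<And>s s'. s \<in> S \<Longrightarrow> s' \<in> S \<Longrightarrow> 0 \<le> 1 + (\<Sum>i\<in>I. s i * s' i * c i)"
  shows "(\<Sum>s\<in>S. \<Sum>s'\<in>S. (1 + (\<Sum>i\<in>I. s i * s' i * c i)) ^ n)
       \<le> (real (card S))\<^sup>2 * exp ((real n)\<^sup>2 * (\<Sum>i\<in>I. (c i)\<^sup>2) / 2)"
proof -
  define x where "x = (\<lambda>i. real n * c i)"
  have card: "real (card S) = 2 ^ card I"
    by (simp add: S_def card_PiE I)
  have step: "(\<Sum>s'\<in>S. (1 + (\<Sum>i\<in>I. s i * s' i * c i)) ^ n)
      \<le> real (card S) * exp ((real n)\<^sup>2 * (\<Sum>i\<in>I. (c i)\<^sup>2) / 2)" if s: "s \<in> S" for s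
  proof -
    have "(\<Sum>s'\<in>S. (1 + (\<Sum>i\<in>I. s i * s' i * c i)) ^ n)
        \<le> (\<Sum>s'\<in>S. \<Prod>i\<in>I. exp (s i * s' i * x i))"
    proof (intro sum_mono)
      fix s' assume s': "s' \<in> S"
      have "(1 + (\<Sum>i\<in>I. s i * s' i * c i)) ^ n \<le> exp (\<Sum>i\<in>I. s i * s' i * c i) ^ n"
        using pos[OF s s'] by (intro power_mono) auto
      also have "\<dots> = exp (\<Sum>i\<in>I. s i * s' i * x i)"
        by (simp add: x_def sum_distrib_left mult_ac flip: exp_of_nat_mult)
      finally show "(1 + (\<Sum>i\<in>I. s i * s' i * c i)) ^ n \<le> (\<Prod>i\<in>I. exp (s i * s' i * x i))"
        by (simp add: exp_sum I)
    qed
    also have "\<dots> = (\<Prod>i\<in>I. \<Sum>t\<in>{-1, 1}. exp (s i * t * x i))"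
      unfolding S_def by (intro prod_sum_PiE[symmetric] I) auto
    also have "\<dots> \<le> (\<Prod>i\<in>I. 2 * exp ((x i)\<^sup>2 / 2))"
    proof (intro prod_mono conjI)
      fix i assume i: "i \<in> I"
      show "0 \<le> (\<Sum>t\<in>{-1, 1}. exp (s i * t * x i))" by (intro sum_nonneg) auto
      have "s i \<in> {-1, 1}" using s i by (auto simp: S_def)
      moreover have "0 \<le> x i" using c i by (simp add: x_def)
      ultimately show "(\<Sum>t\<in>{-1, 1}. exp (s i * t * x i)) \<le> 2 * exp ((x i)\<^sup>2 / 2)"
        using exp_plus_exp_minus_le[of "x i"] by auto
    qed
    also have "\<dots> = 2 ^ card I * exp (\<Sum>i\<in>I. (x i)\<^sup>2 / 2)"
      by (simp add: prod.distrib exp_sum I)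
    also have "(\<Sum>i\<in>I. (x i)\<^sup>2 / 2) = (real n)\<^sup>2 * (\<Sum>i\<in>I. (c i)\<^sup>2) / 2"
      by (simp add: x_def power_mult_distrib sum_distrib_left sum_divide_distrib)
    finally show ?thesis by (simp add: card)
  qed
  have "(\<Sum>s\<in>S. \<Sum>s'\<in>S. (1 + (\<Sum>i\<in>I. s i * s' i * c i)) ^ n)
      \<le> (\<Sum>s\<in>S. real (card S) * exp ((real n)\<^sup>2 * (\<Sum>i\<in>I. (c i)\<^sup>2) / 2))"
    by (intro sum_mono step)
  thus ?thesis by (simp add: power2_eq_square)
qed

text \<open>
  Moving mass within pairs keeps every perturbation exactly normalised; the price is one largest
  element.
\<close>

lemma pairing:
  fixes b \<xi> :: "'a \<Rightarrow> real"
  assumes "finite Z" "\<And>x y. x \<in> Z \<Longrightarrow> y \<in> Z \<Longrightarrow> b x \<le> b y \<Longrightarrow> \<xi> x \<le> \<xi> y"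
    "\<And>y. y \<in> Z \<Longrightarrow> 0 \<le> \<xi> y"
  shows "\<exists>I v. I \<subseteq> Z \<and> inj_on v I \<and> v ` I \<subseteq> Z - I \<and> (\<forall>i\<in>I. b i \<le> b (v i)) \<and>
           (\<forall>M\<ge>0. (\<forall>y\<in>Z. \<xi> y \<le> M) \<longrightarrow> (\<Sum>y\<in>Z. \<xi> y) \<le> 2 * (\<Sum>i\<in>I. \<xi> i) + M)"
  using assms
proof (induction "card Z" arbitrary: Z rule: less_induct)
  case less
  consider "Z = {}" | z where "Z = {z}"
    | (two) y1 y2 where "y1 \<in> Z" "y2 \<in> Z - {y1}" "\<And>y. y \<in> Z \<Longrightarrow> b y \<le> b y1"
        "\<And>y. y \<in> Z - {y1} \<Longrightarrow> b y \<le> b y2"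
  proof (cases "Z = {}")
    case False
    have max: "\<exists>y\<in>W. \<forall>z\<in>W. b z \<le> b y" if "finite W" "W \<noteq> {}" for W
    proof -
      have "Max (b ` W) \<in> b ` W" using that by (intro Max_in) auto
      then obtain y where "y \<in> W" "b y = Max (b ` W)" by force
      thus ?thesis using Max_ge[of "b ` W"] that(1)
        by (metis finite_imageI imageI)
    qed
    obtain y1 where y1: "y1 \<in> Z" "\<And>y. y \<in> Z \<Longrightarrow> b y \<le> b y1"
      using max[OF less.prems(1) False] by blast
    show ?thesis
    proof (cases "Z - {y1} = {}")
      case True
      thus ?thesis using y1 that(2)[of y1] by blast
    next
      case False
      obtain y2 where "y2 \<in> Z - {y1}" "\<And>y. y \<in> Z - {y1} \<Longrightarrow> b y \<le> b y2"
        using max[OF _ False] less.prems(1) by blast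
      thus ?thesis using that(3) y1 by blast
    qed
  qed blast
  thus ?case
  proof cases
    case 1
    thus ?thesis by (intro exI[of _ "{}"]) auto
  next
    case 2
    thus ?thesis by (intro exI[of _ "{}"]) auto
  next
    case two
    define W where "W = Z - {y1, y2}"
    have Z: "Z = insert y1 (insert y2 W)" "y1 \<notin> insert y2 W" "y2 \<notin> W" "finite W"
      using two less.prems(1) by (auto simp: W_def)
    have "card W < card Z" using Z by simp
    from less.hyps[OF this Z(4)] less.prems(2,3) Z(1) obtain I v where I:
      "I \<subseteq> W" "inj_on v I" "v ` I \<subseteq> W - I" "\<forall>i\<in>I. b i \<le> b (v i)"
      "\<And>M. 0 \<le> M \<Longrightarrow> \<forall>y\<in>W. \<xi> y \<le> M \<Longrightarrow> (\<Sum>y\<in>W. \<xi> y) \<le> 2 * (\<Sum>i\<in>I. \<xi> i) + M"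
      by (metis insertI2)
    define v' where "v' = v(y2 := y1)"
    have y2: "y2 \<notin> I" and y1: "y1 \<notin> I" "y1 \<notin> v ` I" using I Z by auto
    have v': "v' i = v i" if "i \<in> I" for i using that y2 by (auto simp: v'_def)
    have img: "v' ` insert y2 I = insert y1 (v ` I)" proof -
      have "v' ` I = v ` I" using v' by (rule image_cong[OF refl])
      moreover have "v' y2 = y1" by (simp add: v'_def)
      ultimately show ?thesis by simp
    qed
    have fI: "finite I" using I(1) Z(4) finite_subset by blast
    show ?thesis
    proof (intro exI[of _ "insert y2 I"] exI[of _ v'] conjI allI impI)
      show "insert y2 I \<subseteq> Z" using I(1) Z(1) by blast
      show "inj_on v' (insert y2 I)"
        using I(2) y1 y2 v' by (auto simp: inj_on_def v'_def)
      show "v' ` insert y2 I \<subseteq> Z - insert y2 I"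
        unfolding img using I(3) Z y1 by auto
      show "\<forall>i\<in>insert y2 I. b i \<le> b (v' i)"
        using I(4) y2 two by (auto simp: v'_def)
      fix M :: real assume M: "0 \<le> M" "\<forall>y\<in>Z. \<xi> y \<le> M"
      have pos: "0 \<le> \<xi> y2" using less.prems(3) two by auto
      have W: "\<xi> y \<le> \<xi> y2" if "y \<in> W" for y
        using that less.prems(2)[of y y2] two by (auto simp: W_def)
      \<comment> \<open>The two largest elements form a pair and \<open>\<xi> y2\<close> bounds the
        rest, so the rest loses at most \<open>\<xi> y2\<close> in its own pairing. Together with
        \<open>\<xi> y2\<close> itself this is the doubled term of the new index, and
        \<open>\<xi> y1\<close> is at most \<open>M\<close>. Hence the loss does not
        accumulate.\<close>
      show "(\<Sum>y\<in>Z. \<xi> y) \<le> 2 * (\<Sum>i\<in>insert y2 I. \<xi> i) + M"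
        using I(5)[of "\<xi> y2"] W M Z fI y2 pos by simp
    qed
  qed
qed

section \<open>Perturbations supported on separated balls\<close>

locale finite_metric =
  fixes X :: "'a set" and d :: "'a \<Rightarrow> 'a \<Rightarrow> real" and p :: "'a pmf"
  assumes finite_X: "finite X" and metric: "metric_on X d" and p_X: "set_pmf p \<subseteq> X"
begin

lemma dist_nonneg: "x \<in> X \<Longrightarrow> y \<in> X \<Longrightarrow> 0 \<le> d x y"
  and dist_self: "x \<in> X \<Longrightarrow> d x x = 0"
  and dist_commute: "x \<in> X \<Longrightarrow> y \<in> X \<Longrightarrow> d x y = d y x"
  and dist_triangle: "x \<in> X \<Longrightarrow> y \<in> X \<Longrightarrow> z \<in> X \<Longrightarrow> d x z \<le> d x y + d y z"
  using metric unfolding metric_on_def by blast+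

lemma finite_support: "set_pmf q \<subseteq> X \<Longrightarrow> finite (set_pmf q)"
  using finite_X finite_subset by blast

lemma X_nonempty: "X \<noteq> {}"
  using p_X set_pmf_not_empty[of p] by blast

lemma expect_p: "expect p f = (\<Sum>x\<in>X. pmf p x * f x)"
  by (rule expect_eq_sum[OF finite_X p_X])

lemma coup_support:
  assumes "M \<in> coup p q" "set_pmf q \<subseteq> X"
  shows "set_pmf M \<subseteq> X \<times> X"
proof
  fix z assume z: "z \<in> set_pmf M"
  have "fst z \<in> set_pmf (map_pmf fst M)" "snd z \<in> set_pmf (map_pmf snd M)" using z by auto
  hence "fst z \<in> set_pmf p" "snd z \<in> set_pmf q"
    using assms(1) unfolding coup_def by (simp_all del: set_map_pmf)
  thus "z \<in> X \<times> X" using assms(2) p_X by (auto simp: mem_Times_iff)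
qed

lemma coup_nonempty: "coup p q \<noteq> {}"
proof -
  have "pair_pmf p q \<in> coup p q" by (simp add: coup_def map_fst_pair_pmf map_snd_pair_pmf)
  thus ?thesis by blast
qed

text \<open>The easy half of Kantorovich duality: the Lipschitz inequality, integrated against any
  coupling, bounds its cost from below.\<close>

lemma wasserstein_ge:
  assumes q: "set_pmf q \<subseteq> X" and F: "\<And>x y. x \<in> X \<Longrightarrow> y \<in> X \<Longrightarrow> F y - F x \<le> d x y"
  shows "expect q F - expect p F \<le> wasserstein d p q"
  unfolding wasserstein_def
proof (intro cINF_greatest coup_nonempty)
  fix M assume M: "M \<in> coup p q"
  have fin: "finite (set_pmf M)"
    using coup_support[OF M q] finite_X finite_subset by blast
  have "expect q F - expect p F = expect M (\<lambda>z. F (snd z)) - expect M (\<lambda>z. F (fst z))"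
    using M by (auto simp: coup_def)
  also have "\<dots> = expect M (\<lambda>z. F (snd z) - F (fst z))"
    by (simp add: integrable_measure_pmf_finite fin)
  also have "\<dots> \<le> expect M (\<lambda>(x, y). d x y)"
    using coup_support[OF M q] F by (intro expect_mono fin) auto
  finally show "expect q F - expect p F \<le> expect M (\<lambda>(x, y). d x y)" .
qed

section \<open>Signed cones as Lipschitz certificates\<close>

definition bumps :: "'a set \<Rightarrow> real \<Rightarrow> ('a \<Rightarrow> real) \<Rightarrow> 'a \<Rightarrow> real" where
  "bumps A r t x = (\<Sum>y\<in>A. t y * max 0 (r - d y x))"

context
  fixes A :: "'a set" and r :: real
  assumes A: "A \<subseteq> X" and sep: "\<And>x y. x \<in> A \<Longrightarrow> y \<in> A \<Longrightarrow> x \<noteq> y \<Longrightarrow> 2 * r \<le> d x y"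
begin

lemma finite_A: "finite A"
  using A finite_X finite_subset by blast

lemma separated_unique:
  assumes "x \<in> X" "a \<in> A" "a' \<in> A" "d a x < r" "d a' x < r"
  shows "a = a'"
proof (rule ccontr)
  assume "a \<noteq> a'"
  moreover have "a \<in> X" "a' \<in> X" using assms A by auto
  ultimately show False
    using assms sep[of a a'] dist_triangle[of a x a'] dist_commute[of a' x] by linarith
qed

lemma bumps_near:
  assumes "x \<in> X" "a \<in> A" "d a x < r"
  shows "bumps A r t x = t a * (r - d a x)"
proof -
  have "max 0 (r - d y x) = 0" if "y \<in> A - {a}" for y
  proof -
    have "\<not> d y x < r" using separated_unique[OF assms(1,2) _ assms(3)] that by blast
    thus ?thesis by simp
  qed
  hence "bumps A r t x = (\<Sum>y\<in>{a}. t y * max 0 (r - d y x))"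
    unfolding bumps_def using assms finite_A by (intro sum.mono_neutral_right) auto
  thus ?thesis using assms by simp
qed

lemma bumps_far:
  assumes "\<And>a. a \<in> A \<Longrightarrow> r \<le> d a x"
  shows "bumps A r t x = 0"
  unfolding bumps_def using assms by (intro sum.neutral) (force simp: max_def)

text \<open>At most one cone is nonzero at any point. The critical case is two different cones with
  possibly opposite signs: the heights add up to at most \<open>2 * r - d a x - d b y\<close>, and
  since the centres are \<open>2 * r\<close> apart, the triangle inequality turns this into
  \<open>d x y\<close>.\<close>

lemma bumps_lipschitz:
  assumes t: "\<And>y. y \<in> A \<Longrightarrow> \<bar>t y\<bar> \<le> 1" and xy: "x \<in> X" "y \<in> X"
  shows "bumps A r t y - bumps A r t x \<le> d x y"
proof -
  have AX: "a \<in> A \<Longrightarrow> a \<in> X" for a using A by blast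
  have ub: "t a * u \<le> u" "- u \<le> t a * u" if "a \<in> A" "0 \<le> u" for a u
    using t[OF that(1)] that(2) mult_right_mono[of "t a" 1 u] mult_right_mono[of "-1" "t a" u]
    by auto
  consider (both) a b where "a \<in> A" "d a x < r" "b \<in> A" "d b y < r"
    | (x) a where "a \<in> A" "d a x < r" "\<And>b. b \<in> A \<Longrightarrow> r \<le> d b y"
    | (y) b where "b \<in> A" "d b y < r" "\<And>a. a \<in> A \<Longrightarrow> r \<le> d a x"
    | (none) "\<And>a. a \<in> A \<Longrightarrow> r \<le> d a x" "\<And>b. b \<in> A \<Longrightarrow> r \<le> d b y"
    by (meson not_le)
  thus ?thesis
  proof cases
    case both
    show ?thesis
    proof (cases "a = b")
      case True
      have "bumps A r t y - bumps A r t x = t a * (d a x - d a y)"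
        using both True xy by (simp add: bumps_near algebra_simps)
      also have "\<dots> \<le> \<bar>t a\<bar> * \<bar>d a x - d a y\<bar>" by (metis abs_ge_self abs_mult)
      also have "\<dots> \<le> 1 * \<bar>d a x - d a y\<bar>" using t both by (intro mult_right_mono) auto
      also have "\<dots> \<le> d x y"
        using dist_triangle[of a x y] dist_triangle[of a y x] dist_commute[of x y] AX[OF both(1)] xy
        by auto
      finally show ?thesis .
    next
      case False
      have "bumps A r t y - bumps A r t x \<le> (r - d b y) + (r - d a x)"
        using both xy ub(1)[of b "r - d b y"] ub(2)[of a "r - d a x"]
          bumps_near[OF xy(2) both(3,4), of t] bumps_near[OF xy(1) both(1,2), of t] by linarith
      also have "\<dots> \<le> d x y"
        using sep[OF both(1,3) False] dist_triangle[of a x b] dist_triangle[of x y b]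
          dist_commute[of y b] AX both xy by auto
      finally show ?thesis .
    qed
  next
    case x
    have "bumps A r t y - bumps A r t x \<le> r - d a x"
      using x xy ub(2)[of a "r - d a x"] by (simp add: bumps_near bumps_far)
    also have "\<dots> \<le> d x y"
      using x(3)[OF x(1)] dist_triangle[of a x y] AX[OF x(1)] xy by auto
    finally show ?thesis .
  next
    case y
    have "bumps A r t y - bumps A r t x \<le> r - d b y"
      using y xy ub(1)[of b "r - d b y"] by (simp add: bumps_near bumps_far)
    also have "\<dots> \<le> d x y"
      using y(3)[OF y(1)] dist_triangle[of b y x] dist_commute[of y x] AX[OF y(1)] xy by auto
    finally show ?thesis .
  next
    case none
    thus ?thesis using xy by (simp add: bumps_far dist_nonneg)
  qed
qed

text \<open>Intended as the relative change of density \<open>q / p - 1\<close>. It is constant on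
  each ball, so that the ball around \<open>y\<close> gains mass \<open>t y * \<zeta> y\<close>. The
  radius is \<open>r/2\<close> because there the cone of \<open>bumps\<close> still has height at
  least \<open>r/2\<close>.\<close>

definition spread :: "('a \<Rightarrow> real) \<Rightarrow> ('a \<Rightarrow> real) \<Rightarrow> 'a \<Rightarrow> real" where
  "spread \<zeta> t x = (\<Sum>y\<in>A. t y * (\<zeta> y / measure_pmf.prob p (ball_on X d y (r/2))
                              * indicator (ball_on X d y (r/2)) x))"

context
  fixes \<zeta> :: "'a \<Rightarrow> real" and b :: "'a \<Rightarrow> real"
  defines "b \<equiv> \<lambda>y. measure_pmf.prob p (ball_on X d y (r/2))"
  assumes r: "r > 0" and b: "\<And>y. y \<in> A \<Longrightarrow> b y > 0" and \<zeta>: "\<And>y. y \<in> A \<Longrightarrow> 0 \<le> \<zeta> y \<and> \<zeta> y \<le> b y"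
begin

lemma spread_near:
  assumes "a \<in> A" "x \<in> ball_on X d a (r/2)"
  shows "spread \<zeta> t x = t a * (\<zeta> a / b a)"
proof -
  have x: "x \<in> X" "d a x < r" using assms r by (auto simp: ball_on_def)
  have "x \<notin> ball_on X d y (r/2)" if "y \<in> A - {a}" for y
    using separated_unique[OF x(1) assms(1) _ x(2), of y] that r by (auto simp: ball_on_def)
  hence "spread \<zeta> t x = (\<Sum>y\<in>{a}. t y * (\<zeta> y / b y * indicator (ball_on X d y (r/2)) x))"
    unfolding spread_def b_def using assms finite_A by (intro sum.mono_neutral_right) auto
  thus ?thesis using assms by simp
qed

lemma spread_far:
  assumes "\<And>a. a \<in> A \<Longrightarrow> x \<notin> ball_on X d a (r/2)"
  shows "spread \<zeta> t x = 0"
  unfolding spread_def using assms by (intro sum.neutral) auto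

lemma expect_balls:
  "expect p (\<lambda>x. \<Sum>y\<in>A. c y * indicator (ball_on X d y (r/2)) x) = (\<Sum>y\<in>A. c y * b y)"
  by (simp add: expect_sum finite_support p_X b_def)

lemma expect_spread: "expect p (spread \<zeta> t) = (\<Sum>y\<in>A. t y * \<zeta> y)"
proof -
  have "expect p (spread \<zeta> t)
      = expect p (\<lambda>x. \<Sum>y\<in>A. t y * (\<zeta> y / b y) * indicator (ball_on X d y (r/2)) x)"
    by (simp add: spread_def[abs_def] b_def mult_ac)
  also have "\<dots> = (\<Sum>y\<in>A. t y * (\<zeta> y / b y) * b y)" by (rule expect_balls)
  also have "\<dots> = (\<Sum>y\<in>A. t y * \<zeta> y)" using b by (intro sum.cong) fastforce+
  finally show ?thesis .
qed

lemma spread_cases: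
  obtains (near) a where "a \<in> A" "x \<in> ball_on X d a (r/2)"
  | (far) "\<And>a. a \<in> A \<Longrightarrow> x \<notin> ball_on X d a (r/2)"
  by blast

lemma balls_near:
  fixes c :: "'a \<Rightarrow> real"
  assumes "a \<in> A" "x \<in> ball_on X d a (r/2)"
  shows "(\<Sum>y\<in>A. c y * indicator (ball_on X d y (r/2)) x) = c a"
proof -
  have x: "x \<in> X" "d a x < r" using assms r by (auto simp: ball_on_def)
  have "x \<notin> ball_on X d y (r/2)" if "y \<in> A - {a}" for y
    using separated_unique[OF x(1) assms(1) _ x(2), of y] that r by (auto simp: ball_on_def)
  hence "(\<Sum>y\<in>A. c y * indicator (ball_on X d y (r/2)) x)
       = (\<Sum>y\<in>{a}. c y * indicator (ball_on X d y (r/2)) x)"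
    using assms finite_A by (intro sum.mono_neutral_right) (auto simp: indicator_def)
  thus ?thesis using assms by simp
qed

text \<open>The balls are disjoint, so only diagonal terms survive;
  \<open>(\<zeta> y)\<^sup>2 / b y\<close> is the chi-square cost of shifting
  \<open>\<zeta> y\<close> on a ball of mass \<open>b y\<close>.\<close>

lemma expect_spread_mult:
  "expect p (\<lambda>x. spread \<zeta> t x * spread \<zeta> t' x) = (\<Sum>y\<in>A. t y * t' y * ((\<zeta> y)\<^sup>2 / b y))"
proof -
  have "spread \<zeta> t x * spread \<zeta> t' x
      = (\<Sum>y\<in>A. t y * t' y * (\<zeta> y / b y)\<^sup>2 * indicator (ball_on X d y (r/2)) x)" for x
  proof (cases x rule: spread_cases)
    case (near a)
    show ?thesis unfolding balls_near[OF near] spread_near[OF near]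
      by (simp add: power2_eq_square)
  next
    case far
    thus ?thesis by (simp add: spread_far)
  qed
  hence "expect p (\<lambda>x. spread \<zeta> t x * spread \<zeta> t' x)
       = (\<Sum>y\<in>A. t y * t' y * (\<zeta> y / b y)\<^sup>2 * b y)"
    by (simp add: expect_balls)
  also have "\<dots> = (\<Sum>y\<in>A. t y * t' y * ((\<zeta> y)\<^sup>2 / b y))"
    using b by (intro sum.cong) (fastforce simp: power2_eq_square)+
  finally show ?thesis .
qed

lemma spread_ge:
  assumes "\<And>y. y \<in> A \<Longrightarrow> \<bar>t y\<bar> \<le> 1"
  shows "0 \<le> 1 + spread \<zeta> t x"
proof (cases x rule: spread_cases)
  case (near a)
  have "\<bar>t a * (\<zeta> a / b a)\<bar> \<le> 1 * 1"
    unfolding abs_mult using assms b \<zeta> near by (intro mult_mono) (fastforce simp: divide_le_eq_1)+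
  hence "- 1 \<le> t a * (\<zeta> a / b a)" by linarith
  thus ?thesis unfolding spread_near[OF near] by linarith
qed (simp add: spread_far)

text \<open>The test function \<open>bumps A r t\<close> carries the same signs as the shifts, so
  the signs square away and each ball contributes its shift times a cone height of at least
  \<open>r/2\<close>.\<close>

lemma wasserstein_spread:
  assumes t: "\<And>y. y \<in> A \<Longrightarrow> \<bar>t y\<bar> = 1"
    and q: "set_pmf q \<subseteq> X" "\<And>x. pmf q x = pmf p x * (1 + spread \<zeta> t x)"
  shows "r / 2 * (\<Sum>y\<in>A. \<zeta> y) \<le> wasserstein d p q"
proof -
  have tt: "t y * t y = 1" if "y \<in> A" for y using t[OF that] by (auto simp: abs_if split: if_splits)
  have "r / 2 * (\<Sum>y\<in>A. \<zeta> y) = (\<Sum>y\<in>A. r / 2 * (\<zeta> y / b y) * b y)"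
    unfolding sum_distrib_left using b by (intro sum.cong) fastforce+
  also have "\<dots> = expect p (\<lambda>x. \<Sum>y\<in>A. r / 2 * (\<zeta> y / b y) * indicator (ball_on X d y (r/2)) x)"
    by (rule expect_balls[symmetric])
  also have "\<dots> \<le> expect p (\<lambda>x. spread \<zeta> t x * bumps A r t x)"
  proof (intro expect_mono finite_support p_X)
    fix x assume "x \<in> set_pmf p"
    show "(\<Sum>y\<in>A. r / 2 * (\<zeta> y / b y) * indicator (ball_on X d y (r/2)) x)
        \<le> spread \<zeta> t x * bumps A r t x"
    proof (cases x rule: spread_cases)
      case (near a)
      hence x: "x \<in> X" "d a x \<le> r / 2" "d a x < r" using r by (auto simp: ball_on_def)
      have "spread \<zeta> t x * bumps A r t x = t a * t a * (\<zeta> a / b a * (r - d a x))"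
        using near x by (simp add: spread_near bumps_near)
      also have "\<dots> = \<zeta> a / b a * (r - d a x)" using tt near by simp
      also have "\<dots> \<ge> \<zeta> a / b a * (r / 2)"
        using x \<zeta> b near by (intro mult_left_mono) (auto simp: less_imp_le)
      finally show ?thesis unfolding balls_near[OF near] by (simp only: mult.commute)
    qed (simp add: spread_far)
  qed
  also have "\<dots> = expect q (bumps A r t) - expect p (bumps A r t)"
    by (simp add: expect_p expect_eq_sum[OF finite_X q(1)] q(2) algebra_simps flip: sum_subtractf)
  also have "\<dots> \<le> wasserstein d p q"
    using t by (intro wasserstein_ge q(1) bumps_lipschitz) auto
  finally show ?thesis .
qed

lemma spread_pmf:
  assumes "\<And>y. y \<in> A \<Longrightarrow> \<bar>t y\<bar> \<le> 1" and bal: "(\<Sum>y\<in>A. t y * \<zeta> y) = 0"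
  obtains q where "set_pmf q \<subseteq> X" "\<And>x. pmf q x = pmf p x * (1 + spread \<zeta> t x)"
proof -
  have "(\<Sum>x\<in>X. pmf p x * (1 + spread \<zeta> t x)) = expect p (\<lambda>x. 1 + spread \<zeta> t x)"
    by (simp add: expect_p)
  also have "\<dots> = 1"
    by (simp add: expect_add finite_support p_X expect_spread bal)
  finally have total: "(\<Sum>x\<in>X. pmf p x * (1 + spread \<zeta> t x)) = 1" .
  have "0 \<le> pmf p x * (1 + spread \<zeta> t x)" for x using spread_ge[OF assms(1)] by simp
  then obtain q where q: "set_pmf q \<subseteq> X" "\<And>x. x \<in> X \<Longrightarrow> pmf q x = pmf p x * (1 + spread \<zeta> t x)"
    using pmf_of_weights[OF finite_X _ total] by blast
  moreover have "pmf q x = pmf p x * (1 + spread \<zeta> t x)" if "x \<notin> X" for x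
  proof -
    have "x \<notin> set_pmf q" "x \<notin> set_pmf p" using that q(1) p_X by auto
    thus ?thesis by (simp add: set_pmf_iff)
  qed
  ultimately show ?thesis by (intro that[of q]) auto
qed

end

end

text \<open>One independent sign per pair decides in which direction the pair exchanges mass, which
  keeps the total equal to 1. All sign patterns yield far distributions, so the tester must tell
  their mixture from \<open>p\<close>. The loss \<open>M\<close> comes from the pairing, and the
  factor 4 from squaring the at most doubled chi-square cost of a pair.\<close>

lemma tester_bound:
  fixes \<xi> :: "'a \<Rightarrow> real"
  assumes Z: "Z \<subseteq> X" and r: "r > 0"
    and sep: "\<And>x y. x \<in> Z \<Longrightarrow> y \<in> Z \<Longrightarrow> x \<noteq> y \<Longrightarrow> 2 * r \<le> d x y"
  defines "b \<equiv> \<lambda>y. measure_pmf.prob p (ball_on X d y (r/2))"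
  assumes b: "\<And>y. y \<in> Z \<Longrightarrow> 0 < b y"
    and \<xi>: "\<And>y. y \<in> Z \<Longrightarrow> 0 \<le> \<xi> y" "\<And>y. y \<in> Z \<Longrightarrow> \<xi> y \<le> b y"
    and mono: "\<And>x y. x \<in> Z \<Longrightarrow> y \<in> Z \<Longrightarrow> b x \<le> b y \<Longrightarrow> \<xi> x \<le> \<xi> y"
    and M: "0 \<le> M" "\<And>y. y \<in> Z \<Longrightarrow> \<xi> y \<le> M"
    and large: "2 * \<epsilon> / r \<le> (\<Sum>y\<in>Z. \<xi> y) - M"
    and tester: "is_tester X d p \<epsilon> n T"
  shows "1/2 \<le> (real n)\<^sup>2 * (\<Sum>y\<in>Z. 4 * ((\<xi> y)\<^sup>2 / b y)\<^sup>2)"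
proof -
  have fZ: "finite Z" using Z finite_X finite_subset by blast
  obtain I v where I: "I \<subseteq> Z" "inj_on v I" "v ` I \<subseteq> Z - I" "\<And>i. i \<in> I \<Longrightarrow> b i \<le> b (v i)"
    and half: "(\<Sum>y\<in>Z. \<xi> y) \<le> 2 * (\<Sum>i\<in>I. \<xi> i) + M"
  proof -
    have "\<exists>I v. I \<subseteq> Z \<and> inj_on v I \<and> v ` I \<subseteq> Z - I \<and> (\<forall>i\<in>I. b i \<le> b (v i)) \<and>
        (\<forall>M\<ge>0. (\<forall>y\<in>Z. \<xi> y \<le> M) \<longrightarrow> (\<Sum>y\<in>Z. \<xi> y) \<le> 2 * (\<Sum>i\<in>I. \<xi> i) + M)"
      by (rule pairing) (use fZ mono \<xi>(1) in auto)
    thus ?thesis using that M by metis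
  qed
  have fI: "finite I" using I(1) fZ finite_subset by blast
  define A where "A = I \<union> v ` I"
  \<comment> \<open>Both members of a pair are sent to its index in \<open>I\<close>, so they share
    sign and amount, while \<open>sg\<close> gives the partner the opposite sign. The amount of the
    lighter member fits into both balls.\<close>
  define own where "own = (\<lambda>y. if y \<in> I then y else inv_into I v y)"
  define sg :: "'a \<Rightarrow> real" where "sg = (\<lambda>y. if y \<in> I then 1 else -1)"
  define \<zeta> where "\<zeta> = (\<lambda>y. \<xi> (own y))"
  define t where "t = (\<lambda>(s::'a \<Rightarrow> real) y. sg y * s (own y))"
  have AZ: "A \<subseteq> Z" using I by (auto simp: A_def)
  have AX: "A \<subseteq> X" using AZ Z by blast
  have sepA: "\<And>x y. x \<in> A \<Longrightarrow> y \<in> A \<Longrightarrow> x \<noteq> y \<Longrightarrow> 2 * r \<le> d x y" using sep AZ by blast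
  have vI: "v i \<notin> I" if "i \<in> I" for i using I(3) that by blast
  have own: "own i = i" "own (v i) = i" "sg i = 1" "sg (v i) = -1" if "i \<in> I" for i
    using that vI[OF that] I(2) by (auto simp: own_def sg_def)
  have ownI: "own y \<in> I" if "y \<in> A" for y using that own by (auto simp: A_def)
  have sumA: "(\<Sum>y\<in>A. f y) = (\<Sum>i\<in>I. f i + f (v i))" for f :: "'a \<Rightarrow> real"
  proof -
    have "(\<Sum>y\<in>A. f y) = (\<Sum>y\<in>I. f y) + (\<Sum>y\<in>v ` I. f y)"
      unfolding A_def using fI I(3) by (intro sum.union_disjoint) auto
    thus ?thesis using I(2) by (simp add: sum.reindex sum.distrib)
  qed
  have bA: "\<And>y. y \<in> A \<Longrightarrow> 0 < b y" using b AZ by blast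
  have \<zeta>A: "0 \<le> \<zeta> y \<and> \<zeta> y \<le> b y" if "y \<in> A" for y
  proof -
    have "own y \<in> Z" using ownI[OF that] I(1) by blast
    moreover have "b (own y) \<le> b y" using that own I(4) by (auto simp: A_def)
    ultimately show ?thesis using \<xi>[of "own y"] by (auto simp: \<zeta>_def)
  qed
  define S where "S = PiE I (\<lambda>_. {-1, 1::real})"
  have tS: "\<bar>t s y\<bar> = 1" if "s \<in> S" "y \<in> A" for s y
  proof -
    have "s (own y) \<in> {-1, 1}" using that(1) ownI[OF that(2)] by (auto simp: S_def)
    thus ?thesis by (auto simp: t_def sg_def)
  qed
  define h where "h = (\<lambda>s. spread A r \<zeta> (t s))"
  note ctx = AX sepA r bA[unfolded b_def] \<zeta>A[unfolded b_def]
  have bal: "(\<Sum>y\<in>A. t s y * \<zeta> y) = 0" for s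
    unfolding sumA by (intro sum.neutral) (simp add: t_def \<zeta>_def own)
  define c where "c = (\<lambda>i. (\<xi> i)\<^sup>2 / b i + (\<xi> i)\<^sup>2 / b (v i))"
  have c: "0 \<le> c i" "c i \<le> 2 * ((\<xi> i)\<^sup>2 / b i)" if "i \<in> I" for i
  proof -
    have "0 < b i" "b i \<le> b (v i)" using b I that by auto
    moreover from this have "(\<xi> i)\<^sup>2 / b (v i) \<le> (\<xi> i)\<^sup>2 / b i" by (intro divide_left_mono) auto
    ultimately show "0 \<le> c i" "c i \<le> 2 * ((\<xi> i)\<^sup>2 / b i)" by (auto simp: c_def)
  qed
  have Eh: "expect p (\<lambda>x. (1 + h s x) * (1 + h s' x)) = 1 + (\<Sum>i\<in>I. s i * s' i * c i)" for s s'
  proof -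
    have "expect p (\<lambda>x. (1 + h s x) * (1 + h s' x))
        = expect p (\<lambda>x. (1 + h s x) + (h s' x + h s x * h s' x))"
      by (simp add: algebra_simps)
    also have "\<dots> = 1 + expect p (h s) + (expect p (h s') + expect p (\<lambda>x. h s x * h s' x))"
      by (simp add: expect_add finite_support p_X)
    also have "\<dots> = 1 + (\<Sum>y\<in>A. t s y * t s' y * ((\<zeta> y)\<^sup>2 / b y))"
      by (simp add: h_def expect_spread[OF ctx] expect_spread_mult[OF ctx] bal b_def)
    also have "\<dots> = 1 + (\<Sum>i\<in>I. s i * s' i * c i)"
      unfolding sumA by (simp add: t_def \<zeta>_def own c_def algebra_simps)
    finally show ?thesis .
  qed
  have "\<forall>s. s \<in> S \<longrightarrow> (\<exists>q. set_pmf q \<subseteq> X \<and> (\<forall>x. pmf q x = pmf p x * (1 + h s x)))"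
  proof (intro allI impI)
    fix s assume "s \<in> S"
    hence "\<And>y. y \<in> A \<Longrightarrow> \<bar>t s y\<bar> \<le> 1" using tS by fastforce
    from spread_pmf[OF ctx this bal] show "\<exists>q. set_pmf q \<subseteq> X \<and> (\<forall>x. pmf q x = pmf p x * (1 + h s x))"
      unfolding h_def by metis
  qed
  then obtain q where q: "\<And>s. s \<in> S \<Longrightarrow> set_pmf (q s) \<subseteq> X"
    "\<And>s x. s \<in> S \<Longrightarrow> pmf (q s) x = pmf p x * (1 + h s x)" by metis
  have rej: "2/3 \<le> reject_prob n T (q s)" if s: "s \<in> S" for s
  proof -
    have "\<epsilon> \<le> r / 2 * (2 * (\<Sum>i\<in>I. \<xi> i))"
    proof -
      have "2 * \<epsilon> / r \<le> 2 * (\<Sum>i\<in>I. \<xi> i)" using large half by linarith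
      thus ?thesis using r by (simp add: field_simps)
    qed
    also have "2 * (\<Sum>i\<in>I. \<xi> i) = (\<Sum>y\<in>A. \<zeta> y)"
      unfolding sumA by (simp add: \<zeta>_def own sum_distrib_left)
    also have "r / 2 * (\<Sum>y\<in>A. \<zeta> y) \<le> wasserstein d p (q s)"
      using q[OF s] tS[OF s] by (intro wasserstein_spread[OF ctx]) (auto simp: h_def)
    finally show ?thesis
      using tester q(1)[OF s] by (simp add: is_tester_def far_dists_def)
  qed
  have S: "finite S" "S \<noteq> {}" using fI by (auto simp: S_def intro!: finite_PiE simp: PiE_eq_empty_iff)
  define k where "k = real (card S)"
  have k: "k > 0" using S by (simp add: k_def card_gt_0_iff)
  define u where "u = (real n)\<^sup>2 * (\<Sum>i\<in>I. (c i)\<^sup>2)"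
  have "4/3 * k\<^sup>2 \<le> (\<Sum>s\<in>S. \<Sum>s'\<in>S. expect p (\<lambda>x. (1 + h s x) * (1 + h s' x)) ^ n)"
    unfolding k_def using tester q rej
    by (intro mixture_second_moment[where q = q and T = T] S finite_support p_X)
       (auto simp: is_tester_def)
  also have "\<dots> = (\<Sum>s\<in>S. \<Sum>s'\<in>S. (1 + (\<Sum>i\<in>I. s i * s' i * c i)) ^ n)"
    by (simp add: Eh)
  also have "\<dots> \<le> k\<^sup>2 * exp ((real n)\<^sup>2 * (\<Sum>i\<in>I. (c i)\<^sup>2) / 2)"
    unfolding k_def S_def
  proof (intro rademacher_chaos_exp fI c(1))
    fix s s' :: "'a \<Rightarrow> real" assume "s \<in> I \<rightarrow>\<^sub>E {- 1, 1}" "s' \<in> I \<rightarrow>\<^sub>E {- 1, 1::real}"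
    hence S: "s \<in> S" "s' \<in> S" by (auto simp: S_def)
    hence "0 \<le> (1 + h s x) * (1 + h s' x)" for x
      unfolding h_def using tS by (intro mult_nonneg_nonneg spread_ge[OF ctx]) fastforce+
    \<comment> \<open>The base of the power is the expectation of a product of two density ratios,
      hence nonnegative as the chaos bound demands.\<close>
    hence "0 \<le> expect p (\<lambda>x. (1 + h s x) * (1 + h s' x))" by simp
    thus "0 \<le> 1 + (\<Sum>i\<in>I. s i * s' i * c i)" by (simp only: Eh)
  qed
  finally have ex: "4/3 \<le> exp (u / 2)" using k by (simp add: u_def)
  have "1/2 \<le> u"
  proof (rule ccontr)
    \<comment> \<open>Otherwise \<open>4/3 \<le> exp (1/4)\<close>, but the fourth power of 4/3 is
      256/81, which exceeds 3 and hence \<open>exp 1\<close>.\<close>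
    assume "\<not> 1/2 \<le> u"
    hence "(4/3::real) ^ 4 \<le> exp (1/4) ^ 4" using ex by (intro power_mono) (auto elim!: order.trans)
    also have "\<dots> = exp 1" by (simp flip: exp_of_nat_mult)
    also have "\<dots> \<le> 3" by (rule exp_le)
    finally show False by (simp add: eval_nat_numeral)
  qed
  also have "u \<le> (real n)\<^sup>2 * (\<Sum>i\<in>I. 4 * ((\<xi> i)\<^sup>2 / b i)\<^sup>2)"
    unfolding u_def
  proof (intro mult_left_mono sum_mono)
    fix i assume "i \<in> I"
    hence "(c i)\<^sup>2 \<le> (2 * ((\<xi> i)\<^sup>2 / b i))\<^sup>2" using c by (intro power_mono)
    thus "(c i)\<^sup>2 \<le> 4 * ((\<xi> i)\<^sup>2 / b i)\<^sup>2" by (simp only: power_mult_distrib) simp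
  qed simp
  also have "\<dots> \<le> (real n)\<^sup>2 * (\<Sum>y\<in>Z. 4 * ((\<xi> y)\<^sup>2 / b y)\<^sup>2)"
    using I(1) fZ by (intro mult_left_mono sum_mono2) auto
  finally show ?thesis .
qed

end

section \<open>Doubling measures and nets\<close>

text \<open>Stated for \<open>map f xs\<close> so that the removed values can be traced back to the
  points carrying them.\<close>

lemma drop_mass_eq_drop:
  "\<exists>k. drop_mass \<delta> (map f xs) = map f (drop k xs) \<and> (k < length xs \<longrightarrow> \<delta> \<le> (\<Sum>x\<leftarrow>take k xs. f x))"
proof (induction xs arbitrary: \<delta>)
  case (Cons x xs)
  show ?case
  proof (cases "\<delta> \<le> 0")
    case True
    thus ?thesis by (intro exI[of _ 0]) auto
  next
    case False
    obtain k where "drop_mass (\<delta> - f x) (map f xs) = map f (drop k xs)"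
      "k < length xs \<longrightarrow> \<delta> - f x \<le> (\<Sum>x\<leftarrow>take k xs. f x)" using Cons by blast
    thus ?thesis using False by (intro exI[of _ "Suc k"]) auto
  qed
qed auto

text \<open>Lifts the truncation from values to points: \<open>K\<close> is kept and
  \<open>R\<close> is removed for its small mass, while the point lost to \<open>butlast\<close> is
  in neither. The mass bound on \<open>R\<close> needs \<open>K\<close> nonempty, since otherwise
  the removal may have run out of entries.\<close>

lemma trunc_split:
  fixes f :: "'a \<Rightarrow> real"
  assumes N: "finite N"
  obtains K R where "K \<subseteq> N" "R \<subseteq> N" "trunc \<delta> (image_mset f (mset_set N)) = image_mset f (mset_set K)"
    "\<And>x y. x \<in> R \<Longrightarrow> y \<in> K \<Longrightarrow> f x \<le> f y" "K \<noteq> {} \<Longrightarrow> \<delta> \<le> sum f R"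
proof -
  obtain ns where ns: "set ns = N" "distinct ns" using finite_distinct_list[OF N] by blast
  define zs where "zs = sort_key f ns"
  have zs: "set zs = N" "distinct zs" "sorted (map f zs)" using ns by (auto simp: zs_def)
  have "image_mset f (mset_set N) = mset (map f zs)"
    using zs by (simp add: mset_set_set flip: zs(1))
  hence sl: "sorted_list_of_multiset (image_mset f (mset_set N)) = map f zs"
    using zs(3) by (simp add: sorted_list_of_multiset_mset sorted_sort_id del: mset_map)
  define ys where "ys = butlast zs"
  have ys: "set ys \<subseteq> N" "distinct ys" "sorted (map f ys)"
    using zs by (auto simp: ys_def distinct_butlast map_butlast dest: in_set_butlastD
                      intro: sorted_butlast)
  obtain k where k: "drop_mass \<delta> (map f ys) = map f (drop k ys)"
    "k < length ys \<longrightarrow> \<delta> \<le> (\<Sum>x\<leftarrow>take k ys. f x)" using drop_mass_eq_drop[of \<delta> f ys] by blast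
  show ?thesis
  proof (rule that[of "set (drop k ys)" "set (take k ys)"])
    show "set (drop k ys) \<subseteq> N" "set (take k ys) \<subseteq> N"
      using ys(1) set_drop_subset[of k ys] set_take_subset[of k ys] by auto
    show "trunc \<delta> (image_mset f (mset_set N)) = image_mset f (mset_set (set (drop k ys)))"
      using k(1) ys(2) by (simp add: trunc_def sl ys_def mset_set_set flip: map_butlast)
    have "sorted (map f (take k ys) @ map f (drop k ys))"
      using ys(3) by (simp flip: map_append)
    thus "f x \<le> f y" if "x \<in> set (take k ys)" "y \<in> set (drop k ys)" for x y
      using that by (auto simp: sorted_append)
    show "\<delta> \<le> sum f (set (take k ys))" if "set (drop k ys) \<noteq> {}"
      using that k(2) ys(2) by (simp add: sum_list_distinct_conv_sum_set)
  qed
qed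

lemma norm23_image_mset:
  "norm23 (image_mset f (mset_set K)) = (\<Sum>x\<in>K. f x powr (2/3)) powr (3/2)"
  by (simp add: norm23_def sum_unfold_sum_mset multiset.map_comp comp_def)

lemma finite_scales: "finite (scales D \<epsilon>)"
proof (rule finite_subset)
  show "scales D \<epsilon> \<subseteq> {\<lceil>log 2 (\<epsilon> / 8)\<rceil>..\<lfloor>log 2 D\<rfloor>}"
    by (auto simp: scales_def ceiling_le_iff le_floor_iff)
qed simp

lemma power_int_le_diam: "i \<in> scales D \<epsilon> \<Longrightarrow> 2 powi i \<le> D"
  by (auto simp: scales_def le_log_iff powr_real_of_int' simp flip: powr_real_of_int')

text \<open>Greedy choice: a point is added unless it is closer than \<open>\<rho>\<close> to a
  chosen one. For negative \<open>\<rho>\<close> every point is chosen and covers itself at distance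
  0, whence the \<open>max\<close>.\<close>

lemma (in finite_metric) maximal_separated_subset:
  assumes "N \<subseteq> X"
  shows "\<exists>Y\<subseteq>N. (\<forall>x\<in>Y. \<forall>y\<in>Y. x \<noteq> y \<longrightarrow> \<rho> \<le> d x y) \<and> (\<forall>x\<in>N. \<exists>y\<in>Y. d x y \<le> max 0 \<rho>)"
proof -
  have "finite N" using assms finite_X finite_subset by blast
  thus ?thesis using assms
  proof (induction N rule: finite_induct)
    case (insert x N)
    then obtain Y where Y: "Y \<subseteq> N" "\<forall>x\<in>Y. \<forall>y\<in>Y. x \<noteq> y \<longrightarrow> \<rho> \<le> d x y"
      "\<forall>x\<in>N. \<exists>y\<in>Y. d x y \<le> max 0 \<rho>" by blast
    have x: "x \<in> X" "N \<subseteq> X" using insert by auto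
    show ?case
    proof (cases "\<exists>y\<in>Y. d x y < \<rho>")
      case True
      then obtain y where y: "y \<in> Y" "d x y < \<rho>" by blast
      hence "d x y \<le> max 0 \<rho>" by linarith
      hence "\<forall>z\<in>insert x N. \<exists>y\<in>Y. d z y \<le> max 0 \<rho>" using Y(3) y(1) by blast
      moreover have "Y \<subseteq> insert x N" using Y(1) by blast
      ultimately show ?thesis using Y(2) by (intro exI[of _ Y] conjI)
    next
      case False
      have *: "\<rho> \<le> d x y \<and> \<rho> \<le> d y x" if "y \<in> Y" for y
        using False that Y(1) x dist_commute[of x y] by force
      show ?thesis
      proof (intro exI[of _ "insert x Y"] conjI)
        show "\<forall>z\<in>insert x Y. \<forall>y\<in>insert x Y. z \<noteq> y \<longrightarrow> \<rho> \<le> d z y" using Y(2) * by blast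
        have "d x x \<le> max 0 \<rho>" using dist_self x by simp
        thus "\<forall>z\<in>insert x N. \<exists>y\<in>insert x Y. d z y \<le> max 0 \<rho>" using Y(3) by blast
      qed (use Y in auto)
    qed
  qed auto
qed

locale doubling_space = finite_metric +
  fixes C :: real
  assumes C: "C > 1" and doubling: "doubling X d p C"
begin

abbreviation mass :: "'a \<Rightarrow> real \<Rightarrow> real" where
  "mass x r \<equiv> measure_pmf.prob p (ball_on X d x r)"

abbreviation D :: real where "D \<equiv> diam_on X d"

lemma dist_le_diam: "x \<in> X \<Longrightarrow> y \<in> X \<Longrightarrow> d x y \<le> D"
  unfolding diam_on_def using finite_X by (intro Max_ge) auto

lemma diam_attained: obtains a b where "a \<in> X" "b \<in> X" "d a b = D"
proof -
  have "D \<in> (\<lambda>(a, b). d a b) ` (X \<times> X)"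
    unfolding diam_on_def using X_nonempty finite_X by (intro Max_in) auto
  thus ?thesis using that by auto
qed

lemma C_pow: "1 \<le> C ^ k" "0 < C ^ k"
  using C by (auto intro: one_le_power)

lemma mass_mono:
  assumes "ball_on X d x r \<subseteq> ball_on X d y s"
  shows "mass x r \<le> mass y s"
  using assms by (intro measure_pmf.finite_measure_mono) auto

lemma ball_subset:
  assumes "x \<in> X" "y \<in> X" "d y x + r \<le> s"
  shows "ball_on X d x r \<subseteq> ball_on X d y s"
  using assms dist_triangle[of y x] by (fastforce simp: ball_on_def)

lemma mass_doubling:
  assumes "x \<in> X" "r > 0"
  shows "mass x (2 ^ k * r) \<le> C ^ k * mass x r"
proof (induction k)
  case (Suc k)
  have "mass x (2 * (2 ^ k * r)) \<le> C * mass x (2 ^ k * r)"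
    using doubling assms unfolding doubling_def by simp
  also have "\<dots> \<le> C * (C ^ k * mass x r)" using Suc C by (intro mult_left_mono) auto
  finally show ?case by (simp add: mult_ac)
qed simp

lemma mass_diam:
  assumes "x \<in> X" "D \<le> r"
  shows "mass x r = 1"
proof -
  have "ball_on X d x r = X" using assms dist_le_diam by (fastforce simp: ball_on_def)
  thus ?thesis using p_X by (simp add: measure_pmf.prob_eq_1 AE_measure_pmf_iff subset_eq)
qed

text \<open>Enough doublings make the ball exhaust \<open>X\<close>, and its mass grows only by a
  finite factor on the way.\<close>

lemma mass_pos:
  assumes "x \<in> X" "r > 0"
  shows "0 < mass x r"
proof -
  obtain k where "D / r < 2 ^ k" using real_arch_pow[of 2 "D / r"] by auto
  hence "mass x (2 ^ k * r) = 1" using assms by (intro mass_diam) (auto simp: field_simps)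
  hence "1 \<le> C ^ k * mass x r" using mass_doubling[OF assms, of k] by simp
  hence "mass x r \<noteq> 0" by auto
  thus ?thesis by (simp add: zero_less_measure_iff)
qed

lemma cell_mass_prob: "cell_mass X p \<pi> x = measure_pmf.prob p (cell X \<pi> x)"
  unfolding cell_mass_def using finite_X
  by (subst measure_measure_pmf_finite) (auto simp: cell_def)

section \<open>Cells of a well separated net, compared with balls\<close>

context
  fixes N :: "'a set" and \<pi> :: "'a \<Rightarrow> 'a" and \<eta> :: real
  assumes \<eta>: "\<eta> > 0" and N: "well_separated_net X d \<eta> N" and \<pi>: "nearest_map X d N \<pi>"
begin

lemma net_X: "N \<subseteq> X" and net_finite: "finite N"
  using N finite_X finite_subset unfolding well_separated_net_def net_def by auto

lemma nearest_in_net: "y \<in> X \<Longrightarrow> \<pi> y \<in> N"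
  using \<pi> unfolding nearest_map_def is_arg_min_def by blast

lemma nearest_le: "y \<in> X \<Longrightarrow> z \<in> N \<Longrightarrow> d (\<pi> y) y \<le> d z y"
  using \<pi> unfolding nearest_map_def is_arg_min_def by force

lemma nearest_dist: "y \<in> X \<Longrightarrow> d (\<pi> y) y \<le> \<eta>"
proof -
  assume y: "y \<in> X"
  then obtain z where "z \<in> N" "d y z \<le> \<eta>" using N by (auto simp: well_separated_net_def net_def)
  thus ?thesis using nearest_le[OF y] dist_commute[OF y] net_X by fastforce
qed

lemma cell_subset_ball: "x \<in> N \<Longrightarrow> cell X \<pi> x \<subseteq> ball_on X d x \<eta>"
  using nearest_dist by (auto simp: cell_def ball_on_def)

text \<open>A point within \<open>\<eta>/2\<close> of \<open>x\<close> has its nearest net point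
  within \<open>\<eta>\<close> of \<open>x\<close>, which the packing property forces to be
  \<open>x\<close>. Cells thus lie between balls of radius \<open>\<eta>/2\<close> and
  \<open>\<eta>\<close>, so doubling makes their masses comparable to those of balls.\<close>

lemma ball_subset_cell:
  assumes x: "x \<in> N"
  shows "ball_on X d x (\<eta>/2) \<subseteq> cell X \<pi> x"
proof
  fix y assume "y \<in> ball_on X d x (\<eta>/2)"
  hence y: "y \<in> X" "d x y \<le> \<eta>/2" by (auto simp: ball_on_def)
  have X: "x \<in> X" "\<pi> y \<in> X" using x y nearest_in_net net_X by auto
  have "d x (\<pi> y) \<le> d x y + d (\<pi> y) y"
    using dist_triangle[of x y "\<pi> y"] dist_commute[of y "\<pi> y"] X y by simp
  also have "\<dots> \<le> \<eta>" using nearest_le[OF y(1) x] y by simp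
  finally have "\<pi> y = x"
    using N x nearest_in_net[OF y(1)] unfolding well_separated_net_def packing_def by force
  thus "y \<in> cell X \<pi> x" using y by (simp add: cell_def)
qed

lemma cell_mass_ge: "x \<in> N \<Longrightarrow> mass x (\<eta>/2) \<le> cell_mass X p \<pi> x"
  unfolding cell_mass_prob by (intro measure_pmf.finite_measure_mono ball_subset_cell) auto

lemma cell_mass_pos: "x \<in> N \<Longrightarrow> 0 < cell_mass X p \<pi> x"
  using mass_pos[of x "\<eta>/2"] cell_mass_ge[of x] net_X \<eta> by force

lemma sum_cell_mass_le:
  assumes S: "S \<subseteq> N" and sub: "\<And>x. x \<in> S \<Longrightarrow> cell X \<pi> x \<subseteq> B"
  shows "(\<Sum>x\<in>S. cell_mass X p \<pi> x) \<le> measure_pmf.prob p B"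
proof -
  have "(\<Sum>x\<in>S. cell_mass X p \<pi> x) = measure_pmf.prob p (\<Union>x\<in>S. cell X \<pi> x)"
    unfolding cell_mass_prob using S net_finite
    by (intro measure_pmf.finite_measure_finite_Union[symmetric])
       (auto simp: disjoint_family_on_def cell_def intro: finite_subset)
  also have "\<dots> \<le> measure_pmf.prob p B"
    using sub by (intro measure_pmf.finite_measure_mono) auto
  finally show ?thesis .
qed

end

section \<open>Lower bound\<close>

text \<open>Net points are regrouped around a separated subset \<open>Y\<close> at the coarser scale
  \<open>\<rho>\<close>, and mass is moved between balls of radius \<open>\<rho>/4\<close> around
  \<open>Y\<close>, of masses \<open>b\<close>. \<open>A\<close> absorbs every comparison between
  cells and these balls. As \<open>V ^ 3\<close> is the square of the truncated norm, the conclusion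
  is the square of a bound linear in \<open>n\<close>.\<close>

lemma tester_ge_truncated_norm:
  fixes N \<pi> \<eta> m
  assumes \<eta>: "\<eta> > 0" and N: "well_separated_net X d \<eta> N" and \<pi>: "nearest_map X d N \<pi>"
    and \<epsilon>: "\<epsilon> > 0" and tester: "is_tester X d p \<epsilon> n T"
    and m: "8 * C ^ 3 \<le> 2 ^ m"
    and K: "K \<subseteq> N" "K \<noteq> {}" and R: "R \<subseteq> N"
    and RK: "\<And>x y. x \<in> R \<Longrightarrow> y \<in> K \<Longrightarrow> cell_mass X p \<pi> x \<le> cell_mass X p \<pi> y"
    and removed: "\<epsilon> / \<eta> \<le> (\<Sum>x\<in>R. cell_mass X p \<pi> x)"
  defines "A \<equiv> C ^ (m + 5)" and "V \<equiv> (\<Sum>x\<in>K. cell_mass X p \<pi> x powr (2/3))"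
  assumes V: "2 * A\<^sup>2 \<le> V"
  shows "V ^ 3 \<le> 128 * A ^ 5 * (\<epsilon> / \<eta>) ^ 4 * (real n)\<^sup>2"
proof -
  note net = \<eta> N \<pi>
  define f where "f = cell_mass X p \<pi>"
  define \<delta> where "\<delta> = \<epsilon> / \<eta>"
  define \<rho> where "\<rho> = 2 ^ m * \<eta>"
  define b where "b = (\<lambda>y. mass y (\<rho>/2/2))"
  have \<delta>: "\<delta> > 0" using \<epsilon> \<eta> by (simp add: \<delta>_def)
  have \<rho>: "\<rho> > 0" "\<eta> \<le> \<rho>" using \<eta> by (auto simp: \<rho>_def)
  have NX: "N \<subseteq> X" and fN: "finite N" using net_X[OF net] net_finite[OF net] by auto
  have f: "f x > 0" if "x \<in> N" for x unfolding f_def by (rule cell_mass_pos[OF net that])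
  obtain Y where Y: "Y \<subseteq> N" "\<And>x y. x \<in> Y \<Longrightarrow> y \<in> Y \<Longrightarrow> x \<noteq> y \<Longrightarrow> \<rho> \<le> d x y"
    "\<forall>x\<in>N. \<exists>y\<in>Y. d x y \<le> \<rho>"
    using maximal_separated_subset[OF NX, of \<rho>] \<rho> by (auto simp: max_def)
  then obtain \<sigma> where \<sigma>: "\<And>x. x \<in> N \<Longrightarrow> \<sigma> x \<in> Y" "\<And>x. x \<in> N \<Longrightarrow> d x (\<sigma> x) \<le> \<rho>" by metis
  have YX: "Y \<subseteq> X" using Y(1) NX by blast
  have b0: "0 < b y" if "y \<in> Y" for y unfolding b_def using that YX \<rho> by (intro mass_pos) auto
  have b1: "b y \<le> 1" for y by (simp add: b_def)
  have A: "1 \<le> A" "C ^ 3 \<le> A" "C ^ (m + 2) \<le> A"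
    using C power_increasing[of 0 "m + 5" C] power_increasing[of 3 "m + 5" C]
      power_increasing[of "m + 2" "m + 5" C] by (auto simp: A_def)
  have cell_ball: "cell X \<pi> x \<subseteq> ball_on X d (\<sigma> x) (2 * \<rho>)" if x: "x \<in> N" for x
  proof -
    have "x \<in> X" "\<sigma> x \<in> X" using x \<sigma> NX YX by auto
    hence "ball_on X d x \<eta> \<subseteq> ball_on X d (\<sigma> x) (2 * \<rho>)"
      using \<sigma>(2)[OF x] dist_commute[of x "\<sigma> x"] \<rho> by (intro ball_subset) auto
    thus ?thesis using cell_subset_ball[OF net x] by blast
  qed
  have big: "mass y (2 * \<rho>) \<le> C ^ 3 * b y" if "y \<in> Y" for y
    using mass_doubling[of y "\<rho>/2/2" 3] that YX \<rho> by (auto simp: b_def)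
  have bf: "b (\<sigma> x) \<le> C ^ (m + 2) * f x" if x: "x \<in> N" for x
  proof -
    have X: "x \<in> X" "\<sigma> x \<in> X" using x \<sigma> NX YX by auto
    have "b (\<sigma> x) \<le> mass x (2 ^ (m + 2) * (\<eta>/2))"
    proof -
      have "2 ^ (m + 2) * (\<eta>/2) = 2 * \<rho>" by (simp add: \<rho>_def)
      thus ?thesis unfolding b_def using X \<sigma>(2)[OF x] \<rho>(1) by (intro mass_mono ball_subset) auto
    qed
    also have "\<dots> \<le> C ^ (m + 2) * mass x (\<eta>/2)" using X \<eta> by (intro mass_doubling) auto
    also have "\<dots> \<le> C ^ (m + 2) * f x"
      unfolding f_def using cell_mass_ge[OF net x] less_imp_le[OF C_pow(2)[of "m + 2"]]
      by (rule mult_left_mono)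
    finally show ?thesis .
  qed
  have fiber: "(\<Sum>x\<in>{x \<in> S. \<sigma> x = y}. f x) \<le> C ^ 3 * b y" if "S \<subseteq> N" "y \<in> Y" for S y
  proof -
    have "(\<Sum>x\<in>{x \<in> S. \<sigma> x = y}. f x) \<le> mass y (2 * \<rho>)"
      unfolding f_def using that cell_ball by (intro sum_cell_mass_le[OF net]) auto
    also have "\<dots> \<le> C ^ 3 * b y" by (rule big[OF that(2)])
    finally show ?thesis .
  qed
  have group: "(\<Sum>x\<in>S. g x) = (\<Sum>y\<in>\<sigma> ` S. \<Sum>x\<in>{x \<in> S. \<sigma> x = y}. g x)" if "S \<subseteq> N"
    for S and g :: "'a \<Rightarrow> real"
    using that fN by (intro sum.group[symmetric]) (auto intro: finite_subset)
  have img: "\<sigma> ` S \<subseteq> Y" if "S \<subseteq> N" for S using that \<sigma> by blast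
  have sumf: "(\<Sum>x\<in>S. f x) \<le> C ^ 3 * (\<Sum>y\<in>\<sigma> ` S. b y)" if "S \<subseteq> N" for S
    unfolding group[OF that] sum_distrib_left using img[OF that] fiber[OF that]
    by (intro sum_mono) auto
  define VA where "VA = (\<Sum>y\<in>\<sigma> ` K. b y powr (2/3))"
  \<comment> \<open>Split \<open>f x powr (2/3)\<close> into \<open>f x\<close> and
    \<open>f x powr (-(1/3))\<close>. The second factor needs only the pointwise lower bound
    \<open>bf\<close>, while the first sums to the mass of the group; this spares counting the net
    points per group. The factors \<open>C ^ (m + 2)\<close> and \<open>C ^ 3\<close> multiply to
    \<open>A\<close>.\<close>
  have sum23: "V \<le> A * VA"
  proof -
    have "V = (\<Sum>y\<in>\<sigma> ` K. \<Sum>x\<in>{x \<in> K. \<sigma> x = y}. f x powr (2/3))"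
      unfolding V_def f_def[symmetric] by (rule group[OF K(1)])
    also have "\<dots> \<le> (\<Sum>y\<in>\<sigma> ` K. A * b y powr (2/3))"
    proof (rule sum_mono)
      fix y assume "y \<in> \<sigma> ` K"
      hence y: "y \<in> Y" using img[OF K(1)] by blast
      have "f x powr (2/3) \<le> f x * (C ^ (m + 2) * b y powr (- (1/3)))"
        if "x \<in> {x \<in> K. \<sigma> x = y}" for x
      proof -
        have x: "x \<in> N" "\<sigma> x = y" using that K(1) by auto
        have f1: "b y / C ^ (m + 2) \<le> f x" "0 < b y / C ^ (m + 2)"
          using bf[OF x(1)] x b0[OF y] C_pow(2)[of "m + 2"] by (auto simp: field_simps)
        have "f x powr (- (1/3)) \<le> (b y / C ^ (m + 2)) powr (- (1/3))"
          using f1 by (intro powr_mono2') auto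
        also have "\<dots> = b y powr (- (1/3)) * (C ^ (m + 2)) powr (1/3)"
          using b0[OF y] C_pow(2)[of "m + 2"] by (simp add: powr_divide powr_minus field_simps)
        also have "(C ^ (m + 2)) powr (1/3) \<le> (C ^ (m + 2)) powr 1"
          using C_pow(1)[of "m + 2"] by (intro powr_mono) auto
        finally have "f x powr (- (1/3)) \<le> b y powr (- (1/3)) * C ^ (m + 2)"
          using C_pow(2)[of "m + 2"] by (simp add: mult_left_mono)
        hence "f x * f x powr (- (1/3)) \<le> f x * (C ^ (m + 2) * b y powr (- (1/3)))"
          using f[OF x(1)] by (subst (2) mult.commute) (intro mult_left_mono, auto)
        moreover have "f x * f x powr (- (1/3)) = f x powr (1 + - (1/3))"
          using f[OF x(1)] by (subst powr_add) simp
        ultimately show ?thesis by simp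
      qed
      hence "(\<Sum>x\<in>{x \<in> K. \<sigma> x = y}. f x powr (2/3))
          \<le> (\<Sum>x\<in>{x \<in> K. \<sigma> x = y}. f x) * (C ^ (m + 2) * b y powr (- (1/3)))"
        unfolding sum_distrib_right by (intro sum_mono)
      also have "\<dots> \<le> (C ^ 3 * b y) * (C ^ (m + 2) * b y powr (- (1/3)))"
        using fiber[OF K(1) y] C_pow(2)[of "m + 2"] by (intro mult_right_mono) auto
      also have "\<dots> = A * (b y powr 1 * b y powr (- (1/3)))"
        using b0[OF y] by (simp add: A_def power_add eval_nat_numeral)
      also have "b y powr 1 * b y powr (- (1/3)) = b y powr (2/3)"
        by (subst powr_add[symmetric]) simp
      finally show "(\<Sum>x\<in>{x \<in> K. \<sigma> x = y}. f x powr (2/3)) \<le> A * b y powr (2/3)" .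
    qed
    finally show ?thesis by (simp add: VA_def sum_distrib_left)
  qed
  have VA: "2 * A \<le> VA"
  proof -
    have "A * (2 * A) \<le> A * VA" using V sum23 by (simp add: power2_eq_square)
    thus ?thesis using A(1) by simp
  qed
  have VA2: "2 \<le> VA" "0 < VA" using VA A(1) by linarith+
  \<comment> \<open>The mass that \<open>tester_bound\<close> asks for at separation radius
    \<open>\<rho>/2\<close>.\<close>
  define \<tau> where "\<tau> = 4 * \<epsilon> / \<rho>"
  have \<tau>0: "0 < \<tau>" using \<epsilon> \<rho> by (simp add: \<tau>_def)
  \<comment> \<open>The purpose of the coarse scale: after the factor \<open>C ^ 3\<close> lost from
    cells to balls, the removed points still carry twice the required mass.\<close>
  have \<tau>: "2 * C ^ 3 * \<tau> \<le> \<delta>"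
  proof -
    have "8 * C ^ 3 * (\<epsilon> / \<eta>) \<le> 2 ^ m * (\<epsilon> / \<eta>)" using m \<epsilon> \<eta> by (intro mult_right_mono) auto
    thus ?thesis using \<eta> by (simp add: \<tau>_def \<delta>_def \<rho>_def pos_divide_le_eq mult_ac)
  qed
  have \<tau>\<delta>: "\<tau> \<le> \<delta>"
    using \<tau> C_pow(1)[of 3] \<tau>0 mult_right_mono[of 1 "2 * C ^ 3" \<tau>] by linarith
  have \<delta>1: "\<delta> \<le> 1"
  proof -
    have "(\<Sum>x\<in>R. cell_mass X p \<pi> x) \<le> measure_pmf.prob p X"
      using R by (intro sum_cell_mass_le[OF net]) (auto simp: cell_def)
    also have "\<dots> \<le> 1" by simp
    finally show ?thesis using removed by (simp add: \<delta>_def)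
  qed
  \<comment> \<open>Normalised so that the shifts \<open>\<alpha> * b y powr (2/3)\<close> sum to
    \<open>2 * \<tau>\<close>; half of this may be lost to the largest element.\<close>
  define \<alpha> where "\<alpha> = 2 * \<tau> / VA"
  have \<alpha>: "0 < \<alpha>" using \<tau>0 VA2 by (simp add: \<alpha>_def)
  have bound: "1/2 \<le> (real n)\<^sup>2 * (\<Sum>y\<in>Z. 4 * ((\<xi> y)\<^sup>2 / b y)\<^sup>2)"
    if Z: "Z \<subseteq> Y" and \<xi>: "\<And>y. y \<in> Z \<Longrightarrow> 0 \<le> \<xi> y" "\<And>y. y \<in> Z \<Longrightarrow> \<xi> y \<le> b y"
      and mono: "\<And>x y. x \<in> Z \<Longrightarrow> y \<in> Z \<Longrightarrow> b x \<le> b y \<Longrightarrow> \<xi> x \<le> \<xi> y"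
      and M: "0 \<le> M" "\<And>y. y \<in> Z \<Longrightarrow> \<xi> y \<le> M" and large: "\<tau> \<le> (\<Sum>y\<in>Z. \<xi> y) - M" for Z \<xi> M
    unfolding b_def
  proof (rule tester_bound[where M = M])
    show "2 * \<epsilon> / (\<rho>/2) \<le> (\<Sum>y\<in>Z. \<xi> y) - M" using large by (simp add: \<tau>_def)
    show "\<And>x y. x \<in> Z \<Longrightarrow> y \<in> Z \<Longrightarrow> x \<noteq> y \<Longrightarrow> 2 * (\<rho>/2) \<le> d x y" using Y(2) Z by auto
    show "is_tester X d p \<epsilon> n T" by fact
  qed (use Z YX \<rho> b0 \<xi> mono M in \<open>auto simp: b_def\<close>)
  \<comment> \<open>If \<open>\<alpha> * b powr (2/3)\<close> exceeds \<open>b\<close> at a kept point, all removed cells are so light that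
    perturbing them by a fixed proportion costs no more.\<close>
  have cost: "1/2 \<le> (real n)\<^sup>2 * (64 * A\<^sup>2 * \<tau> ^ 4 / VA ^ 3)"
  proof (cases "\<forall>y\<in>\<sigma> ` K. \<alpha> ^ 3 \<le> b y")
    case True
    have bK: "0 < b y" if "y \<in> \<sigma> ` K" for y using b0 img[OF K(1)] that by blast
    have "1/2 \<le> (real n)\<^sup>2 * (\<Sum>y\<in>\<sigma> ` K. 4 * ((\<alpha> * b y powr (2/3))\<^sup>2 / b y)\<^sup>2)"
    proof (rule bound[where M = \<alpha>])
      fix y assume y: "y \<in> \<sigma> ` K"
      have "\<alpha> = (\<alpha> ^ 3) powr (1/3)" using \<alpha> by (simp add: powr_powr flip: powr_numeral)
      also have "\<dots> \<le> b y powr (1/3)" using True y \<alpha> by (intro powr_mono2) auto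
      finally have "\<alpha> * b y powr (2/3) \<le> b y powr (1/3) * b y powr (2/3)"
        by (intro mult_right_mono) auto
      thus "\<alpha> * b y powr (2/3) \<le> b y" using bK[OF y] by (simp flip: powr_add)
      have "b y powr (2/3) \<le> 1 powr (2/3)" using b1 bK[OF y] by (intro powr_mono2) auto
      thus "\<alpha> * b y powr (2/3) \<le> \<alpha>" using \<alpha> by simp
    next
      fix x y assume "x \<in> \<sigma> ` K" "y \<in> \<sigma> ` K" "b x \<le> b y"
      thus "\<alpha> * b x powr (2/3) \<le> \<alpha> * b y powr (2/3)"
        using \<alpha> bK[of x] by (intro mult_left_mono powr_mono2) auto
    next
      have "\<tau> = \<alpha> * VA / 2" using VA2 by (simp add: \<alpha>_def)
      \<comment> \<open>Every shift is at most \<open>\<alpha>\<close> because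
        \<open>b \<le> 1\<close>, and \<open>VA \<ge> 2\<close> makes this at most half of the
        total.\<close>
      also have "\<dots> \<le> \<alpha> * (VA - 1)" using VA2 \<alpha> by simp
      finally show "\<tau> \<le> (\<Sum>y\<in>\<sigma> ` K. \<alpha> * b y powr (2/3)) - \<alpha>"
        by (simp add: VA_def algebra_simps flip: sum_distrib_left)
    qed (use \<alpha> img[OF K(1)] in auto)
    also have "(\<Sum>y\<in>\<sigma> ` K. 4 * ((\<alpha> * b y powr (2/3))\<^sup>2 / b y)\<^sup>2) = (\<Sum>y\<in>\<sigma> ` K. 4 * \<alpha> ^ 4 * b y powr (2/3))"
    proof (intro sum.cong refl)
      fix y assume y: "y \<in> \<sigma> ` K"
      have "(b y powr (2/3))\<^sup>2 / b y = b y powr (4/3) / b y powr 1"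
        using bK[OF y] by (simp add: power2_eq_square flip: powr_add)
      also have "\<dots> = b y powr (1/3)" by (subst powr_diff[symmetric]) simp
      finally have "((\<alpha> * b y powr (2/3))\<^sup>2 / b y)\<^sup>2 = \<alpha> ^ 4 * (b y powr (1/3))\<^sup>2"
        by (simp add: power_mult_distrib flip: power_mult times_divide_eq_right)
      thus "4 * ((\<alpha> * b y powr (2/3))\<^sup>2 / b y)\<^sup>2 = 4 * \<alpha> ^ 4 * b y powr (2/3)"
        by (simp add: power2_eq_square flip: powr_add)
    qed
    also have "\<dots> = 4 * \<alpha> ^ 4 * VA" by (simp add: VA_def sum_distrib_left)
    also have "\<dots> = 64 * \<tau> ^ 4 / VA ^ 3"
      using VA2 by (simp add: \<alpha>_def power_divide eval_nat_numeral)
    also have "(real n)\<^sup>2 * (64 * \<tau> ^ 4 / VA ^ 3) \<le> (real n)\<^sup>2 * (64 * A\<^sup>2 * \<tau> ^ 4 / VA ^ 3)"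
      using A(1) VA2 \<tau>0 by (intro mult_left_mono divide_right_mono mult_right_mono) auto
    finally show ?thesis .
  next
    case False
    then obtain x0 where x0: "x0 \<in> K" "b (\<sigma> x0) < \<alpha> ^ 3" by force
    \<comment> \<open>A bound on all removed balls: a removed ball is at most \<open>A\<close> times
      its cell, which is no heavier than the kept cell of \<open>x0\<close>, which is at most
      \<open>A\<close> times the ball of mass below \<open>\<alpha> ^ 3\<close>.\<close>
    define \<beta> where "\<beta> = A\<^sup>2 * \<alpha> ^ 3"
    define B where "B = (\<Sum>y\<in>\<sigma> ` R. b y)"
    \<comment> \<open>Removed balls are perturbed in proportion to their mass, again with total
      \<open>2 * \<tau>\<close>.\<close>
    define \<kappa> where "\<kappa> = 2 * \<tau> / B"
    have bR: "0 < b y" if "y \<in> \<sigma> ` R" for y using b0 img[OF R] that by blast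
    have b\<beta>: "b y \<le> \<beta>" if y: "y \<in> \<sigma> ` R" for y
    proof -
      obtain x where x: "x \<in> R" "y = \<sigma> x" using y by blast
      have "b y \<le> C ^ (m + 2) * f x" using bf x R by blast
      also have "\<dots> \<le> A * f x" using A f[of x] x R by (intro mult_right_mono) (auto simp: less_imp_le)
      also have "\<dots> \<le> A * f x0" using A RK[OF x(1) x0(1)] by (intro mult_left_mono) (auto simp: f_def)
      also have "f x0 \<le> mass (\<sigma> x0) (2 * \<rho>)"
        using cell_ball[of x0] x0 K unfolding f_def cell_mass_prob
        by (intro measure_pmf.finite_measure_mono) auto
      also have "\<dots> \<le> C ^ 3 * b (\<sigma> x0)" using x0 K \<sigma> by (intro big) auto
      also have "\<dots> \<le> A * b (\<sigma> x0)" using A by (intro mult_right_mono) (auto simp: b_def)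
      also have "\<dots> \<le> A * \<alpha> ^ 3" using x0 A by (intro mult_left_mono) auto
      finally show ?thesis using A by (simp add: \<beta>_def power2_eq_square mult_ac)
    qed
    have \<beta>0: "0 \<le> \<beta>" using \<alpha> by (simp add: \<beta>_def)
    have "\<delta> \<le> C ^ 3 * B" using removed sumf[OF R] by (simp add: \<delta>_def f_def B_def)
    hence "C ^ 3 * (2 * \<tau>) \<le> C ^ 3 * B" using \<tau> by simp
    hence \<tau>B: "2 * \<tau> \<le> B" using C_pow(2)[of 3] by simp
    hence B0: "0 < B" using \<tau>0 by linarith
    have \<kappa>: "0 < \<kappa>" "\<kappa> \<le> 1" using \<tau>B B0 \<tau>0 by (auto simp: \<kappa>_def)
    \<comment> \<open>From \<open>VA \<ge> 2 * A\<close> and \<open>\<tau> \<le> 1\<close>; hence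
      the largest removed ball has at most half of \<open>B\<close>, and pairing loses at most half
      of the total.\<close>
    have "2 * \<beta> \<le> 2 * \<tau>"
    proof -
      have "(2 * A) ^ 3 \<le> VA ^ 3" using VA A by (intro power_mono) auto
      moreover have "A\<^sup>2 * 8 \<le> (2 * A) ^ 3" using A(1) by (simp add: eval_nat_numeral)
      moreover have "\<tau>\<^sup>2 \<le> 1\<^sup>2" using \<tau>0 \<tau>\<delta> \<delta>1 by (intro power_mono) auto
      ultimately have "A\<^sup>2 * 8 * \<tau>\<^sup>2 \<le> VA ^ 3 * 1"
        using VA2 by (intro mult_mono) auto
      hence "\<tau> * (A\<^sup>2 * 8 * \<tau>\<^sup>2) \<le> \<tau> * VA ^ 3" using \<tau>0 by (intro mult_left_mono) auto
      thus ?thesis using VA2 by (simp add: \<beta>_def \<alpha>_def field_simps power_divide eval_nat_numeral)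
    qed
    hence \<beta>B: "2 * \<beta> \<le> B" using \<tau>B by linarith
    have "1/2 \<le> (real n)\<^sup>2 * (\<Sum>y\<in>\<sigma> ` R. 4 * ((\<kappa> * b y)\<^sup>2 / b y)\<^sup>2)"
    proof (rule bound[where M = "\<kappa> * \<beta>"])
      have "\<tau> = \<kappa> * B / 2" using B0 by (simp add: \<kappa>_def)
      also have "\<dots> \<le> \<kappa> * (B - \<beta>)" using \<beta>B \<kappa> by simp
      finally show "\<tau> \<le> (\<Sum>y\<in>\<sigma> ` R. \<kappa> * b y) - \<kappa> * \<beta>"
        by (simp add: B_def algebra_simps flip: sum_distrib_left)
    next
      fix y assume y: "y \<in> \<sigma> ` R"
      show "\<kappa> * b y \<le> b y" using \<kappa> bR[OF y] by simp
      show "\<kappa> * b y \<le> \<kappa> * \<beta>" using \<kappa> b\<beta>[OF y] by simp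
      show "0 \<le> \<kappa> * b y" using \<kappa> bR[OF y] by simp
    qed (use \<kappa> \<beta>0 img[OF R] in auto)
    also have "\<dots> \<le> (real n)\<^sup>2 * (64 * A\<^sup>2 * \<tau> ^ 4 / VA ^ 3)"
    proof (intro mult_left_mono)
      have "(\<Sum>y\<in>\<sigma> ` R. 4 * ((\<kappa> * b y)\<^sup>2 / b y)\<^sup>2) \<le> (\<Sum>y\<in>\<sigma> ` R. 4 * \<kappa> * \<beta> * b y)"
      proof (intro sum_mono)
        fix y assume y: "y \<in> \<sigma> ` R"
        have "((\<kappa> * b y)\<^sup>2 / b y)\<^sup>2 = \<kappa> ^ 4 * (b y * b y)"
          using bR[OF y] by (simp add: power_mult_distrib power2_eq_square) (simp add: eval_nat_numeral)
        \<comment> \<open>Keeping a single factor \<open>\<kappa>\<close> is enough: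
          \<open>\<kappa> * B = 2 * \<tau>\<close>, so the total becomes
          \<open>8 * \<tau> * \<beta>\<close>, which by the choice of \<open>\<beta>\<close> is
          exactly the claimed cost.\<close>
        also have "\<dots> \<le> \<kappa> ^ 1 * (\<beta> * b y)"
          using \<kappa> b\<beta>[OF y] bR[OF y] by (intro mult_mono power_decreasing) auto
        finally show "4 * ((\<kappa> * b y)\<^sup>2 / b y)\<^sup>2 \<le> 4 * \<kappa> * \<beta> * b y" by simp
      qed
      also have "\<dots> = 4 * \<kappa> * \<beta> * B" by (simp add: B_def sum_distrib_left)
      also have "\<dots> = 8 * \<tau> * \<beta>" using B0 by (simp add: \<kappa>_def)
      also have "\<dots> = 64 * A\<^sup>2 * \<tau> ^ 4 / VA ^ 3"
        by (simp add: \<beta>_def \<alpha>_def power_divide eval_nat_numeral)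
      finally show "(\<Sum>y\<in>\<sigma> ` R. 4 * ((\<kappa> * b y)\<^sup>2 / b y)\<^sup>2) \<le> 64 * A\<^sup>2 * \<tau> ^ 4 / VA ^ 3" .
    qed simp
    finally show ?thesis .
  qed
  have "VA ^ 3 \<le> 128 * A\<^sup>2 * \<tau> ^ 4 * (real n)\<^sup>2"
    using cost VA2 by (simp add: field_simps)
  also have "\<dots> \<le> 128 * A\<^sup>2 * \<delta> ^ 4 * (real n)\<^sup>2"
    using \<tau>\<delta> \<tau>0 by (intro mult_right_mono mult_left_mono power_mono) auto
  finally have "A ^ 3 * VA ^ 3 \<le> A ^ 3 * (128 * A\<^sup>2 * \<delta> ^ 4 * (real n)\<^sup>2)"
    using A(1) by (intro mult_left_mono) auto
  moreover have "V ^ 3 \<le> (A * VA) ^ 3"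
    using sum23 by (intro power_mono) (auto simp: V_def intro!: sum_nonneg)
  ultimately show ?thesis
    by (simp add: power_mult_distrib \<delta>_def) (simp add: eval_nat_numeral mult_ac)
qed

text \<open>Without samples the verdict has the same law for every distribution and cannot be right
  for both \<open>p\<close> and a far \<open>q\<close>.\<close>

lemma tester_sample_pos:
  assumes "is_tester X d p \<epsilon> n T" "far_dists X d p \<epsilon> \<noteq> {}"
  shows "1 \<le> n"
proof (rule ccontr)
  assume "\<not> 1 \<le> n"
  hence n: "n = 0" by simp
  obtain q where "q \<in> far_dists X d p \<epsilon>" using assms by blast
  hence "2/3 \<le> accept_prob 0 T p" "2/3 \<le> reject_prob 0 T q"
    using assms n by (auto simp: is_tester_def)
  moreover have "reject_prob 0 T q = reject_prob 0 T p" by (simp add: reject_prob_def)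
  ultimately show False using accept_reject_prob[of 0 T p] by simp
qed

text \<open>Doubling twice from radius \<open>D/4\<close> reaches all of \<open>X\<close>, so balls
  of that radius have mass at least \<open>1 / C\<^sup>2\<close>; once \<open>D / \<epsilon>\<close>
  is large, a shift of \<open>4 * \<epsilon> / D\<close> fits into two of them around points at
  distance \<open>D\<close>. For small \<open>D / \<epsilon>\<close> the claim reduces to
  \<open>n \<ge> 1\<close>.\<close>

lemma tester_ge_diam_squared:
  assumes \<epsilon>: "\<epsilon> > 0" and T: "is_tester X d p \<epsilon> n T" and far: "far_dists X d p \<epsilon> \<noteq> {}"
  shows "(D / \<epsilon>)\<^sup>2 \<le> 64 * C ^ 4 * real n"
proof (cases "D / \<epsilon> < 4 * C\<^sup>2")
  case True
  obtain a b where "a \<in> X" "b \<in> X" "d a b = D" by (rule diam_attained)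
  hence "0 \<le> D" using dist_nonneg by metis
  hence "(D / \<epsilon>)\<^sup>2 \<le> (4 * C\<^sup>2)\<^sup>2" using True \<epsilon> by (intro power_mono) auto
  also have "\<dots> \<le> 64 * C ^ 4 * 1" using C_pow[of 4] by (simp add: power_mult_distrib)
  also have "\<dots> \<le> 64 * C ^ 4 * real n"
    using tester_sample_pos[OF T far] C_pow(2)[of 4] by (intro mult_left_mono) auto
  finally show ?thesis .
next
  case False
  hence D: "4 * C\<^sup>2 * \<epsilon> \<le> D" using \<epsilon> by (simp add: field_simps)
  have C2: "0 < C\<^sup>2" using C by simp
  have D0: "D > 0" using D \<epsilon> C2 by (smt (verit) mult_pos_pos)
  obtain a b where ab: "a \<in> X" "b \<in> X" "d a b = D" by (rule diam_attained)
  have neq: "a \<noteq> b" using ab dist_self D0 by auto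
  \<comment> \<open>The mass required at radius \<open>D/2\<close>. Both points carry the shift
    \<open>e\<close>, and pairing loses one of them.\<close>
  define e where "e = 4 * \<epsilon> / D"
  have e: "0 < e" "e * C\<^sup>2 \<le> 1" using \<epsilon> D D0 by (auto simp: e_def field_simps)
  have m: "1 \<le> C\<^sup>2 * mass y (D/4)" if "y \<in> X" for y
    using mass_doubling[of y "D/4" 2] mass_diam[of y D] that D0 by simp
  have em: "e \<le> mass y (D/2/2)" if "y \<in> X" for y
  proof -
    have "e * C\<^sup>2 \<le> mass y (D/4) * C\<^sup>2" using e(2) m[OF that] by (simp add: mult.commute)
    thus ?thesis using C2 by simp
  qed
  have "1/2 \<le> (real n)\<^sup>2 * (\<Sum>y\<in>{a, b}. 4 * (e\<^sup>2 / mass y (D/2/2))\<^sup>2)"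
  proof (rule tester_bound[where M = e])
    show "\<And>x y. x \<in> {a, b} \<Longrightarrow> y \<in> {a, b} \<Longrightarrow> x \<noteq> y \<Longrightarrow> 2 * (D / 2) \<le> d x y"
      using ab dist_commute[of a b] by auto
    show "2 * \<epsilon> / (D / 2) \<le> (\<Sum>y\<in>{a, b}. e) - e" using neq by (simp add: e_def)
    show "is_tester X d p \<epsilon> n T" by fact
    show "\<And>y. y \<in> {a, b} \<Longrightarrow> 0 < mass y (D/2/2)" using ab D0 by (intro mass_pos) auto
  qed (use ab D0 e em in auto)
  also have "\<dots> \<le> (real n)\<^sup>2 * (\<Sum>y\<in>{a, b}. 4 * (e\<^sup>2 * C\<^sup>2)\<^sup>2)"
  proof (intro mult_left_mono sum_mono power_mono)
    fix y assume "y \<in> {a, b}"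
    hence y: "y \<in> X" using ab by auto
    have "e\<^sup>2 * 1 \<le> e\<^sup>2 * (C\<^sup>2 * mass y (D/4))" using m[OF y] by (intro mult_left_mono) auto
    thus "e\<^sup>2 / mass y (D/2/2) \<le> e\<^sup>2 * C\<^sup>2"
      using mass_pos[OF y, of "D/4"] D0 by (simp add: pos_divide_le_eq mult_ac)
  qed auto
  also have "\<dots> = (real n)\<^sup>2 * (8 * 256 * C ^ 4 * (\<epsilon> / D) ^ 4)"
    using neq by (simp add: e_def power_mult_distrib power_divide)
  finally have "(D / \<epsilon>) ^ 4 \<le> 4096 * C ^ 4 * (real n)\<^sup>2"
    using D0 \<epsilon> by (simp add: field_simps power_divide)
  also have "\<dots> \<le> 4096 * (C ^ 4 * C ^ 4) * (real n)\<^sup>2"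
    using mult_left_mono[OF C_pow(1)[of 4], of "C ^ 4"] C_pow(2)[of 4]
    by (intro mult_right_mono mult_left_mono) auto
  also have "\<dots> = (64 * C ^ 4 * real n)\<^sup>2" by (simp add: power2_eq_square)
  finally have "((D / \<epsilon>)\<^sup>2)\<^sup>2 \<le> (64 * C ^ 4 * real n)\<^sup>2" by (simp flip: power_mult)
  thus ?thesis by (rule power2_le_imp_le) (use C_pow in auto)
qed

text \<open>If \<open>V\<close> is below \<open>2 * A\<^sup>2\<close>, the norm is bounded and the
  diameter estimate suffices, since every scale is at most \<open>D\<close>. The linear term follows
  from \<open>u \<le> 1 + u ^ 2\<close>, where the 1 is paid by \<open>n \<ge> 1\<close>.\<close>

lemma lower_rate_le:
  fixes m
  defines "A \<equiv> C ^ (m + 5)"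
  assumes \<epsilon>: "\<epsilon> > 0" and T: "is_tester X d p \<epsilon> n T" and far: "far_dists X d p \<epsilon> \<noteq> {}"
    and m: "8 * C ^ 3 \<le> 2 ^ m"
    and net: "\<And>i. i \<in> scales D \<epsilon> \<Longrightarrow> well_separated_net X d (2 powi i) (N i) \<and> nearest_map X d (N i) (\<pi> i)"
  shows "lower_rate X d p \<epsilon> N \<pi> \<le> 256 * A ^ 4 * C ^ 4 * real n"
proof -
  have A: "1 \<le> A" using C_pow by (simp add: A_def)
  have n1: "1 \<le> real n" using tester_sample_pos[OF T far] by simp
  have Dn: "(D / \<epsilon>)\<^sup>2 \<le> 64 * C ^ 4 * real n" by (rule tester_ge_diam_squared[OF \<epsilon> T far])
  have G: "x * real n \<le> 256 * A ^ 4 * C ^ 4 * real n" if "x \<le> 256 * A ^ 4 * C ^ 4" for x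
    using that by (intro mult_right_mono) auto
  have AC: "1 \<le> A ^ 4" "1 \<le> C ^ 4" using A C_pow by (auto intro: one_le_power)
  have "max (2 powi (2 * i) * \<epsilon> powi (-2) * norm23 (trunc (2 powi (- i) * \<epsilon>) (net_vec X p (N i) (\<pi> i))))
           (2 powi i * \<epsilon> powi (-1)) \<le> 256 * A ^ 4 * C ^ 4 * real n" (is "max (?a * norm23 ?v) ?b \<le> ?G")
    if i: "i \<in> scales D \<epsilon>" for i
  proof -
    define \<eta> :: real where "\<eta> = 2 powi i"
    have \<eta>: "\<eta> > 0" "\<eta> \<le> D" using i by (auto simp: \<eta>_def power_int_le_diam)
    note nets = \<eta>(1) net[OF i, THEN conjunct1, folded \<eta>_def] net[OF i, THEN conjunct2]
    have a: "?a = (\<eta> / \<epsilon>)\<^sup>2"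
      by (simp add: \<eta>_def power_int_minus power_int_mult mult.commute[of 2 i] field_simps power_divide)
    have \<eta>D: "\<eta> / \<epsilon> \<le> D / \<epsilon>" "0 < \<eta> / \<epsilon>" using \<eta> \<epsilon> by (auto simp: divide_right_mono)
    hence aD: "?a \<le> 64 * C ^ 4 * real n"
      unfolding a by (intro order.trans[OF power_mono Dn]) auto
    have "?b = \<eta> / \<epsilon>" by (simp add: \<eta>_def power_int_minus field_simps)
    also have "\<dots> \<le> 1 + (\<eta> / \<epsilon>)\<^sup>2"
    proof -
      have "u \<le> 1 + u\<^sup>2" for u :: real
        using zero_le_power2[of "u - 1/2"] by (simp add: power2_eq_square algebra_simps)
      thus ?thesis .
    qed
    also have "\<dots> \<le> real n + 64 * C ^ 4 * real n" using aD a n1 by simp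
    also have "\<dots> = (1 + 64 * C ^ 4) * real n" by (simp add: algebra_simps)
    also have "\<dots> \<le> ?G"
      using AC mult_mono[of 1 "A ^ 4" 1 "C ^ 4"] mult_right_mono[of 1 "A ^ 4" "C ^ 4"] by (intro G) auto
    finally have b: "?b \<le> ?G" .
    define f where "f = cell_mass X p (\<pi> i)"
    obtain K R where KR: "K \<subseteq> N i" "R \<subseteq> N i" "?v = image_mset f (mset_set K)"
      "\<And>x y. x \<in> R \<Longrightarrow> y \<in> K \<Longrightarrow> f x \<le> f y" "K \<noteq> {} \<Longrightarrow> 2 powi (- i) * \<epsilon> \<le> sum f R"
      using trunc_split[OF net_finite[OF nets], of "2 powi (- i) * \<epsilon>" f] unfolding net_vec_def f_def by metis
    define V where "V = (\<Sum>x\<in>K. f x powr (2/3))"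
    have V0: "0 \<le> V" by (simp add: V_def sum_nonneg)
    have norm: "norm23 ?v = V powr (3/2)" by (simp add: KR norm23_image_mset V_def)
    have "?a * norm23 ?v \<le> ?G"
    proof (cases "2 * A\<^sup>2 \<le> V")
      case False
      have "V powr (3/2) \<le> (2 * A\<^sup>2) powr (3/2)" using False V0 by (intro powr_mono2) auto
      also have "\<dots> \<le> (2 * A\<^sup>2) powr 2"
      proof (intro powr_mono)
        show "1 \<le> 2 * A\<^sup>2" using one_le_power[OF A, of 2] by linarith
      qed simp
      also have "\<dots> = 4 * A ^ 4" using A by (simp add: power_mult_distrib)
      finally have "?a * norm23 ?v \<le> (64 * C ^ 4 * real n) * (4 * A ^ 4)"
        unfolding norm by (intro mult_mono[OF aD]) (use C_pow in auto)
      thus ?thesis by (simp add: mult_ac)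
    next
      case True
      hence "V \<noteq> 0" using A by auto
      hence K: "K \<noteq> {}" by (auto simp: V_def)
      have "V ^ 3 \<le> 128 * A ^ 5 * (\<epsilon> / \<eta>) ^ 4 * (real n)\<^sup>2"
        unfolding A_def V_def f_def
      proof (rule tester_ge_truncated_norm[OF nets \<epsilon> T m KR(1) K KR(2)])
        show "\<epsilon> / \<eta> \<le> sum (cell_mass X p (\<pi> i)) R"
          using KR(5)[OF K] by (simp add: f_def \<eta>_def power_int_minus field_simps)
      qed (use KR(4) True in \<open>auto simp: f_def A_def V_def\<close>)
      \<comment> \<open>The coefficient is enlarged to the square of \<open>12 * A ^ 3\<close>, so
        that a root can be taken.\<close>
      also have "\<dots> \<le> 144 * A ^ 6 * (\<epsilon> / \<eta>) ^ 4 * (real n)\<^sup>2"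
        using A power_increasing[of 5 6 A] by (intro mult_right_mono mult_mono) auto
      also have "\<dots> = (12 * A ^ 3 * (\<epsilon> / \<eta>)\<^sup>2 * real n)\<^sup>2"
        by (simp add: power_mult_distrib flip: power_mult)
      also have "V ^ 3 = (V powr (3/2))\<^sup>2"
        using V0 by (cases "V = 0") (simp_all add: powr_powr flip: powr_numeral)
      finally have "V powr (3/2) \<le> 12 * A ^ 3 * (\<epsilon> / \<eta>)\<^sup>2 * real n"
        by (rule power2_le_imp_le) (use A in auto)
      hence "?a * norm23 ?v \<le> (\<eta> / \<epsilon>)\<^sup>2 * (12 * A ^ 3 * (\<epsilon> / \<eta>)\<^sup>2 * real n)"
        unfolding norm a by (intro mult_left_mono) auto
      also have "\<dots> = 12 * A ^ 3 * real n" using \<eta> \<epsilon> by (simp add: power_divide)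
      also have "\<dots> \<le> ?G"
      proof (intro G)
        have "12 * A ^ 3 \<le> 256 * A ^ 4 * 1" using A AC(1) power_increasing[of 3 4 A] by linarith
        also have "\<dots> \<le> 256 * A ^ 4 * C ^ 4" using AC by (intro mult_left_mono) auto
        finally show "12 * A ^ 3 \<le> 256 * A ^ 4 * C ^ 4" .
      qed
      finally show ?thesis .
    qed
    thus ?thesis using b by simp
  qed
  thus ?thesis unfolding lower_rate_def using finite_scales A C_pow
    by (intro Max.boundedI) (auto intro!: mult_nonneg_nonneg)
qed

end

section \<open>Testing identity in total variation\<close>

lemma expect_replicate_split:
  assumes q: "finite (set_pmf q)"
  shows "expect (replicate_pmf (m + n) q) (\<lambda>zs. F (take m zs) (drop m zs))
       = expect (replicate_pmf m q) (\<lambda>xs. expect (replicate_pmf n q) (F xs))"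
proof -
  have "expect (replicate_pmf (m + n) q) (\<lambda>zs. F (take m zs) (drop m zs))
      = expect (replicate_pmf m q) (\<lambda>xs. expect (replicate_pmf n q)
          (\<lambda>ys. F (take m (xs @ ys)) (drop m (xs @ ys))))"
    by (rule expect_replicate_add[OF q])
  also have "\<dots> = expect (replicate_pmf m q) (\<lambda>xs. expect (replicate_pmf n q) (F xs))"
    by (intro integral_cong_AE) (auto simp: AE_measure_pmf_iff set_replicate_pmf)
  finally show ?thesis .
qed

lemma replicate_pmf_map: "replicate_pmf n (map_pmf g q) = map_pmf (map g) (replicate_pmf n q)"
  by (induction n) (simp_all add: map_bind_pmf bind_map_pmf map_pmf_def[of "(#) _"] bind_assoc_pmf bind_return_pmf)

definition excess :: "'a pmf \<Rightarrow> 'a list \<Rightarrow> 'a \<Rightarrow> real" where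
  "excess P xs x = (\<Sum>s\<leftarrow>xs. indicator {x} s - pmf P x)"

text \<open>
  Multiplying the deviations in two independent halves of the sample, instead of squaring one
  deviation, makes the statistic unbiased without Poissonization.
\<close>

definition collision_stat :: "('a \<Rightarrow> real) \<Rightarrow> 'a set \<Rightarrow> 'a pmf \<Rightarrow> 'a list \<Rightarrow> 'a list \<Rightarrow> real" where
  "collision_stat w A P xs ys = (\<Sum>x\<in>A. w x * excess P xs x * excess P ys x)"

lemma expect_indicator_combination:
  fixes a :: "'a \<Rightarrow> real"
  assumes Q: "finite (set_pmf Q)" and A: "finite A"
  shows "expect Q (\<lambda>t. \<Sum>x\<in>A. a x * (indicator {x} t - pmf P x)) = (\<Sum>x\<in>A. a x * (pmf Q x - pmf P x))"
  by (simp add: expect_sum Q integrable_measure_pmf_finite measure_pmf_single)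

text \<open>The constants \<open>pmf P x\<close> cancel in the variance, and distinct indicators
  have product zero, so the second moment of the remaining sum is diagonal.\<close>

lemma variance_indicator_combination:
  fixes a :: "'a \<Rightarrow> real" and P :: "'a pmf"
  assumes Q: "finite (set_pmf Q)" and A: "finite A"
  defines "f \<equiv> \<lambda>t. \<Sum>x\<in>A. a x * (indicator {x} t - pmf P x)"
  shows "expect Q (\<lambda>t. (f t)\<^sup>2) - (expect Q f)\<^sup>2 \<le> (\<Sum>x\<in>A. (a x)\<^sup>2 * pmf Q x)"
proof -
  have int: "integrable Q g" for g :: "'a \<Rightarrow> real" by (simp add: integrable_measure_pmf_finite Q)
  define k where "k = (\<lambda>t. \<Sum>x\<in>A. a x * indicator {x} t)"
  define c where "c = (\<Sum>x\<in>A. a x * pmf P x)"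
  have f: "f t = k t - c" for t
    by (simp add: f_def k_def c_def algebra_simps sum_subtractf)
  have "f = (\<lambda>t. k t - c)" by (rule ext) (rule f)
  hence "expect Q (\<lambda>t. (f t)\<^sup>2) - (expect Q f)\<^sup>2 = expect Q (\<lambda>t. (k t)\<^sup>2) - (expect Q k)\<^sup>2"
    by (simp add: power2_diff int power2_eq_square algebra_simps)
  also have "\<dots> \<le> expect Q (\<lambda>t. (k t)\<^sup>2)" by simp
  also have "(\<lambda>t. (k t)\<^sup>2) = (\<lambda>t. \<Sum>x\<in>A. (a x)\<^sup>2 * indicator {x} t)"
  proof
    fix t
    have "k t = (if t \<in> A then a t else 0)" "(\<Sum>x\<in>A. (a x)\<^sup>2 * indicator {x} t) = (if t \<in> A then (a t)\<^sup>2 else 0)"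
      using A by (simp_all add: k_def indicator_def if_distrib cong: if_cong)
    thus "(k t)\<^sup>2 = (\<Sum>x\<in>A. (a x)\<^sup>2 * indicator {x} t)" by auto
  qed
  also have "expect Q (\<lambda>t. \<Sum>x\<in>A. (a x)\<^sup>2 * indicator {x} t) = (\<Sum>x\<in>A. (a x)\<^sup>2 * pmf Q x)"
    by (simp add: expect_sum Q measure_pmf_single)
  finally show ?thesis .
qed

lemma sum_list_indicator_combination:
  "(\<Sum>s\<leftarrow>xs. \<Sum>x\<in>A. a x * (indicator {x} s - pmf P x)) = (\<Sum>x\<in>A. a x * excess P xs x)"
  unfolding excess_def by (induction xs) (simp_all add: sum.distrib distrib_left)

text \<open>For a fixed first half \<open>xs\<close> the statistic is an i.i.d. sum over
  \<open>ys\<close>, and its conditional mean is \<open>m\<close> times an i.i.d. sum of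
  \<open>h\<close> over \<open>xs\<close>; the second-moment formula is applied in both stages. Each
  stage contributes one of the two terms of order \<open>m ^ 3\<close>.\<close>

lemma collision_stat_moments:
  fixes P Q :: "'a pmf" and m :: nat and w :: "'a \<Rightarrow> real"
  assumes Q: "finite (set_pmf Q)" and A: "finite A"
  defines "\<Delta> \<equiv> \<lambda>x. pmf Q x - pmf P x" and "R \<equiv> replicate_pmf m Q"
  defines "T \<equiv> (\<Sum>x\<in>A. w x * (\<Delta> x)\<^sup>2)"
  shows "expect R (\<lambda>xs. expect R (\<lambda>ys. collision_stat w A P xs ys)) = (real m)\<^sup>2 * T"
    and "expect R (\<lambda>xs. expect R (\<lambda>ys. (collision_stat w A P xs ys)\<^sup>2)) - ((real m)\<^sup>2 * T)\<^sup>2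
       \<le> (real m)\<^sup>2 * (\<Sum>x\<in>A. (w x * pmf Q x)\<^sup>2) + 2 * real m ^ 3 * (\<Sum>x\<in>A. (w x * \<Delta> x)\<^sup>2 * pmf Q x)"
proof -
  have R: "finite (set_pmf R)" by (simp add: R_def finite_set_replicate_pmf Q)
  define \<kappa> where "\<kappa> = (\<lambda>xs t. \<Sum>x\<in>A. (w x * excess P xs x) * (indicator {x} t - pmf P x))"
  define h where "h = (\<lambda>t. \<Sum>x\<in>A. (w x * \<Delta> x) * (indicator {x} t - pmf P x))"
  have Z: "collision_stat w A P xs ys = (\<Sum>t\<leftarrow>ys. \<kappa> xs t)" for xs ys
    by (simp add: collision_stat_def \<kappa>_def sum_list_indicator_combination)
  have E\<kappa>: "expect Q (\<kappa> xs) = (\<Sum>t\<leftarrow>xs. h t)" for xs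
    unfolding \<kappa>_def h_def expect_indicator_combination[OF Q A] sum_list_indicator_combination
    by (simp add: \<Delta>_def mult_ac)
  have Eh: "expect Q h = T"
    unfolding h_def expect_indicator_combination[OF Q A] T_def by (simp add: \<Delta>_def power2_eq_square mult_ac)
  show "expect R (\<lambda>xs. expect R (\<lambda>ys. collision_stat w A P xs ys)) = (real m)\<^sup>2 * T"
    unfolding Z R_def by (simp add: expect_replicate_sum_list Q E\<kappa> Eh power2_eq_square)
  define V1 where "V1 = (\<Sum>x\<in>A. (w x * \<Delta> x)\<^sup>2 * pmf Q x)"
  define V2 where "V2 = (\<Sum>x\<in>A. (w x * pmf Q x)\<^sup>2)"
  have excess2: "expect R (\<lambda>xs. (excess P xs x)\<^sup>2) \<le> real m * pmf Q x + (real m)\<^sup>2 * (\<Delta> x)\<^sup>2" for x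
  proof -
    define f where "f = (\<lambda>t. indicator {x} t - pmf P x)"
    have f: "f = (\<lambda>t. \<Sum>y\<in>{x}. 1 * (indicator {y} t - pmf P y))" by (simp add: f_def)
    have "expect Q f = \<Delta> x" unfolding f by (subst expect_indicator_combination[OF Q]) (auto simp: \<Delta>_def)
    moreover have "expect Q (\<lambda>t. (f t)\<^sup>2) - (expect Q f)\<^sup>2 \<le> pmf Q x"
      using variance_indicator_combination[OF Q, of "{x}" "\<lambda>_. 1" P] by (simp add: f_def)
    ultimately show ?thesis
      unfolding excess_def f_def[symmetric] R_def expect_replicate_sum_list_square[OF Q]
      by (simp add: mult_left_mono)
  qed
  have "expect R (\<lambda>ys. (collision_stat w A P xs ys)\<^sup>2)
      \<le> (\<Sum>x\<in>A. real m * (w x)\<^sup>2 * pmf Q x * (excess P xs x)\<^sup>2) + (real m)\<^sup>2 * (\<Sum>t\<leftarrow>xs. h t)\<^sup>2" for xs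
  proof -
    have "expect Q (\<lambda>t. (\<kappa> xs t)\<^sup>2) - (expect Q (\<kappa> xs))\<^sup>2 \<le> (\<Sum>x\<in>A. (w x * excess P xs x)\<^sup>2 * pmf Q x)"
      unfolding \<kappa>_def by (rule variance_indicator_combination[OF Q A])
    hence "real m * (expect Q (\<lambda>t. (\<kappa> xs t)\<^sup>2) - (expect Q (\<kappa> xs))\<^sup>2)
        \<le> real m * (\<Sum>x\<in>A. (w x * excess P xs x)\<^sup>2 * pmf Q x)" by (intro mult_left_mono) auto
    thus ?thesis
      unfolding Z R_def expect_replicate_sum_list_square[OF Q] E\<kappa>
      by (simp add: sum_distrib_left power_mult_distrib mult_ac)
  qed
  hence "expect R (\<lambda>xs. expect R (\<lambda>ys. (collision_stat w A P xs ys)\<^sup>2))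
      \<le> expect R (\<lambda>xs. (\<Sum>x\<in>A. real m * (w x)\<^sup>2 * pmf Q x * (excess P xs x)\<^sup>2) + (real m)\<^sup>2 * (\<Sum>t\<leftarrow>xs. h t)\<^sup>2)"
    by (intro expect_mono R)
  also have "\<dots> = (\<Sum>x\<in>A. real m * (w x)\<^sup>2 * pmf Q x * expect R (\<lambda>xs. (excess P xs x)\<^sup>2))
                 + (real m)\<^sup>2 * expect R (\<lambda>xs. (\<Sum>t\<leftarrow>xs. h t)\<^sup>2)"
    by (simp add: expect_add expect_sum R)
  also have "\<dots> \<le> (\<Sum>x\<in>A. real m * (w x)\<^sup>2 * pmf Q x * (real m * pmf Q x + (real m)\<^sup>2 * (\<Delta> x)\<^sup>2))
                 + (real m)\<^sup>2 * (real m * V1 + (real m)\<^sup>2 * T\<^sup>2)"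
  proof (intro add_mono sum_mono mult_left_mono excess2)
    have "expect Q (\<lambda>t. (h t)\<^sup>2) - (expect Q h)\<^sup>2 \<le> V1"
      unfolding h_def V1_def by (rule variance_indicator_combination[OF Q A])
    thus "expect R (\<lambda>xs. (\<Sum>t\<leftarrow>xs. h t)\<^sup>2) \<le> real m * V1 + (real m)\<^sup>2 * T\<^sup>2"
      unfolding R_def expect_replicate_sum_list_square[OF Q] by (simp add: Eh mult_left_mono)
  qed auto
  also have "(\<Sum>x\<in>A. real m * (w x)\<^sup>2 * pmf Q x * (real m * pmf Q x + (real m)\<^sup>2 * (\<Delta> x)\<^sup>2))
           = (real m)\<^sup>2 * V2 + real m ^ 3 * V1"
    by (simp add: V1_def V2_def sum_distrib_left sum.distrib algebra_simps power2_eq_square power3_eq_cube)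
  finally show "expect R (\<lambda>xs. expect R (\<lambda>ys. (collision_stat w A P xs ys)\<^sup>2)) - ((real m)\<^sup>2 * T)\<^sup>2
       \<le> (real m)\<^sup>2 * V2 + 2 * real m ^ 3 * V1"
    by (simp add: algebra_simps power2_eq_square power3_eq_cube)
qed

text \<open>Stated on the full sample of size \<open>m + m\<close>, of which only the first half is
  read, so that this count and the collision statistic live on one probability space. The variance
  is bounded by the mean, as for any binomial count.\<close>

lemma count_moments:
  fixes Q :: "'a pmf" and m :: nat and E :: "'a set"
  assumes Q: "finite (set_pmf Q)"
  defines "f \<equiv> \<lambda>zs. \<Sum>s\<leftarrow>take m zs. indicator E s :: real" and "c \<equiv> real m * measure_pmf.prob Q E"
  shows "expect (replicate_pmf (m + m) Q) f = c"
    and "expect (replicate_pmf (m + m) Q) (\<lambda>zs. (f zs)\<^sup>2) - c\<^sup>2 \<le> c"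
proof -
  show "expect (replicate_pmf (m + m) Q) f = c"
    using expect_replicate_split[OF Q, of m m "\<lambda>xs ys. \<Sum>s\<leftarrow>xs. indicator E s"]
    by (simp add: f_def c_def expect_replicate_sum_list Q)
  have "expect (replicate_pmf (m + m) Q) (\<lambda>zs. (f zs)\<^sup>2)
      = expect (replicate_pmf m Q) (\<lambda>xs. (\<Sum>s\<leftarrow>xs. indicator E s)\<^sup>2)"
    using expect_replicate_split[OF Q, of m m "\<lambda>xs ys. (\<Sum>s\<leftarrow>xs. indicator E s)\<^sup>2"]
    by (simp add: f_def)
  also have "\<dots> = real m * (measure_pmf.prob Q E - (measure_pmf.prob Q E)\<^sup>2) + c\<^sup>2"
  proof -
    have "(indicator E x :: real)\<^sup>2 = indicator E x" for x by (simp add: indicator_def)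
    thus ?thesis by (simp add: expect_replicate_sum_list_square[OF Q] c_def power_mult_distrib)
  qed
  also have "\<dots> \<le> c + c\<^sup>2" unfolding c_def by (intro add_right_mono mult_left_mono) auto
  finally show "expect (replicate_pmf (m + m) Q) (\<lambda>zs. (f zs)\<^sup>2) - c\<^sup>2 \<le> c" by simp
qed

text \<open>The \<open>2/3\<close>-norm of the vector of probabilities without the outer power:
  \<open>norm_sum N P powr (3/2)\<close> is the norm.\<close>

definition norm_sum :: "'a set \<Rightarrow> 'a pmf \<Rightarrow> real" where
  "norm_sum N P = (\<Sum>x\<in>N. pmf P x powr (2/3))"

text \<open>
  The cut-off is chosen such that the light points have total mass at most \<open>\<eta> / 8\<close>, while the
  weights of the heavy points are at most the square of \<open>8 * norm_sum N P / \<eta>\<close>.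
\<close>

definition heavy :: "'a set \<Rightarrow> 'a pmf \<Rightarrow> real \<Rightarrow> 'a set" where
  "heavy N P \<eta> = {x\<in>N. (\<eta> / (8 * norm_sum N P)) ^ 3 \<le> pmf P x}"

text \<open>The weights \<open>pmf P x powr (-(2/3))\<close> are those of instance-optimal identity
  testing. If the heavy part of the sample law is far, the mean of the statistic is at least twice
  its threshold. The light mass is at most \<open>\<eta> / 8\<close> under \<open>P\<close>, but at
  least \<open>3 * \<eta> / 8\<close> if the light part is far; the count is cut off
  halfway.\<close>

definition identity_test :: "'a set \<Rightarrow> 'a pmf \<Rightarrow> real \<Rightarrow> nat \<Rightarrow> 'a list \<Rightarrow> bool" where
  "identity_test N P \<eta> m zs \<longleftrightarrow>
     collision_stat (\<lambda>x. pmf P x powr (-(2/3))) (heavy N P \<eta>) P (take m zs) (drop m zs)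
       < (real m)\<^sup>2 * (\<eta>\<^sup>2 / (8 * norm_sum N P)) \<and>
     (\<Sum>s\<leftarrow>take m zs. indicator (N - heavy N P \<eta>) s) < real m * (\<eta> / 4)"

text \<open>\<open>L\<close> sets the error allowed under \<open>P\<close>, namely
  \<open>1 / (3 * L)\<close>, so that many tests can be run together; \<open>z\<close> is the square
  root of the weight of a heavy point.\<close>

context
  fixes N :: "'a set" and P :: "'a pmf" and \<eta> S L :: real and m :: nat and A :: "'a set"
    and z :: "'a \<Rightarrow> real"
  assumes N: "finite N" and P: "set_pmf P \<subseteq> N" and \<eta>: "0 < \<eta>" "\<eta> \<le> 1"
  defines "S \<equiv> norm_sum N P" and "A \<equiv> heavy N P \<eta>" and "z \<equiv> \<lambda>x. pmf P x powr (-(1/3))"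
  assumes L: "1 \<le> L" and m: "1000 * L * S powr (3/2) \<le> real m * \<eta>\<^sup>2"
begin

lemma sum_pmf_P: "(\<Sum>x\<in>N. pmf P x) = 1"
  using sum_pmf_eq_1[OF N P] .

lemma S_ge_1: "1 \<le> S"
proof -
  have "(\<Sum>x\<in>N. pmf P x) \<le> S"
    unfolding S_def norm_sum_def
  proof (rule sum_mono)
    fix x
    show "pmf P x \<le> pmf P x powr (2/3)"
      using powr_mono'[of "2/3" 1 "pmf P x"] by (cases "pmf P x = 0") (simp_all add: pmf_le_1)
  qed
  thus ?thesis by (simp add: sum_pmf_P)
qed

lemma S_powr: "S powr (3/2) = S * sqrt S" "S \<le> S powr (3/2)" "1 \<le> S powr (3/2)" "(S powr (3/2))\<^sup>2 = S ^ 3"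
proof -
  have "S powr (1 + 1/2) = S * sqrt S" using S_ge_1 by (subst powr_add) (simp add: powr_half_sqrt)
  thus *: "S powr (3/2) = S * sqrt S" by simp
  have "1 \<le> sqrt S" using S_ge_1 by simp
  hence "S * 1 \<le> S * sqrt S" using S_ge_1 by (intro mult_left_mono) auto
  thus "S \<le> S powr (3/2)" by (simp add: *)
  thus "1 \<le> S powr (3/2)" using S_ge_1 by linarith
  show "(S powr (3/2))\<^sup>2 = S ^ 3"
    unfolding * using S_ge_1 by (simp add: power_mult_distrib power2_eq_square power3_eq_cube)
qed

lemma m_ge: "1000 * L \<le> real m * \<eta>\<^sup>2" "1000 * L \<le> real m * \<eta>" "0 < real m"
proof -
  have "1000 * L * 1 \<le> 1000 * L * S powr (3/2)" using L S_powr by (intro mult_left_mono) auto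
  thus *: "1000 * L \<le> real m * \<eta>\<^sup>2" using m by linarith
  have "\<eta>\<^sup>2 \<le> \<eta>" using \<eta> by (simp add: power2_eq_square mult_le_cancel_left1)
  hence "real m * \<eta>\<^sup>2 \<le> real m * \<eta>" by (intro mult_left_mono) auto
  thus "1000 * L \<le> real m * \<eta>" using * by linarith
  show "0 < real m" using * L by (cases "m = 0") auto
qed

lemma A_props: "A \<subseteq> N" "finite A"
  using N by (auto simp: A_def heavy_def)

text \<open>The cut-off is what bounds \<open>z\<close>, and with it the influence that a single
  heavy point can have on the variance.\<close>

lemma heavy_props:
  assumes x: "x \<in> A"
  shows "0 < pmf P x" "1 \<le> z x" "z x \<le> 8 * S / \<eta>" "pmf P x powr (-(2/3)) = (z x)\<^sup>2"
    "(z x)\<^sup>2 * pmf P x = pmf P x powr (1/3)" "(z x)\<^sup>2 * pmf P x \<le> 1" "z x * pmf P x powr (1/3) = 1"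
proof -
  have \<theta>: "(\<eta> / (8 * S)) ^ 3 \<le> pmf P x" using x by (simp add: A_def heavy_def S_def)
  have S: "0 < S" using S_ge_1 by linarith
  have \<theta>0: "0 < \<eta> / (8 * S)" using \<eta> S by simp
  thus p: "0 < pmf P x" using \<theta> by (meson less_le_trans zero_less_power)
  have "1 powr (-(1/3)) \<le> z x" unfolding z_def using p by (intro powr_mono2') (auto simp: pmf_le_1)
  thus "1 \<le> z x" by simp
  have "z x \<le> ((\<eta> / (8 * S)) ^ 3) powr (-(1/3))"
    unfolding z_def using \<theta> \<theta>0 by (intro powr_mono2') auto
  also have "\<dots> = (\<eta> / (8 * S)) powr (-1)" using \<theta>0 by (simp add: powr_powr flip: powr_numeral)
  also have "\<dots> = inverse (\<eta> / (8 * S))"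
    unfolding powr_minus using \<theta>0 by (simp only: powr_one less_imp_le)
  also have "\<dots> = 8 * S / \<eta>" by simp
  finally show "z x \<le> 8 * S / \<eta>" .
  show w: "pmf P x powr (-(2/3)) = (z x)\<^sup>2" by (simp add: z_def power2_eq_square flip: powr_add)
  have "pmf P x powr (1/3) = pmf P x powr (-(2/3) + 1)" by simp
  also have "\<dots> = (z x)\<^sup>2 * pmf P x" unfolding w[symmetric] powr_add using p by simp
  finally show "(z x)\<^sup>2 * pmf P x = pmf P x powr (1/3)" ..
  moreover have "pmf P x powr (1/3) \<le> 1 powr (1/3)" using p by (intro powr_mono2) (auto simp: pmf_le_1)
  ultimately show "(z x)\<^sup>2 * pmf P x \<le> 1" by simp
  show "z x * pmf P x powr (1/3) = 1" using p by (simp add: z_def flip: powr_add)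
qed

lemma sum_heavy_le: "(\<Sum>x\<in>A. (pmf P x powr (1/3))\<^sup>2) \<le> S"
proof -
  have "(\<Sum>x\<in>A. (pmf P x powr (1/3))\<^sup>2) = (\<Sum>x\<in>A. pmf P x powr (2/3))"
    by (simp add: power2_eq_square flip: powr_add)
  also have "\<dots> \<le> S" unfolding S_def norm_sum_def using A_props N by (intro sum_mono2) auto
  finally show ?thesis .
qed

text \<open>Below the cut-off \<open>pmf P x powr (1/3)\<close> is at most
  \<open>\<eta> / (8 * S)\<close>, and the complementary powers \<open>2/3\<close> sum to at most
  \<open>S\<close>.\<close>

lemma light_mass: "(\<Sum>x\<in>N - A. pmf P x) \<le> \<eta> / 8"
proof -
  have S: "0 < S" using S_ge_1 by linarith
  have "(\<Sum>x\<in>N - A. pmf P x) \<le> (\<Sum>x\<in>N - A. \<eta> / (8 * S) * pmf P x powr (2/3))"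
  proof (rule sum_mono)
    fix x assume "x \<in> N - A"
    hence "pmf P x \<le> (\<eta> / (8 * S)) ^ 3" by (auto simp: A_def heavy_def S_def)
    hence "pmf P x powr (1/3) \<le> ((\<eta> / (8 * S)) ^ 3) powr (1/3)" by (intro powr_mono2) auto
    also have "\<dots> = \<eta> / (8 * S)" using \<eta> S by (simp add: powr_powr flip: powr_numeral)
    finally have "pmf P x powr (1/3) * pmf P x powr (2/3) \<le> \<eta> / (8 * S) * pmf P x powr (2/3)"
      by (intro mult_right_mono) auto
    thus "pmf P x \<le> \<eta> / (8 * S) * pmf P x powr (2/3)" by (simp flip: powr_add)
  qed
  also have "\<dots> = \<eta> / (8 * S) * (\<Sum>x\<in>N - A. pmf P x powr (2/3))" by (simp add: sum_distrib_left)
  also have "\<dots> \<le> \<eta> / (8 * S) * S"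
    unfolding S_def[unfolded norm_sum_def] using N \<eta>
    by (intro mult_left_mono sum_mono2) (auto intro!: divide_nonneg_nonneg sum_nonneg)
  also have "\<dots> = \<eta> / 8" using S by simp
  finally show ?thesis .
qed

lemma stat_moments:
  fixes Q :: "'a pmf"
  assumes Q: "finite (set_pmf Q)"
  defines "f \<equiv> \<lambda>zs. collision_stat (\<lambda>x. pmf P x powr (-(2/3))) A P (take m zs) (drop m zs)"
  defines "c \<equiv> (real m)\<^sup>2 * (\<Sum>x\<in>A. (z x * (pmf Q x - pmf P x))\<^sup>2)"
  shows "expect (replicate_pmf (m + m) Q) f = c"
    and "expect (replicate_pmf (m + m) Q) (\<lambda>zs. (f zs)\<^sup>2) - c\<^sup>2
       \<le> (real m)\<^sup>2 * (\<Sum>x\<in>A. ((z x)\<^sup>2 * pmf Q x)\<^sup>2)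
         + 2 * real m ^ 3 * (\<Sum>x\<in>A. ((z x)\<^sup>2 * (pmf Q x - pmf P x))\<^sup>2 * pmf Q x)"
proof -
  note moments = collision_stat_moments[OF Q A_props(2), of m "\<lambda>x. pmf P x powr (-(2/3))" P]
  have c: "c = (real m)\<^sup>2 * (\<Sum>x\<in>A. pmf P x powr (-(2/3)) * (pmf Q x - pmf P x)\<^sup>2)"
    by (simp add: c_def heavy_props(4) power_mult_distrib cong: sum.cong)
  show "expect (replicate_pmf (m + m) Q) f = c"
    unfolding f_def c expect_replicate_split[OF Q, of m m "collision_stat _ _ _"] by (rule moments(1))
  show "expect (replicate_pmf (m + m) Q) (\<lambda>zs. (f zs)\<^sup>2) - c\<^sup>2
       \<le> (real m)\<^sup>2 * (\<Sum>x\<in>A. ((z x)\<^sup>2 * pmf Q x)\<^sup>2)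
         + 2 * real m ^ 3 * (\<Sum>x\<in>A. ((z x)\<^sup>2 * (pmf Q x - pmf P x))\<^sup>2 * pmf Q x)"
    using moments(2)
    unfolding f_def c expect_replicate_split[OF Q, of m m "\<lambda>xs ys. (collision_stat _ _ _ xs ys)\<^sup>2"]
    by (simp add: heavy_props(4) cong: sum.cong)
qed

text \<open>Under \<open>P\<close> the drift vanishes, so the statistic has mean 0 and variance at
  most \<open>m ^ 2 * S\<close>. Chebyshev bounds the failure of each of the two conditions by
  \<open>1 / (6 * L)\<close>.\<close>

lemma identity_test_complete:
  "measure_pmf.prob (replicate_pmf (m + m) P) {zs. \<not> identity_test N P \<eta> m zs} \<le> 1 / (3 * L)"
proof -
  have fP: "finite (set_pmf P)" using P N finite_subset by blast
  let ?R = "replicate_pmf (m + m) P"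
  have fR: "finite (set_pmf ?R)" by (rule finite_set_replicate_pmf[OF fP])
  define f where "f = (\<lambda>zs. collision_stat (\<lambda>x. pmf P x powr (-(2/3))) A P (take m zs) (drop m zs))"
  define g :: "'a list \<Rightarrow> real" where "g = (\<lambda>zs. \<Sum>s\<leftarrow>take m zs. indicator (N - A) s)"
  define \<tau> where "\<tau> = (real m)\<^sup>2 * (\<eta>\<^sup>2 / (8 * S))"
  have S: "0 < S" using S_ge_1 by linarith
  have \<tau>: "0 < \<tau>" using m_ge(3) \<eta> S by (simp add: \<tau>_def)
  have "measure_pmf.prob ?R {zs. \<tau> \<le> \<bar>f zs - 0\<bar>} \<le> (real m)\<^sup>2 * S / \<tau>\<^sup>2"
  proof (rule prob_deviation_le[OF fR \<tau>])
    show "expect ?R f = 0" using stat_moments(1)[OF fP] by (simp add: f_def)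
    have "(\<Sum>x\<in>A. ((z x)\<^sup>2 * pmf P x)\<^sup>2) \<le> S"
      using sum_heavy_le by (simp add: heavy_props(5) cong: sum.cong)
    hence "(real m)\<^sup>2 * (\<Sum>x\<in>A. ((z x)\<^sup>2 * pmf P x)\<^sup>2) \<le> (real m)\<^sup>2 * S" by (intro mult_left_mono) auto
    thus "expect ?R (\<lambda>zs. (f zs)\<^sup>2) - 0\<^sup>2 \<le> (real m)\<^sup>2 * S"
      using stat_moments(2)[OF fP] by (simp add: f_def)
  qed
  also have "\<dots> \<le> 1 / (6 * L)"
  proof -
    have "384 * L * S ^ 3 \<le> (1000 * L * S powr (3/2))\<^sup>2"
    proof -
      have "384 * L \<le> 1000000 * (L * L)" using L mult_right_mono[OF L, of L] by linarith
      hence "384 * L * S ^ 3 \<le> 1000000 * (L * L) * S ^ 3" using S by (intro mult_right_mono) auto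
      also have "\<dots> = (1000 * L)\<^sup>2 * (S powr (3/2))\<^sup>2"
        unfolding S_powr(4) by (simp add: power2_eq_square)
      also have "\<dots> = (1000 * L * S powr (3/2))\<^sup>2" by (rule power_mult_distrib[symmetric])
      finally show ?thesis .
    qed
    also have "\<dots> \<le> (real m * \<eta>\<^sup>2)\<^sup>2" using m L by (intro power_mono) auto
    finally have "6 * L * (64 * S ^ 3) \<le> (real m)\<^sup>2 * \<eta> ^ 4" by (simp add: power_mult_distrib)
    moreover have "(real m)\<^sup>2 * S / \<tau>\<^sup>2 = 64 * S ^ 3 / ((real m)\<^sup>2 * \<eta> ^ 4)"
      using m_ge(3) S \<eta> by (simp add: \<tau>_def field_simps power2_eq_square power3_eq_cube eval_nat_numeral)
    moreover have "b / Y \<le> 1 / (6 * L)" if "6 * L * b \<le> Y" "0 < Y" for b Y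
      using that L by (simp add: field_simps)
    ultimately show ?thesis using m_ge(3) \<eta> by simp
  qed
  finally have 1: "measure_pmf.prob ?R {zs. \<tau> \<le> \<bar>f zs\<bar>} \<le> 1 / (6 * L)" by simp
  define \<mu> where "\<mu> = real m * measure_pmf.prob P (N - A)"
  have \<mu>: "\<mu> \<le> real m * (\<eta> / 8)"
    unfolding \<mu>_def using light_mass N by (intro mult_left_mono) (auto simp: measure_measure_pmf_finite)
  have m\<eta>: "0 < real m * (\<eta> / 8)" using m_ge(3) \<eta> by simp
  have "measure_pmf.prob ?R {zs. real m * (\<eta> / 8) \<le> \<bar>g zs - \<mu>\<bar>} \<le> \<mu> / (real m * (\<eta> / 8))\<^sup>2"
    using count_moments[OF fP, of m "N - A"]
    by (intro prob_deviation_le[OF fR m\<eta>]) (simp_all add: g_def \<mu>_def)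
  also have "\<dots> \<le> (real m * (\<eta> / 8)) / (real m * (\<eta> / 8))\<^sup>2" using \<mu> by (intro divide_right_mono) auto
  also have "\<dots> = 8 / (real m * \<eta>)" using m_ge(3) \<eta> by (simp add: power2_eq_square)
  also have "\<dots> \<le> 1 / (6 * L)" using m_ge(2,3) \<eta> L by (simp add: field_simps)
  finally have 2: "measure_pmf.prob ?R {zs. real m * (\<eta> / 8) \<le> \<bar>g zs - \<mu>\<bar>} \<le> 1 / (6 * L)" .
  have "{zs. \<not> identity_test N P \<eta> m zs} \<subseteq> {zs. \<tau> \<le> \<bar>f zs\<bar>} \<union> {zs. real m * (\<eta> / 8) \<le> \<bar>g zs - \<mu>\<bar>}"
  proof (rule subsetI)
    fix zs assume "zs \<in> {zs. \<not> identity_test N P \<eta> m zs}"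
    hence "\<tau> \<le> f zs \<or> real m * (\<eta> / 4) \<le> g zs"
      unfolding identity_test_def f_def g_def \<tau>_def S_def A_def by (simp add: not_less)
    moreover have "real m * (\<eta> / 4) = real m * (\<eta> / 8) + real m * (\<eta> / 8)" by simp
    ultimately have "\<tau> \<le> \<bar>f zs\<bar> \<or> real m * (\<eta> / 8) \<le> \<bar>g zs - \<mu>\<bar>" using \<mu> by linarith
    thus "zs \<in> {zs. \<tau> \<le> \<bar>f zs\<bar>} \<union> {zs. real m * (\<eta> / 8) \<le> \<bar>g zs - \<mu>\<bar>}" by blast
  qed
  hence "measure_pmf.prob ?R {zs. \<not> identity_test N P \<eta> m zs}
      \<le> measure_pmf.prob ?R ({zs. \<tau> \<le> \<bar>f zs\<bar>} \<union> {zs. real m * (\<eta> / 8) \<le> \<bar>g zs - \<mu>\<bar>})"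
    by (intro measure_pmf.finite_measure_mono) auto
  also have "\<dots> \<le> measure_pmf.prob ?R {zs. \<tau> \<le> \<bar>f zs\<bar>}
      + measure_pmf.prob ?R {zs. real m * (\<eta> / 8) \<le> \<bar>g zs - \<mu>\<bar>}"
    by (rule measure_subadditive) auto
  also have "\<dots> \<le> 1 / (6 * L) + 1 / (6 * L)" using 1 2 by (rule add_mono)
  also have "\<dots> = 1 / (3 * L)" by simp
  finally show ?thesis .
qed

text \<open>Half of the distance lies on the light or on the heavy points. In the light case
  \<open>Q\<close> must itself put much mass there, as \<open>P\<close> has too little. In the heavy
  case Cauchy-Schwarz gives \<open>\<eta> ^ 2 / 4 \<le> T * S\<close>, so the mean
  \<open>m ^ 2 * T\<close> is at least twice the threshold and Chebyshev applies.\<close>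

lemma identity_test_sound:
  assumes Q: "set_pmf Q \<subseteq> N" and far: "\<eta> \<le> (\<Sum>x\<in>N. \<bar>pmf P x - pmf Q x\<bar>)"
  shows "measure_pmf.prob (replicate_pmf (m + m) Q) {zs. identity_test N P \<eta> m zs} \<le> 1 / 3"
proof -
  have fQ: "finite (set_pmf Q)" using Q N finite_subset by blast
  let ?R = "replicate_pmf (m + m) Q"
  have fR: "finite (set_pmf ?R)" by (rule finite_set_replicate_pmf[OF fQ])
  have S: "0 < S" using S_ge_1 by linarith
  have m0: "0 < real m" by (rule m_ge(3))
  have split: "(\<Sum>x\<in>N. \<bar>pmf P x - pmf Q x\<bar>) = (\<Sum>x\<in>A. \<bar>pmf P x - pmf Q x\<bar>) + (\<Sum>x\<in>N - A. \<bar>pmf P x - pmf Q x\<bar>)"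
    using sum.subset_diff[OF A_props(1) N, of "\<lambda>x. \<bar>pmf P x - pmf Q x\<bar>"] by simp
  show ?thesis
  proof (cases "\<eta> / 2 \<le> (\<Sum>x\<in>N - A. \<bar>pmf P x - pmf Q x\<bar>)")
    case True
    define g :: "'a list \<Rightarrow> real" where "g = (\<lambda>zs. \<Sum>s\<leftarrow>take m zs. indicator (N - A) s)"
    define u where "u = measure_pmf.prob Q (N - A)"
    have "(\<Sum>x\<in>N - A. \<bar>pmf P x - pmf Q x\<bar>) \<le> (\<Sum>x\<in>N - A. pmf P x + pmf Q x)"
      by (intro sum_mono) (smt (verit) pmf_nonneg)
    also have "\<dots> = (\<Sum>x\<in>N - A. pmf P x) + u"
      using N by (simp add: sum.distrib u_def measure_measure_pmf_finite)
    finally have u: "3 * \<eta> / 8 \<le> u" using True light_mass by linarith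
    have u0: "0 < u" using u \<eta> by linarith
    have a: "0 < real m * u / 3" using m0 u0 by simp
    have "measure_pmf.prob ?R {zs. identity_test N P \<eta> m zs}
        \<le> measure_pmf.prob ?R {zs. real m * u / 3 \<le> \<bar>g zs - real m * u\<bar>}"
    proof (intro measure_pmf.finite_measure_mono subsetI CollectI)
      fix zs assume "zs \<in> {zs. identity_test N P \<eta> m zs}"
      hence "g zs < real m * (\<eta> / 4)" by (simp add: identity_test_def g_def A_def)
      also have "\<dots> \<le> real m * (2 / 3 * u)" using u by (intro mult_left_mono) auto
      also have "\<dots> = 2 / 3 * (real m * u)" by simp
      finally show "real m * u / 3 \<le> \<bar>g zs - real m * u\<bar>" using a by linarith
    qed simp
    also have "\<dots> \<le> (real m * u) / (real m * u / 3)\<^sup>2"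
      using count_moments[OF fQ, of m "N - A"]
      by (intro prob_deviation_le[OF fR a]) (simp_all add: g_def u_def)
    also have "\<dots> = 9 / (real m * u)" using m0 u0 by (simp add: power2_eq_square)
    also have "\<dots> \<le> 1/3"
    proof -
      have "real m * (3 * \<eta> / 8) \<le> real m * u" using u by (intro mult_left_mono) auto
      moreover have "1000 \<le> real m * \<eta>" using m_ge(2) L by linarith
      ultimately have "27 \<le> real m * u" by simp
      thus ?thesis using m0 u0 by (simp add: field_simps)
    qed
    finally show ?thesis .
  next
    case False
    hence half: "\<eta> / 2 \<le> (\<Sum>x\<in>A. \<bar>pmf P x - pmf Q x\<bar>)" using far split by linarith
    define \<Delta> where "\<Delta> = (\<lambda>x. pmf Q x - pmf P x)"
    define T where "T = (\<Sum>x\<in>A. (z x * \<Delta> x)\<^sup>2)"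
    define r where "r = sqrt T"
    define G where "G = 8 * S / \<eta>"
    define M where "M = real m"
    define f where "f = (\<lambda>zs. collision_stat (\<lambda>x. pmf P x powr (-(2/3))) A P (take m zs) (drop m zs))"
    have T0: "0 \<le> T" by (simp add: T_def sum_nonneg)
    have rr: "r * r = T" "0 \<le> r" using T0 by (simp_all add: r_def)
    have G0: "0 < G" using S \<eta> by (simp add: G_def)
    have "(\<eta> / 2)\<^sup>2 \<le> (\<Sum>x\<in>A. \<bar>pmf P x - pmf Q x\<bar>)\<^sup>2" using half \<eta> by (intro power_mono) auto
    also have "(\<Sum>x\<in>A. \<bar>pmf P x - pmf Q x\<bar>) = (\<Sum>x\<in>A. \<bar>z x * \<Delta> x\<bar> * pmf P x powr (1/3))"
    proof (rule sum.cong[OF refl])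
      fix x assume x: "x \<in> A"
      have "\<bar>z x * \<Delta> x\<bar> * pmf P x powr (1/3) = \<bar>\<Delta> x\<bar> * (z x * pmf P x powr (1/3))"
        using heavy_props(2)[OF x] by (simp add: abs_mult)
      thus "\<bar>pmf P x - pmf Q x\<bar> = \<bar>z x * \<Delta> x\<bar> * pmf P x powr (1/3)"
        using heavy_props(7)[OF x] by (simp add: \<Delta>_def)
    qed
    also have "\<dots>\<^sup>2 \<le> (\<Sum>x\<in>A. \<bar>z x * \<Delta> x\<bar>\<^sup>2) * (\<Sum>x\<in>A. (pmf P x powr (1/3))\<^sup>2)"
      by (rule Cauchy_Schwarz_ineq_sum)
    also have "\<dots> \<le> T * S" unfolding T_def using sum_heavy_le by (intro mult_mono) (auto intro: sum_nonneg)
    finally have TS: "\<eta>\<^sup>2 / 4 \<le> T * S" by (simp add: power_divide)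
    hence Tpos: "0 < T" using \<eta> T0 S by (cases "T = 0") auto
    have rS: "\<eta> / 2 \<le> r * sqrt S"
    proof -
      have "sqrt (\<eta>\<^sup>2 / 4) \<le> sqrt (T * S)" using TS by (rule real_sqrt_le_mono)
      thus ?thesis using \<eta> by (simp add: r_def real_sqrt_mult real_sqrt_divide)
    qed
    have m': "1000 * (S * sqrt S) \<le> M * \<eta>\<^sup>2"
    proof -
      have "1000 * 1 * (S * sqrt S) \<le> 1000 * L * (S * sqrt S)" using L S by (intro mult_right_mono) auto
      thus ?thesis using m unfolding S_powr(1) M_def by linarith
    qed
    have sS: "0 < sqrt S" "sqrt S * sqrt S = S" using S by simp_all
    \<comment> \<open>The sample size is now spent on the variance: \<open>i1\<close> serves the
      terms containing \<open>G\<close>, \<open>i3\<close> the term \<open>M ^ 3 * T\<close>, and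
      \<open>i4\<close> the term \<open>M ^ 2 * S\<close> already present under
      \<open>P\<close>.\<close>
    have i1: "62 * G \<le> M * r"
    proof -
      have "500 * S * (\<eta> * sqrt S) \<le> M * (\<eta> / 2) * \<eta> * \<eta>"
        using mult_right_mono[OF m', of "\<eta> / 2"] \<eta> by (simp add: power2_eq_square mult_ac)
      also have "\<dots> \<le> M * (r * sqrt S) * \<eta> * \<eta>"
        using rS \<eta> by (intro mult_right_mono mult_left_mono) (auto simp: M_def)
      finally have "(\<eta> * sqrt S) * (500 * S) \<le> (\<eta> * sqrt S) * (M * r * \<eta>)" by (simp add: mult_ac)
      hence "500 * S \<le> M * r * \<eta>" using \<eta> sS by simp
      hence "62 * (8 * S) \<le> M * r * \<eta>" using S by linarith
      thus ?thesis using \<eta> by (simp add: G_def field_simps)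
    qed
    have i2: "250 * sqrt S \<le> M * T"
    proof -
      have "M * \<eta>\<^sup>2 \<le> M * (4 * (T * S))" using TS by (intro mult_left_mono) (auto simp: M_def)
      hence "S * (1000 * sqrt S) \<le> S * (4 * (M * T))" using m' by (simp add: mult_ac)
      thus ?thesis using S by simp
    qed
    have i3: "250 \<le> M * T" using i2 S_ge_1 real_sqrt_ge_1_iff[of S] by linarith
    have i4: "62500 * S \<le> (M * T)\<^sup>2"
    proof -
      have "(250 * sqrt S)\<^sup>2 \<le> (M * T)\<^sup>2" using i2 sS by (intro power_mono) auto
      thus ?thesis using S by (simp add: power_mult_distrib)
    qed
    have small: "\<bar>z x * \<Delta> x\<bar> \<le> r" if "x \<in> A" for x
    proof -
      have "(z x * \<Delta> x)\<^sup>2 \<le> T" unfolding T_def using that A_props(2) by (intro member_le_sum) auto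
      hence "sqrt ((z x * \<Delta> x)\<^sup>2) \<le> r" unfolding r_def by (rule real_sqrt_le_mono)
      thus ?thesis by simp
    qed
    \<comment> \<open>With \<open>pmf Q x = pmf P x + \<Delta> x\<close>, the part from
      \<open>P\<close> sums to at most \<open>S\<close>; in the other part one factor
      \<open>z x\<close> is replaced by its bound \<open>G\<close>.\<close>
    have V2: "(\<Sum>x\<in>A. ((z x)\<^sup>2 * pmf Q x)\<^sup>2) \<le> 2 * S + 2 * G\<^sup>2 * T"
    proof -
      have "(\<Sum>x\<in>A. ((z x)\<^sup>2 * pmf Q x)\<^sup>2) \<le> (\<Sum>x\<in>A. 2 * (pmf P x powr (1/3))\<^sup>2 + 2 * G\<^sup>2 * (z x * \<Delta> x)\<^sup>2)"
      proof (rule sum_mono)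
        fix x assume x: "x \<in> A"
        have "((z x)\<^sup>2 * pmf Q x)\<^sup>2 = ((z x)\<^sup>2 * pmf P x + z x * (z x * \<Delta> x))\<^sup>2"
          by (simp add: \<Delta>_def power2_eq_square algebra_simps)
        also have "\<dots> \<le> 2 * ((z x)\<^sup>2 * pmf P x)\<^sup>2 + 2 * (z x * (z x * \<Delta> x))\<^sup>2"
          using zero_le_power2[of "(z x)\<^sup>2 * pmf P x - z x * (z x * \<Delta> x)"]
          by (simp add: power2_sum power2_diff)
        also have "(z x * (z x * \<Delta> x))\<^sup>2 \<le> G\<^sup>2 * (z x * \<Delta> x)\<^sup>2"
          unfolding power_mult_distrib[of "z x" "z x * \<Delta> x"] G_def
          using heavy_props(2,3)[OF x] by (intro mult_right_mono power_mono) auto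
        finally show "((z x)\<^sup>2 * pmf Q x)\<^sup>2 \<le> 2 * (pmf P x powr (1/3))\<^sup>2 + 2 * G\<^sup>2 * (z x * \<Delta> x)\<^sup>2"
          unfolding heavy_props(5)[OF x] by simp
      qed
      also have "\<dots> = 2 * (\<Sum>x\<in>A. (pmf P x powr (1/3))\<^sup>2) + 2 * G\<^sup>2 * T"
        by (simp add: T_def sum.distrib sum_distrib_left)
      finally show ?thesis using sum_heavy_le by linarith
    qed
    have V1: "(\<Sum>x\<in>A. ((z x)\<^sup>2 * \<Delta> x)\<^sup>2 * pmf Q x) \<le> T * (1 + G * r)"
    proof -
      have "(\<Sum>x\<in>A. ((z x)\<^sup>2 * \<Delta> x)\<^sup>2 * pmf Q x) \<le> (\<Sum>x\<in>A. (z x * \<Delta> x)\<^sup>2 * (1 + G * r))"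
      proof (rule sum_mono)
        fix x assume x: "x \<in> A"
        have "(z x)\<^sup>2 * pmf Q x = (z x)\<^sup>2 * pmf P x + z x * (z x * \<Delta> x)"
          by (simp add: \<Delta>_def power2_eq_square algebra_simps)
        also have "z x * (z x * \<Delta> x) \<le> G * r"
        proof -
          have "z x * (z x * \<Delta> x) \<le> z x * \<bar>z x * \<Delta> x\<bar>"
            using heavy_props(2)[OF x] by (intro mult_left_mono) auto
          also have "\<dots> \<le> G * r"
            unfolding G_def using heavy_props(2,3)[OF x] small[OF x] by (intro mult_mono) auto
          finally show ?thesis .
        qed
        finally have "(z x)\<^sup>2 * pmf Q x \<le> 1 + G * r" using heavy_props(6)[OF x] by linarith
        hence "(z x * \<Delta> x)\<^sup>2 * ((z x)\<^sup>2 * pmf Q x) \<le> (z x * \<Delta> x)\<^sup>2 * (1 + G * r)"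
          by (intro mult_left_mono) auto
        thus "((z x)\<^sup>2 * \<Delta> x)\<^sup>2 * pmf Q x \<le> (z x * \<Delta> x)\<^sup>2 * (1 + G * r)"
          by (simp add: power2_eq_square mult_ac)
      qed
      thus ?thesis by (simp add: T_def sum_distrib_right)
    qed
    have M0: "0 < M" using m0 by (simp add: M_def)
    define W where "W = (M\<^sup>2 * T)\<^sup>2"
    define v where "v = M\<^sup>2 * (2 * S + 2 * G\<^sup>2 * T) + 2 * M ^ 3 * (T * (1 + G * r))"
    \<comment> \<open>Deviation by half the mean has probability at most \<open>4 * v / W\<close>,
      so 12 gives 1/3. The left side is 24 times the sum of four terms, which are at most
      \<open>W\<close> divided by 62500, 3844, 250 and 62.\<close>
    have vW: "12 * v \<le> W"
    proof -
      have "62500 * (M\<^sup>2 * S) \<le> W"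
        using mult_left_mono[OF i4, of "M\<^sup>2"] by (simp add: W_def power_mult_distrib power2_eq_square mult_ac)
      moreover have "3844 * (M\<^sup>2 * (G\<^sup>2 * T)) \<le> W"
      proof -
        have "(62 * G)\<^sup>2 \<le> (M * r)\<^sup>2" using i1 G0 by (intro power_mono) auto
        hence "3844 * G\<^sup>2 \<le> M\<^sup>2 * T" using rr by (simp add: power2_eq_square mult_ac)
        hence "M\<^sup>2 * T * (3844 * G\<^sup>2) \<le> M\<^sup>2 * T * (M\<^sup>2 * T)" using T0 by (intro mult_left_mono) auto
        thus ?thesis by (simp add: W_def power2_eq_square mult_ac)
      qed
      moreover have "250 * (M ^ 3 * T) \<le> W"
        using mult_left_mono[OF i3, of "M ^ 3 * T"] T0 M0
        by (simp add: W_def power2_eq_square power3_eq_cube mult_ac)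
      moreover have "62 * (M ^ 3 * T * (G * r)) \<le> W"
      proof -
        have "(M ^ 3 * T * r) * (62 * G) \<le> (M ^ 3 * T * r) * (M * r)"
          using i1 T0 M0 rr(2) by (intro mult_left_mono) auto
        also have "\<dots> = W" using rr(1)[symmetric] by (simp add: W_def power2_eq_square power3_eq_cube mult_ac)
        finally show ?thesis by (simp add: mult_ac)
      qed
      moreover have "v = 2 * (M\<^sup>2 * S) + 2 * (M\<^sup>2 * (G\<^sup>2 * T)) + 2 * (M ^ 3 * T) + 2 * (M ^ 3 * T * (G * r))"
        by (simp add: v_def algebra_simps)
      moreover have "0 \<le> W" by (simp add: W_def)
      ultimately show ?thesis by linarith
    qed
    have a: "0 < M\<^sup>2 * T / 2" using M0 Tpos by simp
    have "measure_pmf.prob ?R {zs. identity_test N P \<eta> m zs}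
        \<le> measure_pmf.prob ?R {zs. M\<^sup>2 * T / 2 \<le> \<bar>f zs - M\<^sup>2 * T\<bar>}"
    proof (intro measure_pmf.finite_measure_mono subsetI CollectI)
      fix zs assume "zs \<in> {zs. identity_test N P \<eta> m zs}"
      hence "f zs < M\<^sup>2 * (\<eta>\<^sup>2 / (8 * S))" by (simp add: identity_test_def f_def A_def S_def M_def)
      also have "\<dots> \<le> M\<^sup>2 * (T / 2)"
        using TS S by (intro mult_left_mono) (auto simp: field_simps)
      also have "\<dots> = M\<^sup>2 * T / 2" by simp
      finally show "M\<^sup>2 * T / 2 \<le> \<bar>f zs - M\<^sup>2 * T\<bar>" by linarith
    qed simp
    also have "\<dots> \<le> v / (M\<^sup>2 * T / 2)\<^sup>2"
    proof (rule prob_deviation_le[OF fR a])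
      show "expect ?R f = M\<^sup>2 * T" using stat_moments(1)[OF fQ] by (simp add: f_def M_def T_def \<Delta>_def)
      have "expect ?R (\<lambda>zs. (f zs)\<^sup>2) - (M\<^sup>2 * T)\<^sup>2
          \<le> M\<^sup>2 * (\<Sum>x\<in>A. ((z x)\<^sup>2 * pmf Q x)\<^sup>2) + 2 * M ^ 3 * (\<Sum>x\<in>A. ((z x)\<^sup>2 * \<Delta> x)\<^sup>2 * pmf Q x)"
        using stat_moments(2)[OF fQ] by (simp add: f_def M_def T_def \<Delta>_def)
      also have "\<dots> \<le> v" unfolding v_def using V1 V2 M0 by (intro add_mono mult_left_mono) auto
      finally show "expect ?R (\<lambda>zs. (f zs)\<^sup>2) - (M\<^sup>2 * T)\<^sup>2 \<le> v" .
    qed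
    also have "\<dots> = 4 * v / W" by (simp add: W_def power_divide)
    also have "\<dots> \<le> 1/3" using vW M0 Tpos by (simp add: W_def field_simps)
    finally show ?thesis .
  qed
qed

end

section \<open>Multiscale transport\<close>

text \<open>Every cell of \<open>h\<close> is a union of cells of \<open>g\<close>. This is used for
  the mass already matched, which has zero balance on the fine cells and hence on all coarser
  ones.\<close>

lemma sum_refine_zero:
  fixes w :: "'a \<Rightarrow> real"
  assumes X: "finite X" and ref: "\<And>x y. x \<in> X \<Longrightarrow> y \<in> X \<Longrightarrow> g x = g y \<Longrightarrow> h x = h y"
    and zero: "\<And>c. (\<Sum>x\<in>{x\<in>X. g x = c}. w x) = 0"
  shows "(\<Sum>x\<in>{x\<in>X. h x = c}. w x) = 0"
proof -
  let ?H = "{x\<in>X. h x = c}"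
  have "(\<Sum>x\<in>?H. w x) = (\<Sum>e\<in>g ` ?H. \<Sum>x\<in>{x\<in>?H. g x = e}. w x)"
    using X by (intro sum.group[symmetric]) auto
  also have "\<dots> = (\<Sum>e\<in>g ` ?H. \<Sum>x\<in>{x\<in>X. g x = e}. w x)"
    using ref by (intro sum.cong refl) (auto intro: sum.cong)
  finally show ?thesis by (simp add: zero)
qed

text \<open>Induction downwards from \<open>m\<close>, with \<open>u\<close> and \<open>v\<close>
  general because the unmatched rest is handed to the next scale. That rest has total
  \<open>D k u v / 2\<close> on either side and the same cell differences at all levels from
  \<open>k\<close> on, so the bound for \<open>Suc k\<close> applies to it with the sums
  unchanged.\<close>

lemma multiscale_transport:
  fixes d :: "'a \<Rightarrow> 'a \<Rightarrow> real" and g :: "nat \<Rightarrow> 'a \<Rightarrow> 'c" and r :: "nat \<Rightarrow> real"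
  assumes X: "finite X" and r: "\<And>k. 0 \<le> r k"
    and refine: "\<And>k x y. x \<in> X \<Longrightarrow> y \<in> X \<Longrightarrow> g k x = g k y \<Longrightarrow> g (Suc k) x = g (Suc k) y"
    and diam: "\<And>k x y. x \<in> X \<Longrightarrow> y \<in> X \<Longrightarrow> g k x = g k y \<Longrightarrow> d x y \<le> r k"
    and top: "\<And>x y. x \<in> X \<Longrightarrow> y \<in> X \<Longrightarrow> g m x = g m y"
  defines "D \<equiv> \<lambda>k u v. \<Sum>c\<in>g k ` X. \<bar>\<Sum>x\<in>{x\<in>X. g k x = c}. u x - v x\<bar>"
  assumes "k \<le> m" and u: "\<And>x. x \<in> X \<Longrightarrow> 0 \<le> u x" and v: "\<And>x. x \<in> X \<Longrightarrow> 0 \<le> v x"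
    and eq: "(\<Sum>x\<in>X. u x) = (\<Sum>x\<in>X. v x)"
  shows "\<exists>\<gamma>. (\<forall>x\<in>X. \<forall>y\<in>X. 0 \<le> \<gamma> x y) \<and> (\<forall>x\<in>X. (\<Sum>y\<in>X. \<gamma> x y) = u x) \<and> (\<forall>y\<in>X. (\<Sum>x\<in>X. \<gamma> x y) = v y) \<and>
           (\<Sum>x\<in>X. \<Sum>y\<in>X. \<gamma> x y * d x y) \<le> r k * (\<Sum>x\<in>X. u x) + (\<Sum>j\<in>{k..<m}. r (Suc j) * (D j u v / 2))"
  using \<open>k \<le> m\<close> u v eq
proof (induction k arbitrary: u v rule: inc_induct)
  case base
  define s where "s = (\<Sum>x\<in>X. u x)"
  have s: "s = (\<Sum>x\<in>X. v x)" using base by (simp add: s_def)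
  have zero: "u x = 0 \<and> v x = 0" if "s = 0" "x \<in> X" for x
    using that base X s by (simp add: s_def sum_nonneg_eq_0_iff)
  have s0: "0 \<le> s" unfolding s_def using base by (intro sum_nonneg)
  show ?case
  \<comment> \<open>At the top there is a single cell and the product plan does. If
    \<open>s = 0\<close>, both measures vanish and division by zero yields the right value
    0.\<close>
  proof (intro exI[of _ "\<lambda>x y. u x * v y / s"] conjI ballI)
    fix x y assume "x \<in> X" "y \<in> X"
    thus "0 \<le> u x * v y / s" using base s0 by simp
  next
    fix x assume "x \<in> X"
    thus "(\<Sum>y\<in>X. u x * v y / s) = u x"
      using zero by (cases "s = 0") (simp_all add: s flip: sum_divide_distrib sum_distrib_left)
  next
    fix y assume "y \<in> X"
    thus "(\<Sum>x\<in>X. u x * v y / s) = v y"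
      using zero by (cases "s = 0") (simp_all add: s_def flip: sum_divide_distrib sum_distrib_right)
  next
    have "(\<Sum>x\<in>X. \<Sum>y\<in>X. u x * v y / s * d x y) \<le> (\<Sum>x\<in>X. \<Sum>y\<in>X. u x * v y / s * r m)"
      using base s0 diam[OF _ _ top] by (intro sum_mono mult_left_mono) auto
    also have "\<dots> = (\<Sum>x\<in>X. u x * (r m / s) * (\<Sum>y\<in>X. v y))" by (simp add: sum_distrib_left sum_divide_distrib mult_ac)
    also have "\<dots> = (\<Sum>x\<in>X. u x) * (r m / s) * (\<Sum>y\<in>X. v y)" by (simp only: sum_distrib_right)
    also have "\<dots> = r m * s" unfolding s_def[symmetric] s[symmetric] by simp
    finally show "(\<Sum>x\<in>X. \<Sum>y\<in>X. u x * v y / s * d x y)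
        \<le> r m * (\<Sum>x\<in>X. u x) + (\<Sum>j\<in>{m..<m}. r (Suc j) * (D j u v / 2))" by (simp add: s_def)
  qed
next
  case (step k)
  note u = step.prems(1) and v = step.prems(2) and eq = step.prems(3)
  define cell where "cell = (\<lambda>c. {x\<in>X. g k x = c})"
  define U where "U = (\<lambda>c. \<Sum>x\<in>cell c. u x)"
  define V where "V = (\<lambda>c. \<Sum>x\<in>cell c. v x)"
  define M where "M = (\<lambda>c. max (U c) (V c))"
  \<comment> \<open>A product plan inside each cell, scaled to transport the smaller of the two cell
    masses; \<open>u'\<close> and \<open>v'\<close> are what it leaves over.\<close>
  define \<gamma>0 where "\<gamma>0 = (\<lambda>x y. if g k x = g k y then u x * v y / M (g k x) else 0)"
  define u' where "u' = (\<lambda>x. u x * (1 - V (g k x) / M (g k x)))"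
  define v' where "v' = (\<lambda>y. v y * (1 - U (g k y) / M (g k y)))"
  have UV: "0 \<le> U c" "0 \<le> V c" for c unfolding U_def V_def cell_def using u v by (auto intro!: sum_nonneg)
  have M: "U c \<le> M c" "V c \<le> M c" "0 \<le> M c" for c using UV[of c] by (auto simp: M_def)
  have frac: "U c / M c \<le> 1" "V c / M c \<le> 1" "0 \<le> U c / M c" "0 \<le> V c / M c" for c
    using M[of c] UV[of c] by (auto simp: divide_le_eq_1)
  have group: "(\<Sum>x\<in>X. f x) = (\<Sum>c\<in>g k ` X. \<Sum>x\<in>cell c. f x)" for f :: "'a \<Rightarrow> real"
    unfolding cell_def using X by (intro sum.group[symmetric]) auto
  have res: "a * (1 - b / max a b) = max 0 (a - b)" if "0 \<le> a" "0 \<le> b" for a b :: real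
  proof (cases "a \<le> b")
    case True
    thus ?thesis using that by (cases "b = 0") (simp_all add: max_def)
  next
    case False
    thus ?thesis using that by (simp add: max_def right_diff_distrib)
  qed
  have U': "(\<Sum>x\<in>cell c. u' x) = max 0 (U c - V c)" for c
  proof -
    have "(\<Sum>x\<in>cell c. u' x) = (\<Sum>x\<in>cell c. u x * (1 - V c / M c))"
      by (intro sum.cong) (auto simp: u'_def cell_def)
    also have "\<dots> = U c * (1 - V c / M c)" by (simp add: U_def sum_distrib_right)
    also have "\<dots> = max 0 (U c - V c)" using res[of "U c" "V c"] UV by (simp add: M_def)
    finally show ?thesis .
  qed
  have V': "(\<Sum>x\<in>cell c. v' x) = max 0 (V c - U c)" for c
  proof -
    have "(\<Sum>x\<in>cell c. v' x) = (\<Sum>x\<in>cell c. v x * (1 - U c / M c))"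
      by (intro sum.cong) (auto simp: v'_def cell_def)
    also have "\<dots> = V c * (1 - U c / M c)" by (simp add: V_def sum_distrib_right)
    also have "\<dots> = max 0 (V c - U c)"
      using res[of "V c" "U c"] UV by (simp add: M_def max.commute)
    finally show ?thesis .
  qed
  \<comment> \<open>The plan removes equal amounts from both sides of every cell of level
    \<open>k\<close>, which cancel in all coarser differences.\<close>
  have D: "D j u' v' = D j u v" if j: "k \<le> j" for j
  proof -
    have ref: "g j x = g j y" if "x \<in> X" "y \<in> X" "g k x = g k y" for x y
      using j
    proof (induction j rule: dec_induct)
      case base
      show ?case by (rule that(3))
    next
      case (step j)
      show ?case by (rule refine[OF that(1,2) step.IH])
    qed
    have zero: "(\<Sum>x\<in>{x\<in>X. g k x = c}. (u' x - v' x) - (u x - v x)) = 0" for c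
    proof -
      have "(\<Sum>x\<in>cell c. (u' x - v' x) - (u x - v x))
          = max 0 (U c - V c) - max 0 (V c - U c) - (U c - V c)"
        by (simp only: sum_subtractf U' V') (simp add: U_def V_def)
      also have "\<dots> = 0" by (simp add: max_def)
      finally show ?thesis by (simp only: cell_def)
    qed
    have "(\<Sum>x\<in>{x\<in>X. g j x = c}. u' x - v' x) = (\<Sum>x\<in>{x\<in>X. g j x = c}. u x - v x)" for c
      using sum_refine_zero[where g = "g k" and h = "g j" and c = c, OF X ref zero]
        sum_subtractf[of "\<lambda>x. u' x - v' x" "\<lambda>x. u x - v x" "{x\<in>X. g j x = c}"] by linarith
    thus ?thesis by (simp only: D_def)
  qed
  have UVsum: "(\<Sum>c\<in>g k ` X. U c) = (\<Sum>c\<in>g k ` X. V c)"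
    using eq unfolding group U_def V_def by simp
  \<comment> \<open>The rests are the positive and negative parts of the cell differences; as these
    sum to zero, each part is half of the absolute sum.\<close>
  have tot: "(\<Sum>x\<in>X. u' x) = D k u v / 2" "(\<Sum>x\<in>X. v' x) = D k u v / 2"
  proof -
    have D: "D k u v = (\<Sum>c\<in>g k ` X. \<bar>U c - V c\<bar>)"
      by (simp add: D_def U_def V_def cell_def sum_subtractf)
    have "(\<Sum>x\<in>X. u' x) = (\<Sum>c\<in>g k ` X. (\<bar>U c - V c\<bar> + (U c - V c)) / 2)"
      unfolding group U' by (intro sum.cong) (auto simp: max_def)
    also have "\<dots> = D k u v / 2"
      using UVsum by (simp add: D sum.distrib sum_subtractf flip: sum_divide_distrib)
    finally show "(\<Sum>x\<in>X. u' x) = D k u v / 2" .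
    have "(\<Sum>x\<in>X. v' x) = (\<Sum>c\<in>g k ` X. (\<bar>U c - V c\<bar> - (U c - V c)) / 2)"
      unfolding group V' by (intro sum.cong) (auto simp: max_def)
    also have "\<dots> = D k u v / 2"
      using UVsum by (simp add: D sum.distrib sum_subtractf flip: sum_divide_distrib)
    finally show "(\<Sum>x\<in>X. v' x) = D k u v / 2" .
  qed
  have pos: "0 \<le> u' x" "0 \<le> v' x" if "x \<in> X" for x
    using that u v frac by (auto simp: u'_def v'_def)
  obtain \<gamma>' where \<gamma>': "\<And>x y. x \<in> X \<Longrightarrow> y \<in> X \<Longrightarrow> 0 \<le> \<gamma>' x y"
    "\<And>x. x \<in> X \<Longrightarrow> (\<Sum>y\<in>X. \<gamma>' x y) = u' x" "\<And>y. y \<in> X \<Longrightarrow> (\<Sum>x\<in>X. \<gamma>' x y) = v' y"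
    "(\<Sum>x\<in>X. \<Sum>y\<in>X. \<gamma>' x y * d x y)
      \<le> r (Suc k) * (\<Sum>x\<in>X. u' x) + (\<Sum>j\<in>{Suc k..<m}. r (Suc j) * (D j u' v' / 2))"
    using step.IH[of u' v', OF pos trans[OF tot(1) tot(2)[symmetric]]] by blast
  have row: "(\<Sum>y\<in>X. \<gamma>0 x y) = u x - u' x" if "x \<in> X" for x
  proof -
    have "(\<Sum>y\<in>X. \<gamma>0 x y) = (\<Sum>y\<in>cell (g k x). u x * v y / M (g k x))"
      using X unfolding \<gamma>0_def cell_def by (intro sum.mono_neutral_cong_right) auto
    also have "\<dots> = u x * V (g k x) / M (g k x)"
      by (simp add: V_def sum_distrib_left sum_divide_distrib)
    finally show ?thesis by (simp add: u'_def algebra_simps)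
  qed
  have col: "(\<Sum>x\<in>X. \<gamma>0 x y) = v y - v' y" if "y \<in> X" for y
  proof -
    have "(\<Sum>x\<in>X. \<gamma>0 x y) = (\<Sum>x\<in>cell (g k y). u x * v y / M (g k y))"
      using X unfolding \<gamma>0_def cell_def by (intro sum.mono_neutral_cong_right) auto
    also have "\<dots> = U (g k y) * v y / M (g k y)"
      by (simp add: U_def sum_distrib_right sum_divide_distrib)
    finally show ?thesis by (simp add: v'_def algebra_simps)
  qed
  have \<gamma>0: "0 \<le> \<gamma>0 x y" if "x \<in> X" "y \<in> X" for x y
    using that u v M by (simp add: \<gamma>0_def)
  have cost0: "(\<Sum>x\<in>X. \<Sum>y\<in>X. \<gamma>0 x y * d x y) \<le> r k * (\<Sum>x\<in>X. u x)"
  proof -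
    have "\<gamma>0 x y * d x y \<le> \<gamma>0 x y * r k" if "x \<in> X" "y \<in> X" for x y
    proof (cases "g k x = g k y")
      case True
      show ?thesis by (rule mult_left_mono[OF diam[OF that True] \<gamma>0[OF that]])
    qed (simp add: \<gamma>0_def)
    hence "(\<Sum>x\<in>X. \<Sum>y\<in>X. \<gamma>0 x y * d x y) \<le> (\<Sum>x\<in>X. \<Sum>y\<in>X. \<gamma>0 x y * r k)" by (intro sum_mono)
    also have "\<dots> = (\<Sum>x\<in>X. (u x - u' x) * r k)" by (simp add: row flip: sum_distrib_right)
    also have "\<dots> \<le> (\<Sum>x\<in>X. u x * r k)" using pos r by (intro sum_mono mult_right_mono) auto
    finally show ?thesis by (simp add: sum_distrib_left mult.commute)
  qed
  show ?case
  proof (intro exI[of _ "\<lambda>x y. \<gamma>0 x y + \<gamma>' x y"] conjI ballI)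
    have "(\<Sum>x\<in>X. \<Sum>y\<in>X. (\<gamma>0 x y + \<gamma>' x y) * d x y)
        = (\<Sum>x\<in>X. \<Sum>y\<in>X. \<gamma>0 x y * d x y) + (\<Sum>x\<in>X. \<Sum>y\<in>X. \<gamma>' x y * d x y)"
      by (simp add: distrib_right sum.distrib)
    also have "\<dots> \<le> r k * (\<Sum>x\<in>X. u x) + (r (Suc k) * (D k u v / 2) + (\<Sum>j\<in>{Suc k..<m}. r (Suc j) * (D j u v / 2)))"
    proof (intro add_mono cost0)
      have "(\<Sum>j\<in>{Suc k..<m}. r (Suc j) * (D j u' v' / 2)) = (\<Sum>j\<in>{Suc k..<m}. r (Suc j) * (D j u v / 2))"
        using D by (intro sum.cong) auto
      thus "(\<Sum>x\<in>X. \<Sum>y\<in>X. \<gamma>' x y * d x y)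
          \<le> r (Suc k) * (D k u v / 2) + (\<Sum>j\<in>{Suc k..<m}. r (Suc j) * (D j u v / 2))"
        using \<gamma>'(4) by (simp only: tot(1))
    qed
    also have "\<dots> = r k * (\<Sum>x\<in>X. u x) + (\<Sum>j\<in>{k..<m}. r (Suc j) * (D j u v / 2))"
      using step.hyps by (simp add: sum.atLeast_Suc_lessThan)
    finally show "(\<Sum>x\<in>X. \<Sum>y\<in>X. (\<gamma>0 x y + \<gamma>' x y) * d x y)
        \<le> r k * (\<Sum>x\<in>X. u x) + (\<Sum>j\<in>{k..<m}. r (Suc j) * (D j u v / 2))" .
  qed (simp_all add: \<gamma>0 \<gamma>' row col sum.distrib)
qed

section \<open>Upper estimates of the Wasserstein distance by transport plans\<close>

context finite_metric
begin

lemma wasserstein_le_expect: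
  assumes q: "set_pmf q \<subseteq> X" and M: "M \<in> coup p q"
  shows "wasserstein d p q \<le> expect M (\<lambda>(x, y). d x y)"
  unfolding wasserstein_def
proof (rule cINF_lower[OF _ M])
  show "bdd_below ((\<lambda>M. expect M (\<lambda>(x, y). d x y)) ` coup p q)"
  proof (rule bdd_belowI2)
    fix M assume "M \<in> coup p q"
    hence sub: "set_pmf M \<subseteq> X \<times> X" by (rule coup_support[OF _ q])
    have "AE z in measure_pmf M. 0 \<le> (case z of (x, y) \<Rightarrow> d x y)"
    proof (subst AE_measure_pmf_iff, intro ballI)
      fix z assume "z \<in> set_pmf M"
      hence "fst z \<in> X" "snd z \<in> X" using sub by auto
      thus "0 \<le> (case z of (x, y) \<Rightarrow> d x y)" using dist_nonneg by (simp add: case_prod_beta)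
    qed
    thus "0 \<le> expect M (\<lambda>(x, y). d x y)" by (rule integral_nonneg_AE)
  qed
qed

lemma wasserstein_le_transport:
  assumes q: "set_pmf q \<subseteq> X" and \<gamma>: "\<And>x y. x \<in> X \<Longrightarrow> y \<in> X \<Longrightarrow> 0 \<le> \<gamma> x y"
    "\<And>x. x \<in> X \<Longrightarrow> (\<Sum>y\<in>X. \<gamma> x y) = pmf p x" "\<And>y. y \<in> X \<Longrightarrow> (\<Sum>x\<in>X. \<gamma> x y) = pmf q y"
  shows "wasserstein d p q \<le> (\<Sum>x\<in>X. \<Sum>y\<in>X. \<gamma> x y * d x y)"
proof -
  have XX: "finite (X \<times> X)" using finite_X by simp
  have "(\<Sum>z\<in>X \<times> X. \<gamma> (fst z) (snd z)) = (\<Sum>x\<in>X. \<Sum>y\<in>X. \<gamma> x y)"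
    by (simp add: sum.cartesian_product case_prod_beta)
  also have "\<dots> = 1" using \<gamma>(2) sum_pmf_eq_1[OF finite_X p_X] by simp
  finally have total: "(\<Sum>z\<in>X \<times> X. \<gamma> (fst z) (snd z)) = 1" .
  have "0 \<le> \<gamma> (fst z) (snd z)" if "z \<in> X \<times> X" for z using that \<gamma>(1) by auto
  then obtain M where M: "set_pmf M \<subseteq> X \<times> X" "\<And>z. z \<in> X \<times> X \<Longrightarrow> pmf M z = \<gamma> (fst z) (snd z)"
    using pmf_of_weights[OF XX _ total] by blast
  have EM: "expect M f = (\<Sum>x\<in>X. \<Sum>y\<in>X. \<gamma> x y * f (x, y))" for f
    by (simp add: expect_eq_sum[OF XX M(1)] M(2) sum.cartesian_product case_prod_beta cong: sum.cong)
  have "map_pmf fst M = p"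
  proof (rule pmf_eqI)
    fix x
    have "pmf (map_pmf fst M) x = expect M (indicator (fst -` {x}))" by (simp add: pmf_map)
    also have "\<dots> = (\<Sum>x'\<in>X. if x' = x then pmf p x' else 0)"
      unfolding EM by (intro sum.cong) (auto simp: \<gamma>(2))
    also have "\<dots> = pmf p x" using finite_X p_X by (auto simp: pmf_eq_0_set_pmf)
    finally show "pmf (map_pmf fst M) x = pmf p x" .
  qed
  moreover have "map_pmf snd M = q"
  proof (rule pmf_eqI)
    fix y
    have "pmf (map_pmf snd M) y = expect M (indicator (snd -` {y}))" by (simp add: pmf_map)
    also have "\<dots> = (\<Sum>y'\<in>X. if y' = y then pmf q y' else 0)"
      unfolding EM by (subst sum.swap, intro sum.cong) (auto simp: \<gamma>(3))
    also have "\<dots> = pmf q y" using finite_X q by (auto simp: pmf_eq_0_set_pmf)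
    finally show "pmf (map_pmf snd M) y = pmf q y" .
  qed
  ultimately have "M \<in> coup p q" by (simp add: coup_def)
  from wasserstein_le_expect[OF q this] show ?thesis by (simp add: EM)
qed

lemma pmf_map_eq_sum:
  assumes "set_pmf q \<subseteq> X"
  shows "pmf (map_pmf g q) c = (\<Sum>x\<in>{x\<in>X. g x = c}. pmf q x)"
proof -
  have "pmf (map_pmf g q) c = expect q (indicator (g -` {c}))" by (simp add: pmf_map)
  also have "\<dots> = (\<Sum>x\<in>X. pmf q x * indicator (g -` {c}) x)" by (rule expect_eq_sum[OF finite_X assms])
  also have "\<dots> = (\<Sum>x\<in>{x\<in>X. g x = c}. pmf q x)"
    using finite_X by (intro sum.mono_neutral_cong_right) (auto simp: indicator_def)
  finally show ?thesis .
qed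

text \<open>The index shift reflects that mass unmatched in the cells of level \<open>j\<close>
  moves, at the next attempt, within cells of level \<open>Suc j\<close>; the first term charges the
  whole unit mass at the finest level.\<close>

lemma wasserstein_le_multiscale:
  fixes g :: "nat \<Rightarrow> 'a \<Rightarrow> 'c"
  assumes q: "set_pmf q \<subseteq> X" and r: "\<And>k. 0 \<le> r k"
    and refine: "\<And>k x y. x \<in> X \<Longrightarrow> y \<in> X \<Longrightarrow> g k x = g k y \<Longrightarrow> g (Suc k) x = g (Suc k) y"
    and diam: "\<And>k x y. x \<in> X \<Longrightarrow> y \<in> X \<Longrightarrow> g k x = g k y \<Longrightarrow> d x y \<le> r k"
    and top: "\<And>x y. x \<in> X \<Longrightarrow> y \<in> X \<Longrightarrow> g m x = g m y"
  shows "wasserstein d p q \<le> r 0 + (\<Sum>j<m. r (Suc j) *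
           ((\<Sum>c\<in>g j ` X. \<bar>pmf (map_pmf (g j) p) c - pmf (map_pmf (g j) q) c\<bar>) / 2))"
proof -
  define c where "c = r 0 * (\<Sum>x\<in>X. pmf p x) + (\<Sum>j\<in>{0..<m}. r (Suc j) *
       ((\<Sum>c\<in>g j ` X. \<bar>\<Sum>x\<in>{x\<in>X. g j x = c}. pmf p x - pmf q x\<bar>) / 2))"
  have eq: "(\<Sum>x\<in>X. pmf p x) = (\<Sum>x\<in>X. pmf q x)"
    using sum_pmf_eq_1[OF finite_X p_X] sum_pmf_eq_1[OF finite_X q] by simp
  have "\<exists>\<gamma>. (\<forall>x\<in>X. \<forall>y\<in>X. 0 \<le> \<gamma> x y) \<and> (\<forall>x\<in>X. (\<Sum>y\<in>X. \<gamma> x y) = pmf p x) \<and>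
      (\<forall>y\<in>X. (\<Sum>x\<in>X. \<gamma> x y) = pmf q y) \<and> (\<Sum>x\<in>X. \<Sum>y\<in>X. \<gamma> x y * d x y) \<le> c"
    unfolding c_def
    by (rule multiscale_transport[where g = g and r = r, OF finite_X r refine diam top _ _ _ eq]) simp_all
  then obtain \<gamma> where \<gamma>: "\<And>x y. x \<in> X \<Longrightarrow> y \<in> X \<Longrightarrow> 0 \<le> \<gamma> x y"
    "\<And>x. x \<in> X \<Longrightarrow> (\<Sum>y\<in>X. \<gamma> x y) = pmf p x" "\<And>y. y \<in> X \<Longrightarrow> (\<Sum>x\<in>X. \<gamma> x y) = pmf q y"
    "(\<Sum>x\<in>X. \<Sum>y\<in>X. \<gamma> x y * d x y) \<le> c" by blast
  have "wasserstein d p q \<le> (\<Sum>x\<in>X. \<Sum>y\<in>X. \<gamma> x y * d x y)"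
    by (intro wasserstein_le_transport q \<gamma>(1-3))
  also note \<gamma>(4)
  finally show ?thesis
    by (simp add: c_def pmf_map_eq_sum q p_X sum_subtractf sum_pmf_eq_1[OF finite_X p_X] atLeast0LessThan)
qed

end

section \<open>Upper bound\<close>

lemma log2_ge_1: "0 \<le> x \<Longrightarrow> 1 \<le> log 2 (2 + x)"
  by (simp add: le_log_iff)

text \<open>The norm is homogeneous of degree one, so a pointwise factor \<open>B\<close> enters
  linearly.\<close>

lemma norm_sum_powr_le:
  assumes "0 \<le> B" and le: "\<And>x. x \<in> N \<Longrightarrow> pmf P x \<le> B * f x" and f: "\<And>x. x \<in> N \<Longrightarrow> 0 \<le> f x"
  shows "norm_sum N P powr (3/2) \<le> B * norm23 (image_mset f (mset_set N))"
proof -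
  define s where "s = (\<Sum>x\<in>N. f x powr (2/3))"
  have "norm_sum N P \<le> (\<Sum>x\<in>N. B powr (2/3) * f x powr (2/3))"
    unfolding norm_sum_def
  proof (rule sum_mono)
    fix x assume x: "x \<in> N"
    have "pmf P x powr (2/3) \<le> (B * f x) powr (2/3)" using le[OF x] by (intro powr_mono2) auto
    thus "pmf P x powr (2/3) \<le> B powr (2/3) * f x powr (2/3)" using assms(1) f[OF x] by (simp add: powr_mult)
  qed
  also have "\<dots> = B powr (2/3) * s" by (simp add: s_def sum_distrib_left)
  finally have "norm_sum N P powr (3/2) \<le> (B powr (2/3) * s) powr (3/2)"
    by (intro powr_mono2) (auto simp: norm_sum_def sum_nonneg)
  also have "\<dots> = B * s powr (3/2)"
    using assms(1) by (simp add: powr_mult powr_powr s_def sum_nonneg)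
  finally show ?thesis by (simp add: norm23_image_mset s_def)
qed

lemma (in doubling_space) wasserstein_le_diam:
  assumes q: "set_pmf q \<subseteq> X"
  shows "wasserstein d p q \<le> D"
proof -
  obtain M where M: "M \<in> coup p q" using coup_nonempty by blast
  have sub: "set_pmf M \<subseteq> X \<times> X" by (rule coup_support[OF M q])
  have "wasserstein d p q \<le> expect M (\<lambda>(x, y). d x y)" by (rule wasserstein_le_expect[OF q M])
  also have "\<dots> \<le> expect M (\<lambda>_. D)"
    using sub dist_le_diam finite_X by (intro expect_mono) (auto intro: finite_subset)
  finally show ?thesis by simp
qed

lemma upper_rate_ge:
  assumes "i \<in> scales (diam_on X d) \<epsilon>"
  shows "(2 powi i / \<epsilon>)\<^sup>2 * norm23 (net_vec X p (N i) (\<pi> i)) \<le> upper_rate X d p \<epsilon> N \<pi>"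
    and "2 powi i / \<epsilon> \<le> upper_rate X d p \<epsilon> N \<pi>"
proof -
  have "max (2 powi (2 * i) * \<epsilon> powi (-2) * norm23 (net_vec X p (N i) (\<pi> i))) (2 powi i * \<epsilon> powi (-1))
      \<le> upper_rate X d p \<epsilon> N \<pi>"
    unfolding upper_rate_def using assms finite_scales by (intro Max_ge) auto
  moreover have "2 powi (2 * i) * \<epsilon> powi (-2) = (2 powi i / \<epsilon>)\<^sup>2"
    by (simp add: power_int_minus power_int_mult mult.commute[of 2 i] field_simps power_divide)
  moreover have "2 powi i * \<epsilon> powi (-1) = 2 powi i / \<epsilon>" by (simp add: power_int_minus field_simps)
  ultimately show "(2 powi i / \<epsilon>)\<^sup>2 * norm23 (net_vec X p (N i) (\<pi> i)) \<le> upper_rate X d p \<epsilon> N \<pi>"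
    and "2 powi i / \<epsilon> \<le> upper_rate X d p \<epsilon> N \<pi>" by auto
qed

lemma upper_rate_nonneg: "0 \<le> upper_rate X d p \<epsilon> N \<pi>"
  unfolding upper_rate_def by (intro Max_ge) (auto simp: finite_scales)

lemma accept_prob_deterministic:
  "accept_prob n (\<lambda>zs. return_pmf (Q zs)) q = measure_pmf.prob (replicate_pmf n q) {zs. Q zs}"
proof -
  have "(Q -` {True}) = {zs. Q zs}" by auto
  thus ?thesis unfolding accept_prob_def by (simp add: map_pmf_def[symmetric] pmf_map)
qed

section \<open>Nested cells over all scales and the combined tester\<close>

locale multiscale = doubling_space +
  fixes \<epsilon> :: real and N :: "int \<Rightarrow> 'a set" and \<pi> :: "int \<Rightarrow> 'a \<Rightarrow> 'a"
  assumes \<epsilon>: "0 < \<epsilon>" "\<epsilon> \<le> D"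
    and nets: "\<And>i. i \<in> scales D \<epsilon> \<Longrightarrow> well_separated_net X d (2 powi i) (N i) \<and> nearest_map X d (N i) (\<pi> i)"
begin

definition low :: int where "low = \<lceil>log 2 (\<epsilon> / 8)\<rceil>"
definition high :: int where "high = \<lfloor>log 2 D\<rfloor>"
definition levels :: nat where "levels = nat (high - low) + 1"
definition lv :: "nat \<Rightarrow> int" where "lv k = low + int k"
definition radius :: "nat \<Rightarrow> real" where "radius k = 2 powi low * 2 ^ k"

text \<open>Each map factors through the previous one, so the fibres are nested by construction.
  From \<open>levels\<close> on the map is constantly \<open>undefined\<close>: a single cell, the
  top partition of the transport.\<close>

primrec G :: "nat \<Rightarrow> 'a \<Rightarrow> 'a" where
  "G 0 = \<pi> low"
| "G (Suc k) = (\<lambda>y. if Suc k < levels then \<pi> (lv (Suc k)) (G k y) else undefined)"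

lemma D_pos: "0 < D" using \<epsilon> by simp

lemma low_le_high: "low \<le> high"
proof -
  have "log 2 (\<epsilon> / 8) = log 2 \<epsilon> - 3"
    using \<epsilon> log_divide[of 2 \<epsilon> 8] log_pow_cancel[of 2 3] by simp
  moreover have "log 2 \<epsilon> \<le> log 2 D" using \<epsilon> by simp
  ultimately show ?thesis unfolding low_def high_def by linarith
qed

lemma lv_scales: "k < levels \<Longrightarrow> lv k \<in> scales D \<epsilon>"
  using D_pos low_le_high unfolding scales_def lv_def levels_def low_def high_def by simp linarith

lemma radius_lv: "2 powi lv k = radius k"
  by (simp add: lv_def radius_def power_int_add)

lemma radius_pos: "0 < radius k"
  by (simp add: radius_def)

lemma radius_Suc: "radius (Suc k) = 2 * radius k"
  by (simp add: radius_def)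

text \<open>Rounding up puts the finest scale between \<open>\<epsilon> / 8\<close> and
  \<open>\<epsilon> / 4\<close>, so moving mass inside its cells, of diameter at most
  \<open>2 * radius 0\<close>, costs at most half of \<open>\<epsilon>\<close>.\<close>

lemma radius_low: "\<epsilon> / 8 \<le> radius 0" "4 * radius 0 \<le> \<epsilon>"
proof -
  have r: "radius 0 = 2 powr real_of_int low" by (simp add: radius_def powr_real_of_int')
  have "\<epsilon> / 8 = 2 powr (log 2 (\<epsilon> / 8))" using \<epsilon> by simp
  also have "\<dots> \<le> radius 0" unfolding r low_def by (intro powr_mono) auto
  finally show "\<epsilon> / 8 \<le> radius 0" .
  have "radius 0 \<le> 2 powr (log 2 (\<epsilon> / 8) + 1)" unfolding r low_def by (intro powr_mono) linarith+
  also have "\<dots> = \<epsilon> / 4" using \<epsilon> by (simp add: powr_add)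
  finally show "4 * radius 0 \<le> \<epsilon>" by simp
qed

lemma radius_ge: "\<epsilon> / 8 \<le> radius k"
proof -
  have "radius 0 * 1 \<le> radius 0 * 2 ^ k" using radius_pos[of 0] by (intro mult_left_mono) auto
  also have "radius 0 * 2 ^ k = radius k" by (simp add: radius_def)
  finally show ?thesis using radius_low(1) by linarith
qed

lemma D_le_radius: "levels \<le> k \<Longrightarrow> D \<le> radius k"
proof -
  assume k: "levels \<le> k"
  have "D = 2 powr (log 2 D)" using D_pos by simp
  also have "\<dots> \<le> 2 powr (real_of_int (lv k))"
  proof (intro powr_mono)
    have "log 2 D \<le> real_of_int high + 1" unfolding high_def by linarith
    also have "\<dots> \<le> real_of_int (lv k)" using k low_le_high unfolding lv_def levels_def by linarith
    finally show "log 2 D \<le> real_of_int (lv k)" .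
  qed simp
  also have "\<dots> = radius k" by (simp add: powr_real_of_int' radius_lv)
  finally show ?thesis .
qed

lemma net_at:
  assumes "k < levels"
  shows "0 < radius k" "well_separated_net X d (radius k) (N (lv k))" "nearest_map X d (N (lv k)) (\<pi> (lv k))"
  using nets[OF lv_scales[OF assms]] radius_pos by (auto simp: radius_lv)

lemma levels_pos: "0 < levels"
  by (simp add: levels_def)

text \<open>Each composition step moves a point by at most the current radius, and
  \<open>radius 0 + ... + radius k\<close> equals \<open>2 * radius k - radius 0\<close>.\<close>

lemma G_props:
  assumes "k < levels" "y \<in> X"
  shows "G k y \<in> N (lv k) \<and> G k y \<in> X \<and> d (G k y) y \<le> 2 * radius k - radius 0"
  using assms(1)
proof (induction k)
  case 0
  note n = net_at[OF 0]
  show ?case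
    using nearest_in_net[OF n assms(2)] nearest_dist[OF n assms(2)] net_X[OF n] by (auto simp: lv_def)
next
  case (Suc k)
  hence IH: "G k y \<in> X" "d (G k y) y \<le> 2 * radius k - radius 0" by auto
  note n = net_at[OF Suc.prems]
  have G: "G (Suc k) y = \<pi> (lv (Suc k)) (G k y)" using Suc.prems by simp
  have N: "G (Suc k) y \<in> N (lv (Suc k))" unfolding G by (rule nearest_in_net[OF n IH(1)])
  hence X: "G (Suc k) y \<in> X" using net_X[OF n] by auto
  have "d (G (Suc k) y) y \<le> d (G (Suc k) y) (G k y) + d (G k y) y"
    using dist_triangle[OF X IH(1) assms(2)] .
  also have "d (G (Suc k) y) (G k y) \<le> radius (Suc k)" unfolding G by (rule nearest_dist[OF n IH(1)])
  finally show ?case using N X IH(2) by (simp add: radius_Suc del: G.simps)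
qed

definition P :: "nat \<Rightarrow> 'a pmf" where "P k = map_pmf (G k) p"
text \<open>Mass unmatched at level \<open>k\<close> travels less than \<open>8 * radius k\<close>,
  so a cell distance of \<open>\<eta> k\<close>, halved, costs at most
  \<open>\<epsilon> / (2 * levels)\<close>.\<close>

definition \<eta> :: "nat \<Rightarrow> real" where "\<eta> k = \<epsilon> / (8 * real levels * radius k)"

lemma G_image: "k < levels \<Longrightarrow> G k ` X \<subseteq> N (lv k)"
  using G_props by blast

lemma \<eta>_bounds: "0 < \<eta> k" "\<eta> k \<le> 1"
proof -
  show "0 < \<eta> k" using \<epsilon> levels_pos radius_pos[of k] by (simp add: \<eta>_def)
  have "\<epsilon> \<le> 1 * (8 * radius k)" using radius_ge[of k] by simp
  also have "\<dots> \<le> real levels * (8 * radius k)"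
    using levels_pos radius_pos[of k] by (intro mult_right_mono) auto
  finally show "\<eta> k \<le> 1" using levels_pos radius_pos[of k] by (simp add: \<eta>_def)
qed

text \<open>Were all levels close, the finest cells would cost at most \<open>\<epsilon> / 2\<close>
  and the levels together less than \<open>\<epsilon> / 2\<close>, contradicting the distance of
  \<open>q\<close>.\<close>

lemma far_at_some_level:
  assumes q: "q \<in> far_dists X d p \<epsilon>"
  shows "\<exists>k<levels. \<eta> k \<le> (\<Sum>x\<in>N (lv k). \<bar>pmf (P k) x - pmf (map_pmf (G k) q) x\<bar>)"
proof (rule ccontr)
  assume "\<not> ?thesis"
  hence close: "(\<Sum>x\<in>N (lv k). \<bar>pmf (P k) x - pmf (map_pmf (G k) q) x\<bar>) < \<eta> k" if "k < levels" for k
    using that by force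
  have qX: "set_pmf q \<subseteq> X" and W: "\<epsilon> \<le> wasserstein d p q" using q by (auto simp: far_dists_def)
  \<comment> \<open>Twice the displacement bound of \<open>G_props\<close>, hence a bound on the
    diameter of a nested cell; for the top cell it exceeds \<open>D\<close>.\<close>
  define r where "r = (\<lambda>k. 4 * radius k - 2 * radius 0)"
  have mono: "radius 0 \<le> radius k" for k
    using radius_pos[of 0] by (simp add: radius_def)
  have r0: "0 \<le> r k" for k using mono[of k] radius_pos[of 0] by (simp add: r_def)
  have "wasserstein d p q \<le> r 0 + (\<Sum>j<levels. r (Suc j) *
      ((\<Sum>c\<in>G j ` X. \<bar>pmf (map_pmf (G j) p) c - pmf (map_pmf (G j) q) c\<bar>) / 2))"
  proof (rule wasserstein_le_multiscale[OF qX r0])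
    fix k x y assume xy: "x \<in> X" "y \<in> X" "G k x = G k y"
    show "G (Suc k) x = G (Suc k) y" using xy by simp
    show "d x y \<le> r k"
    proof (cases "k < levels")
      case True
      have "d x y \<le> d x (G k x) + d (G k x) y" using G_props[OF True] xy by (intro dist_triangle) auto
      also have "\<dots> = d (G k x) x + d (G k y) y" using G_props[OF True] xy dist_commute[of x "G k x"] by simp
      also have "\<dots> \<le> r k" using G_props[OF True xy(1)] G_props[OF True xy(2)] by (simp add: r_def)
      finally show ?thesis .
    next
      case False
      have "d x y \<le> D" using xy by (intro dist_le_diam)
      also have "\<dots> \<le> radius k" using False by (intro D_le_radius) simp
      also have "\<dots> \<le> r k" using mono[of k] radius_pos[of k] by (simp add: r_def)
      finally show ?thesis .
    qed
  next
    fix x y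
    obtain j where "levels = Suc j" using levels_pos by (cases levels) auto
    thus "G levels x = G levels y" by simp
  qed
  also have "\<dots> < r 0 + (\<Sum>j<levels. \<epsilon> / (2 * real levels))"
  proof (intro add_strict_left_mono sum_strict_mono)
    fix j assume "j \<in> {..<levels}"
    hence j: "j < levels" by simp
    have "(\<Sum>c\<in>G j ` X. \<bar>pmf (map_pmf (G j) p) c - pmf (map_pmf (G j) q) c\<bar>)
        \<le> (\<Sum>x\<in>N (lv j). \<bar>pmf (P j) x - pmf (map_pmf (G j) q) x\<bar>)"
      unfolding P_def using G_image[OF j] net_finite[OF net_at[OF j]] by (intro sum_mono2) auto
    also have "\<dots> < \<eta> j" by (rule close[OF j])
    finally have "(\<Sum>c\<in>G j ` X. \<bar>pmf (map_pmf (G j) p) c - pmf (map_pmf (G j) q) c\<bar>) / 2 < \<eta> j / 2" by simp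
    moreover have "0 < r (Suc j)" using mono[of j] radius_pos[of j] by (simp add: r_def radius_Suc)
    ultimately have "r (Suc j) * ((\<Sum>c\<in>G j ` X. \<bar>pmf (map_pmf (G j) p) c - pmf (map_pmf (G j) q) c\<bar>) / 2)
        < r (Suc j) * (\<eta> j / 2)" by (rule mult_strict_left_mono)
    also have "\<dots> \<le> (8 * radius j) * (\<eta> j / 2)"
      using \<eta>_bounds[of j] radius_pos[of 0] by (intro mult_right_mono) (auto simp: r_def radius_Suc)
    also have "\<dots> = \<epsilon> / (2 * real levels)" using radius_pos[of j] by (simp add: \<eta>_def)
    finally show "r (Suc j) * ((\<Sum>c\<in>G j ` X. \<bar>pmf (map_pmf (G j) p) c - pmf (map_pmf (G j) q) c\<bar>) / 2)
        < \<epsilon> / (2 * real levels)" .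
  qed (use levels_pos in auto)
  also have "\<dots> \<le> \<epsilon>" using radius_low(2) levels_pos by (simp add: r_def)
  finally show False using W by simp
qed

text \<open>A nested cell lies in the ball of radius \<open>2 * radius k\<close>, while the given
  cell contains the ball of radius \<open>radius k / 2\<close>; two doublings lead from one to the
  other.\<close>

lemma pmf_P_le:
  assumes k: "k < levels" and x: "x \<in> N (lv k)"
  shows "pmf (P k) x \<le> C\<^sup>2 * cell_mass X p (\<pi> (lv k)) x"
proof -
  note n = net_at[OF k]
  have xX: "x \<in> X" using net_X[OF n] x by blast
  have "pmf (P k) x = measure_pmf.prob p {y\<in>X. G k y = x}"
    unfolding P_def pmf_map_eq_sum[OF p_X] using finite_X by (simp add: measure_measure_pmf_finite)
  also have "\<dots> \<le> mass x (2\<^sup>2 * (radius k / 2))"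
    using G_props[OF k] radius_pos[of 0]
    by (intro measure_pmf.finite_measure_mono) (fastforce simp: ball_on_def)+
  also have "\<dots> \<le> C\<^sup>2 * mass x (radius k / 2)" using xX radius_pos[of k] by (intro mass_doubling) auto
  also have "\<dots> \<le> C\<^sup>2 * cell_mass X p (\<pi> (lv k)) x" using cell_mass_ge[OF n x] by (intro mult_left_mono) auto
  finally show ?thesis .
qed

text \<open>The additive 4 consists of \<open>log 2 8 = 3\<close> and one for counting both end
  points; it is absorbed because the logarithm of \<open>2 + D / \<epsilon>\<close> is at least
  1.\<close>

lemma levels_le: "real levels \<le> 5 * log 2 (2 + D / \<epsilon>)"
proof -
  have "real levels = real_of_int high - real_of_int low + 1" using low_le_high by (simp add: levels_def)
  also have "\<dots> \<le> log 2 D - log 2 (\<epsilon> / 8) + 1" unfolding high_def low_def by linarith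
  also have "\<dots> = log 2 (D / \<epsilon>) + 4"
    using \<epsilon> D_pos log_divide[of 2 \<epsilon> 8] log_pow_cancel[of 2 3] log_divide[of 2 D \<epsilon>] by simp
  also have "\<dots> \<le> log 2 (2 + D / \<epsilon>) + 4 * log 2 (2 + D / \<epsilon>)"
    using \<epsilon> D_pos log2_ge_1[of "D / \<epsilon>"] by (intro add_mono) (auto simp: add_pos_pos)
  finally show ?thesis by simp
qed

text \<open>All levels test the same \<open>m + m\<close> samples, pushed forward by
  \<open>G k\<close>, and acceptance requires all of them. Only the acceptance of \<open>p\<close>
  needs a union bound; a far \<open>q\<close> is caught by a single level.\<close>

lemma upper_bound:
  "\<exists>n T. is_tester X d p \<epsilon> n T \<and>
     real n \<le> 16000500 * C\<^sup>2 * log 2 (2 + D / \<epsilon>) ^ 3 * upper_rate X d p \<epsilon> N \<pi>"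
proof -
  define U where "U = upper_rate X d p \<epsilon> N \<pi>"
  define L where "L = real levels"
  \<comment> \<open>Each level needs \<open>1000 * L\<close> times its norm, divided by the square
    of \<open>\<eta> k\<close>. The latter contributes \<open>64 * L ^ 2\<close> and
    \<open>(radius k / \<epsilon>) ^ 2\<close>, and \<open>C ^ 2\<close> is the price of nested
    cells.\<close>
  define M where "M = 64000 * L ^ 3 * C\<^sup>2 * U"
  define m where "m = nat \<lceil>M\<rceil>"
  define accept where "accept = (\<lambda>zs. \<forall>k<levels. identity_test (N (lv k)) (P k) (\<eta> k) m (map (G k) zs))"
  define T where "T = (\<lambda>zs. return_pmf (accept zs))"
  have L: "1 \<le> L" using levels_pos by (simp add: L_def)
  have C2: "1 \<le> C\<^sup>2" using C by simp
  have U0: "0 \<le> U" by (simp add: U_def upper_rate_nonneg)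
  have M0: "0 \<le> M" using L U0 by (simp add: M_def)
  have Mm: "M \<le> real m" "real m \<le> M + 1" using M0 by (simp_all add: m_def)
  \<comment> \<open>The top scale is at least \<open>D/2\<close> and hence
    \<open>\<epsilon>/2\<close>, so its linear term keeps the rate away from 0. This pays for
    rounding \<open>M\<close> up.\<close>
  have U1: "1 \<le> 2 * U"
  proof -
    obtain j where j: "levels = Suc j" using levels_pos by (cases levels) auto
    hence "radius j / \<epsilon> \<le> U"
      using upper_rate_ge(2)[OF lv_scales[of j]] by (simp add: radius_lv U_def)
    moreover have "\<epsilon> \<le> 2 * radius j" using D_le_radius[of levels] \<epsilon> j by (simp add: radius_Suc)
    hence "1 \<le> 2 * (radius j / \<epsilon>)" using \<epsilon> by (simp add: field_simps)
    ultimately show ?thesis by linarith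
  qed
  have m: "1000 * L * norm_sum (N (lv k)) (P k) powr (3/2) \<le> real m * (\<eta> k)\<^sup>2" if k: "k < levels" for k
  proof -
    note n = net_at[OF k]
    define nrm where "nrm = norm23 (net_vec X p (N (lv k)) (\<pi> (lv k)))"
    have "norm_sum (N (lv k)) (P k) powr (3/2) \<le> C\<^sup>2 * nrm"
      unfolding nrm_def net_vec_def using pmf_P_le[OF k] cell_mass_pos[OF n]
      by (intro norm_sum_powr_le) (auto intro: less_imp_le)
    hence "1000 * L * norm_sum (N (lv k)) (P k) powr (3/2) \<le> 1000 * L * (C\<^sup>2 * nrm)"
      using L by (intro mult_left_mono) auto
    also have "\<dots> = 64000 * L ^ 3 * C\<^sup>2 * ((radius k / \<epsilon>)\<^sup>2 * nrm) * (\<eta> k)\<^sup>2"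
      using \<epsilon> radius_pos[of k] L
      by (simp add: \<eta>_def L_def[symmetric] power_divide power_mult_distrib power2_eq_square power3_eq_cube)
    also have "\<dots> \<le> 64000 * L ^ 3 * C\<^sup>2 * U * (\<eta> k)\<^sup>2"
      using upper_rate_ge(1)[OF lv_scales[OF k]] L
      by (intro mult_right_mono mult_left_mono) (auto simp: radius_lv U_def nrm_def)
    also have "\<dots> \<le> real m * (\<eta> k)\<^sup>2" using Mm by (intro mult_right_mono) (auto simp: M_def)
    finally show ?thesis .
  qed
  have supp: "set_pmf (map_pmf (G k) q) \<subseteq> N (lv k)" if "k < levels" "set_pmf q \<subseteq> X" for k q
    using G_image[OF that(1)] that(2) by auto
  \<comment> \<open>Mapping the samples through \<open>G k\<close> is the same as sampling from the
    pushed-forward distribution.\<close>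
  have push: "measure_pmf.prob (replicate_pmf (m + m) q) {zs. A (map (G k) zs)}
            = measure_pmf.prob (replicate_pmf (m + m) (map_pmf (G k) q)) {zs. A zs}" for A k q
    by (simp add: replicate_pmf_map vimage_def)
  have acc: "2/3 \<le> accept_prob (m + m) T p"
  proof -
    let ?R = "replicate_pmf (m + m) p"
    have "measure_pmf.prob ?R (\<Union>k<levels. {zs. \<not> identity_test (N (lv k)) (P k) (\<eta> k) m (map (G k) zs)})
        \<le> (\<Sum>k<levels. measure_pmf.prob ?R {zs. \<not> identity_test (N (lv k)) (P k) (\<eta> k) m (map (G k) zs)})"
      by (intro measure_UNION_le) auto
    also have "\<dots> \<le> (\<Sum>k<levels. 1 / (3 * L))"
    proof (rule sum_mono)
      fix k assume "k \<in> {..<levels}"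
      hence k: "k < levels" by simp
      have "measure_pmf.prob (replicate_pmf (m + m) (P k)) {zs. \<not> identity_test (N (lv k)) (P k) (\<eta> k) m zs} \<le> 1 / (3 * L)"
        using supp[OF k p_X]
        by (intro identity_test_complete net_finite[OF net_at[OF k]] \<eta>_bounds L m[OF k]) (simp add: P_def)
      thus "measure_pmf.prob ?R {zs. \<not> identity_test (N (lv k)) (P k) (\<eta> k) m (map (G k) zs)} \<le> 1 / (3 * L)"
        using push[where k = k and q = p and A = "\<lambda>zs. \<not> identity_test (N (lv k)) (P k) (\<eta> k) m zs"]
        by (simp add: P_def)
    qed
    also have "\<dots> = 1/3" using L by (simp add: L_def)
    also have "(\<Union>k<levels. {zs. \<not> identity_test (N (lv k)) (P k) (\<eta> k) m (map (G k) zs)}) = - {zs. accept zs}"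
      by (auto simp: accept_def)
    also have "measure_pmf.prob ?R (- {zs. accept zs}) = 1 - measure_pmf.prob ?R {zs. accept zs}"
      using measure_pmf.prob_compl[of "{zs. accept zs}" ?R] by (simp add: Compl_eq_Diff_UNIV)
    finally show ?thesis by (simp add: T_def accept_prob_deterministic)
  qed
  moreover have "2/3 \<le> reject_prob (m + m) T q" if q: "q \<in> far_dists X d p \<epsilon>" for q
  proof -
    have qX: "set_pmf q \<subseteq> X" using q by (simp add: far_dists_def)
    obtain k where k: "k < levels" and far: "\<eta> k \<le> (\<Sum>x\<in>N (lv k). \<bar>pmf (P k) x - pmf (map_pmf (G k) q) x\<bar>)"
      using far_at_some_level[OF q] by blast
    have "accept_prob (m + m) T q = measure_pmf.prob (replicate_pmf (m + m) q) {zs. accept zs}"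
      by (simp add: T_def accept_prob_deterministic)
    also have "\<dots> \<le> measure_pmf.prob (replicate_pmf (m + m) q) {zs. identity_test (N (lv k)) (P k) (\<eta> k) m (map (G k) zs)}"
      using k by (intro measure_pmf.finite_measure_mono) (auto simp: accept_def)
    also have "\<dots> = measure_pmf.prob (replicate_pmf (m + m) (map_pmf (G k) q)) {zs. identity_test (N (lv k)) (P k) (\<eta> k) m zs}"
      by (rule push)
    also have "\<dots> \<le> 1/3"
      using supp[OF k p_X]
      by (intro identity_test_sound[OF net_finite[OF net_at[OF k]] _ \<eta>_bounds L m[OF k] supp[OF k qX] far])
         (simp add: P_def)
    finally show ?thesis using accept_reject_prob[of "m + m" T q] by simp
  qed
  ultimately have "is_tester X d p \<epsilon> (m + m) T" by (simp add: is_tester_def)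
  moreover have "real (m + m) \<le> 16000500 * C\<^sup>2 * log 2 (2 + D / \<epsilon>) ^ 3 * U"
  proof -
    have LC: "1 \<le> L ^ 3 * C\<^sup>2" using L C2 mult_mono[of 1 "L ^ 3" 1 "C\<^sup>2"] one_le_power[OF L, of 3] by simp
    have "real (m + m) \<le> 2 * M + 4 * U" using Mm U1 by simp
    also have "\<dots> \<le> 2 * M + 4 * (L ^ 3 * C\<^sup>2 * U)" using mult_right_mono[OF LC U0] by simp
    also have "\<dots> = 128004 * (L ^ 3 * (C\<^sup>2 * U))" by (simp add: M_def)
    also have "\<dots> \<le> 128004 * ((5 * log 2 (2 + D / \<epsilon>)) ^ 3 * (C\<^sup>2 * U))"
      using levels_le L U0 by (intro mult_left_mono mult_right_mono power_mono) (auto simp: L_def)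
    also have "\<dots> = 16000500 * C\<^sup>2 * log 2 (2 + D / \<epsilon>) ^ 3 * U" by (simp add: power_mult_distrib)
    finally show ?thesis .
  qed
  ultimately show ?thesis unfolding U_def by blast
qed

end

theorem theorem17:
  shows "\<exists>k::nat. \<forall>C::real. C > 1 \<longrightarrow>
    (\<exists>K::real. \<exists>c::real. K > 0 \<and> c > 0 \<and>
      (\<forall>(X::'a set) (d::'a \<Rightarrow> 'a \<Rightarrow> real) (p::'a pmf) (\<epsilon>::real)
         (N::int \<Rightarrow> 'a set) (\<pi>::int \<Rightarrow> 'a \<Rightarrow> 'a).
        finite X \<longrightarrow> metric_on X d \<longrightarrow> set_pmf p \<subseteq> X \<longrightarrow> \<epsilon> > 0 \<longrightarrow> doubling X d p C \<longrightarrow>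
        (\<forall>i\<in>scales (diam_on X d) \<epsilon>. well_separated_net X d (2 powi i) (N i)
                                   \<and> nearest_map X d (N i) (\<pi> i)) \<longrightarrow>
          (\<exists>n T. is_tester X d p \<epsilon> n T \<and>
             real n \<le> K * (log 2 (2 + diam_on X d / \<epsilon>)) ^ k * upper_rate X d p \<epsilon> N \<pi>)
          \<and> (far_dists X d p \<epsilon> \<noteq> {} \<longrightarrow>
             (\<forall>n T. is_tester X d p \<epsilon> n T \<longrightarrow> c * lower_rate X d p \<epsilon> N \<pi> \<le> real n))))"
proof (rule exI[of _ 3], intro allI impI)
  fix C :: real assume C: "C > 1"
  \<comment> \<open>The exponent depends on \<open>C\<close> alone, which makes the constant of the
    lower bound uniform over all spaces.\<close>
  obtain m where "8 * C ^ 3 < 2 ^ m" using real_arch_pow[of 2 "8 * C ^ 3"] by auto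
  hence m: "8 * C ^ 3 \<le> 2 ^ m" by simp
  define K where "K = 16000500 * C\<^sup>2"
  define B where "B = 256 * (C ^ (m + 5)) ^ 4 * C ^ 4"
  have B: "0 < B" using C by (simp add: B_def)
  show "\<exists>K::real. \<exists>c::real. K > 0 \<and> c > 0 \<and>
      (\<forall>(X::'a set) (d::'a \<Rightarrow> 'a \<Rightarrow> real) (p::'a pmf) (\<epsilon>::real)
         (N::int \<Rightarrow> 'a set) (\<pi>::int \<Rightarrow> 'a \<Rightarrow> 'a).
        finite X \<longrightarrow> metric_on X d \<longrightarrow> set_pmf p \<subseteq> X \<longrightarrow> \<epsilon> > 0 \<longrightarrow> doubling X d p C \<longrightarrow>
        (\<forall>i\<in>scales (diam_on X d) \<epsilon>. well_separated_net X d (2 powi i) (N i)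
                                   \<and> nearest_map X d (N i) (\<pi> i)) \<longrightarrow>
          (\<exists>n T. is_tester X d p \<epsilon> n T \<and>
             real n \<le> K * (log 2 (2 + diam_on X d / \<epsilon>)) ^ 3 * upper_rate X d p \<epsilon> N \<pi>)
          \<and> (far_dists X d p \<epsilon> \<noteq> {} \<longrightarrow>
             (\<forall>n T. is_tester X d p \<epsilon> n T \<longrightarrow> c * lower_rate X d p \<epsilon> N \<pi> \<le> real n)))"
  proof (rule exI[of _ K], rule exI[of _ "1 / B"], intro conjI allI impI)
    show "0 < K" using C by (simp add: K_def)
    show "0 < 1 / B" using B by simp
  next
    fix X :: "'a set" and d :: "'a \<Rightarrow> 'a \<Rightarrow> real" and p :: "'a pmf" and \<epsilon> :: real
      and N :: "int \<Rightarrow> 'a set" and \<pi> :: "int \<Rightarrow> 'a \<Rightarrow> 'a"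
    assume X: "finite X" "metric_on X d" "set_pmf p \<subseteq> X" and \<epsilon>: "0 < \<epsilon>" and dbl: "doubling X d p C"
      and nets: "\<forall>i\<in>scales (diam_on X d) \<epsilon>. well_separated_net X d (2 powi i) (N i)
                                   \<and> nearest_map X d (N i) (\<pi> i)"
    interpret doubling_space X d p C using X C dbl by unfold_locales
    show "\<exists>n T. is_tester X d p \<epsilon> n T \<and>
             real n \<le> K * (log 2 (2 + D / \<epsilon>)) ^ 3 * upper_rate X d p \<epsilon> N \<pi>"
    proof (cases "\<epsilon> \<le> D")
      case True
      interpret multiscale X d p C \<epsilon> N \<pi> using \<epsilon> True nets by unfold_locales auto
      show ?thesis unfolding K_def by (rule upper_bound)
    next
      case False
      \<comment> \<open>No distance exceeds \<open>D\<close>, so nothing is far and constant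
        acceptance with no samples is a tester. This case cannot go through the general
        construction, as there may be no scale at all.\<close>
      hence none: "far_dists X d p \<epsilon> = {}" using wasserstein_le_diam by (fastforce simp: far_dists_def)
      obtain a b where "a \<in> X" "b \<in> X" "d a b = D" by (rule diam_attained)
      hence "0 \<le> D" using dist_nonneg by metis
      hence "1 \<le> log 2 (2 + D / \<epsilon>)" using \<epsilon> by (intro log2_ge_1) simp
      moreover have "is_tester X d p \<epsilon> 0 (\<lambda>_. return_pmf True)"
        by (simp add: is_tester_def none accept_prob_def)
      ultimately show ?thesis using C
        by (intro exI[of _ 0] exI[of _ "\<lambda>_. return_pmf True"])
           (auto simp: K_def upper_rate_nonneg intro!: mult_nonneg_nonneg)
    qed
    fix n T assume far: "far_dists X d p \<epsilon> \<noteq> {}" and T: "is_tester X d p \<epsilon> n T"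
    have "lower_rate X d p \<epsilon> N \<pi> \<le> B * real n"
      unfolding B_def using nets by (intro lower_rate_le[OF \<epsilon> T far m]) auto
    thus "1 / B * lower_rate X d p \<epsilon> N \<pi> \<le> real n" using B by (simp add: field_simps)
  qed
qed

end
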